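(* Let $\alpha\in(0,1)$ and $T>0$. Let $(\tilde V_n)_{n\ge1}$ be the size-biased ordering of the points of the random mass-partition $\sum_{T_i\le 1}\delta_{P_i/\tau_1}$, and let $U$ be uniformly distributed on $(0,1)$ and independent of $(\tilde V_n)$. Then, with all remaining notation as defined in the context, $$\left(\frac{A_T}{T},\ \sum_{T_i<L_T}\delta_{P_i/T},\ \frac{B_T}{T}\right)\ \stackrel{d}{=}\ \left(\frac{A_\Gamma}{\Gamma},\ \frac{N^\vee_{T_1^\wedge}}{\Gamma},\ \frac{B_\Gamma}{\Gamma}\right)\ \stackrel{d}{=}\ \left(\tilde V_1,\ \{\tilde V_j\}_{j\ge2},\ \tilde V_1\Big(\frac{1}{U^{1/\alpha}}-1\Big)\right).$$
   Context: Notation. $N=\sum_i\delta_{(T_i,P_i)}$ is a Poisson point process on $(0,\infty)^2$ with intensity $\mathrm{Leb}\times\mu_\alpha$, where $\mu_\alpha(du)=\frac{\alpha}{\Gamma(1-\alpha)}u^{-\alpha-1}du$, i.e. $\mu_\alpha(u,\infty)=u^{-\alpha}/\Gamma(1-\alpha)$ (here $\Gamma(\cdot)$ with an argument is the gamma function). The $\alpha$-stable subordinator is $\tau_t=\tau(t)=\sum_{T_i\le t}P_i$, with left limits $\tau(t-)=\sum_{T_i<t}P_i$, and its inverse is $L_s=\inf\{t:\tau_t>s\}$. For a level $T>0$ (deterministic or random), $A_T=T-\tau(L_T-)$ is the undershoot and $B_T=\tau(L_T)-T$ is the overshoot. Let $(E_i)$ be i.i.d. standard exponential random variables independent of $N$,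 marking the points of $N$. The points with $P_i>E_i$, together with their marks, ordered by increasing time coordinate, are denoted $(T_j^\wedge,P_j^\wedge,E_j^\wedge)_{j\ge1}$; so $T_1^\wedge=\min\{T_i:P_i>E_i\}$ and $P_1^\wedge,E_1^\wedge$ are the corresponding jump and mark. The points with $P_i\le E_i$ form $N^\vee=\sum_i\delta_{(T_i^\vee,P_i^\vee)}$, and $N_s^\vee=\sum_{T_i^\vee\le s}\delta_{P_i^\vee}$ for $s>0$ (also for random $s$). Put $$\Gamma=\sum_{T_i^\vee\le T_1^\wedge}P_i^\vee+E_1^\wedge .$$ For a counting measure $\sum_i\delta_{x_i}$ and $c>0$, $c\sum_i\delta_{x_i}=\sum_i\delta_{cx_i}$ (scaling of points), so $N^\vee_{T_1^\wedge}/\Gamma$ has points $P_i^\vee/\Gamma$. A countable family $\{x_j\}$ is identified with the counting measure $\sum_j\delta_{x_j}$. The size-biased ordering of a mass-partition $\{V_i\}$ (nonnegative, $\sum_iV_i=1$) is obtained by, conditionally on $\{V_i\}$, sampling its points successively without replacement, each time choosing a remaining point with probability proportional to its size. $\stackrel{d}{=}$ denotes equality of joint laws. *)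

theory Defs
  imports "HOL-Probability.Probability"
begin

section \<open>Counting measures and their laws\<close>

text \<open>The counting measure \<open>\<Sum>i\<in>I. \<delta> (x i)\<close> on \<open>S\<close>, points counted with multiplicity.\<close>

definition points :: "'b measure \<Rightarrow> 'i set \<Rightarrow> ('i \<Rightarrow> 'b) \<Rightarrow> 'b measure" where
  "points S I x = distr (count_space I) S x"

text \<open>The space of all measures on \<open>K\<close>, with the sigma-algebra generated by the evaluations
  \<open>\<lambda>N. emeasure N A\<close>; this is \<^const>\<open>subprob_algebra\<close> without the bound on the total mass.\<close>

definition measure_algebra :: "'b measure \<Rightarrow> 'b measure measure" where
  "measure_algebra K =
    (SUP A \<in> sets K. vimage_algebra {N. sets N = sets K} (\<lambda>N. emeasure N A) borel)"

text \<open>Measurability is demanded explicitly because \<^const>\<open>distr\<close> is a junk value for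
  non-measurable functions.\<close>

definition eq_in_law :: "'w measure \<Rightarrow> 'b measure \<Rightarrow> ('w \<Rightarrow> 'b) \<Rightarrow> ('w \<Rightarrow> 'b) \<Rightarrow> bool" where
  "eq_in_law M S X Y \<longleftrightarrow> X \<in> M \<rightarrow>\<^sub>M S \<and> Y \<in> M \<rightarrow>\<^sub>M S \<and> distr M S X = distr M S Y"

text \<open>Independence of two random variables whose value types may differ
  (\<^const>\<open>prob_space.indep_var\<close> forces them to coincide).\<close>

definition indep_rvs ::
  "'w measure \<Rightarrow> 'b measure \<Rightarrow> ('w \<Rightarrow> 'b) \<Rightarrow> 'c measure \<Rightarrow> ('w \<Rightarrow> 'c) \<Rightarrow> bool" where
  "indep_rvs M S X S' Y \<longleftrightarrow> X \<in> M \<rightarrow>\<^sub>M S \<and> Y \<in> M \<rightarrow>\<^sub>M S' \<and>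
    prob_space.indep_set M (sets (vimage_algebra (space M) X S))
                           (sets (vimage_algebra (space M) Y S'))"

section \<open>The Poisson point process of jumps\<close>

text \<open>\<open>X\<close> enumerates the points of a Poisson point process with intensity \<open>\<nu>\<close>. The weights are
  those of the Poisson law, written out so as to include mean \<open>0\<close>, which \<^const>\<open>poisson_pmf\<close>
  excludes. Because points are enumerated by \<^typ>\<open>nat\<close>, this is for \<open>\<nu>\<close> of infinite mass.\<close>

definition poisson_point_process ::
  "'w measure \<Rightarrow> 'b measure \<Rightarrow> (nat \<Rightarrow> 'w \<Rightarrow> 'b) \<Rightarrow> bool" where
  "poisson_point_process M \<nu> X \<longleftrightarrow>
    (let N = (\<lambda>\<omega>. points \<nu> UNIV (\<lambda>i. X i \<omega>)) in
      (\<forall>i. X i \<in> M \<rightarrow>\<^sub>M \<nu>) \<and>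
      (\<forall>B\<in>sets \<nu>. emeasure \<nu> B < \<infinity> \<longrightarrow>
        (\<forall>k. measure M {\<omega> \<in> space M. emeasure (N \<omega>) B = of_nat k} =
          measure \<nu> B ^ k / fact k * exp (- measure \<nu> B))) \<and>
      (\<forall>F. finite F \<and> F \<subseteq> sets \<nu> \<and> disjoint F \<longrightarrow>
        prob_space.indep_vars M (\<lambda>_. borel) (\<lambda>B \<omega>. emeasure (N \<omega>) B) F))"

definition stable_jump_measure :: "real \<Rightarrow> real measure" where
  "stable_jump_measure \<alpha> =
    density (restrict_space lborel {0<..})
      (\<lambda>u. ennreal (\<alpha> / Gamma (1 - \<alpha>) * u powr (- \<alpha> - 1)))"

definition stable_intensity :: "real \<Rightarrow> (real \<times> real) measure" where
  "stable_intensity \<alpha> = restrict_space lborel {0<..} \<Otimes>\<^sub>M stable_jump_measure \<alpha>"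

section \<open>Path functionals\<close>

text \<open>In this section \<open>t\<close>, \<open>p\<close> and \<open>e\<close> are the times, sizes and marks of one realisation. Sums of
  sizes are taken in \<^typ>\<open>ennreal\<close>, so that they make sense also on the null event where they
  diverge.\<close>

definition subordinator :: "(nat \<Rightarrow> real) \<Rightarrow> (nat \<Rightarrow> real) \<Rightarrow> real \<Rightarrow> ennreal" where
  "subordinator t p s = (\<Sum>\<^sub>\<infinity>i\<in>{i. t i \<le> s}. ennreal (p i))"

definition subordinator_left :: "(nat \<Rightarrow> real) \<Rightarrow> (nat \<Rightarrow> real) \<Rightarrow> real \<Rightarrow> ennreal" where
  "subordinator_left t p s = (\<Sum>\<^sub>\<infinity>i\<in>{i. t i < s}. ennreal (p i))"

definition inverse_subordinator :: "(nat \<Rightarrow> real) \<Rightarrow> (nat \<Rightarrow> real) \<Rightarrow> real \<Rightarrow> real" where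
  "inverse_subordinator t p s = Inf {r. 0 \<le> r \<and> ennreal s < subordinator t p r}"

definition undershoot :: "(nat \<Rightarrow> real) \<Rightarrow> (nat \<Rightarrow> real) \<Rightarrow> real \<Rightarrow> real" where
  "undershoot t p s = s - enn2real (subordinator_left t p (inverse_subordinator t p s))"

definition overshoot :: "(nat \<Rightarrow> real) \<Rightarrow> (nat \<Rightarrow> real) \<Rightarrow> real \<Rightarrow> real" where
  "overshoot t p s = enn2real (subordinator t p (inverse_subordinator t p s)) - s"

text \<open>The index of the earliest point with size exceeding its mark. Almost surely there is exactly
  one such index; \<open>LEAST\<close> is only a tie-break on a null event.\<close>

definition first_cut :: "(nat \<Rightarrow> real) \<Rightarrow> (nat \<Rightarrow> real) \<Rightarrow> (nat \<Rightarrow> real) \<Rightarrow> nat" where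
  "first_cut t p e = (LEAST i. is_arg_min t (\<lambda>i. e i < p i) i)"

text \<open>The indices of the points \<open>(T\<^sub>i\<^sup>\<or>, P\<^sub>i\<^sup>\<or>)\<close> with \<open>T\<^sub>i\<^sup>\<or> \<le> T\<^sub>1\<^sup>\<and>\<close>.\<close>

definition uncut_before_first :: "(nat \<Rightarrow> real) \<Rightarrow> (nat \<Rightarrow> real) \<Rightarrow> (nat \<Rightarrow> real) \<Rightarrow> nat set" where
  "uncut_before_first t p e = {i. p i \<le> e i \<and> t i \<le> t (first_cut t p e)}"

definition cut_level :: "(nat \<Rightarrow> real) \<Rightarrow> (nat \<Rightarrow> real) \<Rightarrow> (nat \<Rightarrow> real) \<Rightarrow> real" where
  "cut_level t p e =
    enn2real (\<Sum>\<^sub>\<infinity>i\<in>uncut_before_first t p e. ennreal (p i)) + e (first_cut t p e)"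

text \<open>The mass-partition with points \<open>P\<^sub>i / \<tau>\<^sub>1\<close>, \<open>T\<^sub>i \<le> 1\<close>. The remaining indices carry mass \<open>0\<close>
  and hence are never chosen in a size-biased ordering.\<close>

definition jump_partition :: "(nat \<Rightarrow> real) \<Rightarrow> (nat \<Rightarrow> real) \<Rightarrow> nat \<Rightarrow> real" where
  "jump_partition t p i = (if t i \<le> 1 then p i / enn2real (subordinator t p 1) else 0)"

section \<open>Size-biased ordering\<close>

text \<open>The sigma-algebra generated by the whole family \<open>V\<close> and the first \<open>n\<close> choices \<open>\<sigma>\<close>.\<close>

definition choice_history ::
  "'w measure \<Rightarrow> (nat \<Rightarrow> 'w \<Rightarrow> real) \<Rightarrow> (nat \<Rightarrow> 'w \<Rightarrow> nat) \<Rightarrow> nat \<Rightarrow> 'w measure" where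
  "choice_history M V \<sigma> n =
    vimage_algebra (space M) (\<lambda>\<omega>. (\<lambda>i. V i \<omega>, \<lambda>k\<in>{..<n}. \<sigma> k \<omega>))
      ((\<Pi>\<^sub>M i\<in>UNIV. borel) \<Otimes>\<^sub>M (\<Pi>\<^sub>M k\<in>{..<n}. count_space UNIV))"

text \<open>\<open>W\<close> lists the masses of the random mass-partition \<open>V\<close> (of total mass \<open>1\<close>) in size-biased
  order, starting at index \<open>0\<close>; \<open>\<sigma> n\<close> is the index chosen in step \<open>n\<close>. As the ordering never
  stops, this is for partitions that almost surely have infinitely many positive masses.\<close>

definition size_biased_ordering ::
  "'w measure \<Rightarrow> (nat \<Rightarrow> 'w \<Rightarrow> real) \<Rightarrow> (nat \<Rightarrow> 'w \<Rightarrow> real) \<Rightarrow> bool" where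
  "size_biased_ordering M V W \<longleftrightarrow>
    (\<forall>i. V i \<in> borel_measurable M) \<and>
    (\<exists>\<sigma>. (\<forall>n. \<sigma> n \<in> M \<rightarrow>\<^sub>M count_space UNIV) \<and>
      (\<forall>n i. AE \<omega> in M.
        real_cond_exp M (choice_history M V \<sigma> n) (indicator {\<omega> \<in> space M. \<sigma> n \<omega> = i}) \<omega> =
          (if \<exists>k<n. \<sigma> k \<omega> = i then 0 else V i \<omega> / (1 - (\<Sum>k<n. V (\<sigma> k \<omega>) \<omega>)))) \<and>
      (\<forall>n. \<forall>\<omega>\<in>space M. W n \<omega> = V (\<sigma> n \<omega>) \<omega>))"

end

theory Submission
  imports Defs
begin

text \<open>
  All three triples are shown to have the same expectations. For a measurable \<open>F \<ge> 0\<close> the expectation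
  of \<open>F\<close> of each triple is
  \[ \frac{\alpha}{\Gamma(1-\alpha)} \, E \int_0^\infty \frac{y^{-\alpha}}{y + \tau_1} \int_0^1
     F \Big(\frac{y}{y + \tau_1}, \sum_{T_j \le 1} \delta_{P_j / (y + \tau_1)},
       \frac{y}{y + \tau_1} (w^{-1/\alpha} - 1)\Big) \, dw \, dy, \]
  which is called \<open>common_integral F\<close>. The main tool is the Mecke equation: the expected sum, over
  the points of a Poisson process, of a functional of the point and of the configuration of the
  other points is the integral over the intensity of the expectation of the functional of the
  point and of the whole configuration (\<open>mecke\<close>).

  \<^item> \<^emph>\<open>Fixed level.\<close> The sum over the jumps \<open>(s, u)\<close> of \<open>F\<close> of the triple at level \<open>T\<close>, if the jump
    crosses that level, i.e. \<open>\<tau>(s-) < T < \<tau>(s-) + u\<close>, has only one nonzero term. The Mecke equation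
    makes it an integral over \<open>ds u\<^sup>-\<^sup>\<alpha>\<^sup>-\<^sup>1 du\<close>; by self-similarity, the jumps before \<open>s\<close> may be replaced
    by \<open>s\<^sup>1\<^sup>/\<^sup>\<alpha>\<close> times the jumps up to time \<open>1\<close>. The substitution \<open>s = (T / (y + \<tau>\<^sub>1))\<^sup>\<alpha>\<close>,
    \<open>u = (T y / (y + \<tau>\<^sub>1)) w\<^sup>-\<^sup>1\<^sup>/\<^sup>\<alpha>\<close> eliminates \<open>T\<close> and yields the common integral
    (\<open>crossing_integral\<close>).
  \<^item> \<^emph>\<open>Size-biased ordering.\<close> The first choice is the jump \<open>i\<close> with probability \<open>P\<^sub>i / \<tau>\<^sub>1\<close>, and the
    further choices exhaust the other jumps. The sum over the first choices is again evaluated by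
    the Mecke equation: the probability becomes \<open>y / (y + \<tau>\<^sub>1)\<close>, whose product with the jump density,
    a multiple of \<open>y\<^sup>-\<^sup>\<alpha>\<^sup>-\<^sup>1\<close>, is the weight in the common integral
    (\<open>size_biased_integral\<close>, \<open>size_biased_law\<close>).
  \<^item> \<^emph>\<open>The level \<open>\<Gamma>\<close>.\<close> Given the process, a jump \<open>(s, u)\<close> is the first cut jump, with mark \<open>z\<close>, if \<open>z < u\<close>
    and no jump before \<open>s\<close> is cut; the latter has probability \<open>exp (- \<tau>(s-))\<close>. With the density
    \<open>exp (- z)\<close> of the mark, \<open>T = \<tau>(s-) + z\<close> has density \<open>exp (- T)\<close>, and \<open>z < u\<close> means that the
    jump crosses \<open>T\<close>. So the triple at \<open>\<Gamma>\<close> has the law of the triple at an independent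
    exponential level, and the law at a fixed level does not depend on the level
    (\<open>first_cut_term_given_path\<close>, \<open>first_cut_integral\<close>).

  That almost surely \<^emph>\<open>some\<close> jump crosses \<open>T\<close>, and that \<^emph>\<open>some\<close> jump is the first cut jump, needs
  no argument about the range of the subordinator. The common integral of the constant \<open>1\<close> is \<open>1\<close>
  because it is the total mass of the law of the size-biased triple; hence the expected number
  of such jumps is \<open>1\<close>, and there is never more than one of them, up to the null
  set where jump times coincide (\<open>nn_integral_unique_index\<close>). In the same way the existence of a size-biased ordering of the
  \<open>P\<^sub>i / \<tau>\<^sub>1\<close> provides \<open>0 < \<tau>\<^sub>1 < \<infinity>\<close> almost surely.

  The Mecke equation is derived from the definition of a Poisson process by its counts: on
  finitely many disjoint sets it is the identity \<open>E [K g(K - 1)] = c E [g(K)]\<close> for a Poisson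
  variable \<open>K\<close> with mean \<open>c\<close>, and the counts on such families determine a law on the space of
  measures (\<open>measure_algebra_eqI\<close>).
\<close>

section \<open>Spaces of measures\<close>

lemma space_measure_algebra: "space (measure_algebra K) = {N. sets N = sets K}"
  by (auto simp: measure_algebra_def space_Sup_eq_UN)

lemma measurable_emeasure_measure_algebra [measurable]:
  "A \<in> sets K \<Longrightarrow> (\<lambda>N. emeasure N A) \<in> borel_measurable (measure_algebra K)"
  by (auto intro!: measurable_Sup1 measurable_vimage_algebra1 simp: measure_algebra_def)

lemma measurable_measure_algebra:
  assumes "\<And>a. a \<in> space M \<Longrightarrow> sets (k a) = sets K"
    and "\<And>A. A \<in> sets K \<Longrightarrow> (\<lambda>a. emeasure (k a) A) \<in> borel_measurable M"
  shows "k \<in> M \<rightarrow>\<^sub>M measure_algebra K"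
  using assms by (auto intro!: measurable_Sup2 measurable_vimage_algebra2 simp: measure_algebra_def)

lemma measurable_emeasure_measure_algebra_compose:
  assumes "k \<in> M \<rightarrow>\<^sub>M measure_algebra K" "A \<in> sets K"
  shows "(\<lambda>a. emeasure (k a) A) \<in> borel_measurable M"
  using measurable_compose[OF assms(1) measurable_emeasure_measure_algebra[OF assms(2)]] .

lemma nn_integral_measurable_measure_algebra:
  assumes f: "f \<in> borel_measurable K"
  shows "(\<lambda>N. integral\<^sup>N N f) \<in> borel_measurable (measure_algebra K)" (is "_ \<in> ?B")
  using f
proof induct
  case (cong f g)
  moreover have "(\<lambda>N. integral\<^sup>N N f) \<in> ?B \<longleftrightarrow> (\<lambda>N. integral\<^sup>N N g) \<in> ?B"
    by (intro measurable_cong nn_integral_cong cong)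
       (auto simp: space_measure_algebra dest!: sets_eq_imp_space_eq)
  ultimately show ?case by simp
next
  case (set B)
  then have "(\<lambda>N. integral\<^sup>N N (indicator B)) \<in> ?B \<longleftrightarrow> (\<lambda>N. emeasure N B) \<in> ?B"
    by (intro measurable_cong nn_integral_indicator) (simp add: space_measure_algebra)
  with set show ?case by simp
next
  case (mult f c)
  then have "(\<lambda>N. \<integral>\<^sup>+x. c * f x \<partial>N) \<in> ?B \<longleftrightarrow> (\<lambda>N. c * integral\<^sup>N N f) \<in> ?B"
    by (intro measurable_cong nn_integral_cmult)
       (auto simp: space_measure_algebra cong: measurable_cong_sets)
  with mult show ?case by simp
next
  case (add f g)
  then have "(\<lambda>N. \<integral>\<^sup>+x. f x + g x \<partial>N) \<in> ?B \<longleftrightarrow> (\<lambda>N. integral\<^sup>N N f + integral\<^sup>N N g) \<in> ?B"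
    by (intro measurable_cong nn_integral_add)
       (auto simp: space_measure_algebra cong: measurable_cong_sets)
  with add show ?case by (simp add: ac_simps)
next
  case (seq F)
  have "(\<lambda>N. integral\<^sup>N N (SUP i. F i)) \<in> ?B \<longleftrightarrow> (\<lambda>N. SUP i. integral\<^sup>N N (F i)) \<in> ?B"
    unfolding SUP_apply using seq
    by (intro measurable_cong nn_integral_monotone_convergence_SUP)
       (auto simp: space_measure_algebra cong: measurable_cong_sets)
  moreover have "(\<lambda>N. SUP i. integral\<^sup>N N (F i)) \<in> ?B"
    using seq(3) by measurable
  ultimately show ?case by blast
qed

lemma measurable_distr_measure_algebra:
  assumes g: "g \<in> K \<rightarrow>\<^sub>M K'"
  shows "(\<lambda>N. distr N K' g) \<in> measure_algebra K \<rightarrow>\<^sub>M measure_algebra K'"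
proof (rule measurable_measure_algebra)
  fix A assume A: "A \<in> sets K'"
  have "(\<lambda>N. emeasure (distr N K' g) A) \<in> borel_measurable (measure_algebra K) \<longleftrightarrow>
      (\<lambda>N. emeasure N (g -` A \<inter> space K)) \<in> borel_measurable (measure_algebra K)"
  proof (rule measurable_cong)
    fix N assume "N \<in> space (measure_algebra K)"
    then have N: "sets N = sets K" by (simp add: space_measure_algebra)
    have "g \<in> N \<rightarrow>\<^sub>M K'" using g by (simp cong: measurable_cong_sets add: N)
    then show "emeasure (distr N K' g) A = emeasure N (g -` A \<inter> space K)"
      using A sets_eq_imp_space_eq[OF N] by (simp add: emeasure_distr)
  qed
  also have "\<dots>" using measurable_sets[OF g A] by measurable
  finally show "(\<lambda>N. emeasure (distr N K' g) A) \<in> borel_measurable (measure_algebra K)" .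
qed simp

section \<open>Counting measures\<close>

lemma infsum_ennreal_nat:
  fixes f :: "nat \<Rightarrow> ennreal"
  shows "(\<Sum>\<^sub>\<infinity>i\<in>A. f i) = (\<Sum>i. if i \<in> A then f i else 0)"
proof -
  have "(\<Sum>\<^sub>\<infinity>i\<in>A. f i) = (\<Sum>\<^sub>\<infinity>i\<in>UNIV. if i \<in> A then f i else 0)"
    by (rule infsum_cong_neutral) auto
  also have "\<dots> = (\<Sum>i. if i \<in> A then f i else 0)"
  proof -
    have "((\<lambda>i. if i \<in> A then f i else 0) has_sum (\<Sum>\<^sub>\<infinity>i\<in>UNIV. if i \<in> A then f i else 0)) UNIV"
      by (rule has_sum_infsum) (rule nonneg_summable_on_complete, simp)
    from has_sum_imp_sums[OF this] show ?thesis by (simp add: sums_iff)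
  qed
  finally show ?thesis .
qed

lemma sets_points [simp, measurable_cong]: "sets (points S I x) = sets S"
  by (simp add: points_def)

lemma space_points [simp]: "space (points S I x) = space S"
  by (simp add: points_def)

lemma nn_integral_points:
  fixes I :: "nat set"
  assumes "x \<in> I \<rightarrow> space S" "f \<in> borel_measurable S"
  shows "(\<integral>\<^sup>+y. f y \<partial>points S I x) = (\<Sum>i. if i \<in> I then f (x i) else 0)"
proof -
  have "(\<integral>\<^sup>+y. f y \<partial>points S I x) = (\<integral>\<^sup>+i. f (x i) \<partial>count_space I)"
    unfolding points_def using assms by (intro nn_integral_distr) auto
  also have "\<dots> = (\<integral>\<^sup>+i. f (x i) * indicator I i \<partial>count_space UNIV)"
    by (rule nn_integral_count_space_indicator) simp
  also have "\<dots> = (\<Sum>i. f (x i) * indicator I i)"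
    by (rule nn_integral_count_space_nat)
  also have "\<dots> = (\<Sum>i. if i \<in> I then f (x i) else 0)"
    by (intro arg_cong[where f=suminf] ext) (auto simp: indicator_def)
  finally show ?thesis .
qed

lemma emeasure_points:
  fixes I :: "nat set"
  assumes "x \<in> I \<rightarrow> space S" "A \<in> sets S"
  shows "emeasure (points S I x) A = (\<Sum>i. if i \<in> I \<and> x i \<in> A then 1 else 0)"
proof -
  have "emeasure (points S I x) A = (\<integral>\<^sup>+y. indicator A y \<partial>points S I x)"
    using assms(2) by simp
  also have "\<dots> = (\<Sum>i. if i \<in> I then indicator A (x i) else 0)"
    using assms by (intro nn_integral_points) auto
  also have "\<dots> = (\<Sum>i. if i \<in> I \<and> x i \<in> A then 1 else 0)"
    by (intro arg_cong[where f=suminf] ext) (auto simp: indicator_def)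
  finally show ?thesis .
qed

lemma points_cong:
  assumes "\<And>i. i \<in> I \<Longrightarrow> x i = y i" "I = J"
  shows "points S I x = points S J y"
  unfolding points_def assms(2)[symmetric] using assms(1) by (intro distr_cong) auto

lemma distr_points:
  assumes "x \<in> I \<rightarrow> space S" "g \<in> S \<rightarrow>\<^sub>M S'"
  shows "distr (points S I x) S' g = points S' I (\<lambda>i. g (x i))"
  using assms unfolding points_def
  by (subst distr_distr) (auto simp: comp_def)

lemma measurable_points:
  fixes I :: "'w \<Rightarrow> nat set"
  assumes I: "\<And>i. {\<omega> \<in> space M. i \<in> I \<omega>} \<in> sets M"
    and x: "\<And>i. x i \<in> M \<rightarrow>\<^sub>M S"
  shows "(\<lambda>\<omega>. points S (I \<omega>) (\<lambda>i. x i \<omega>)) \<in> M \<rightarrow>\<^sub>M measure_algebra S"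
proof (rule measurable_measure_algebra)
  fix A assume A: "A \<in> sets S"
  note [measurable] = I x A
  have "(\<lambda>\<omega>. \<Sum>i. if i \<in> I \<omega> \<and> x i \<omega> \<in> A then 1 else 0::ennreal) \<in> borel_measurable M"
    by measurable
  then show "(\<lambda>\<omega>. emeasure (points S (I \<omega>) (\<lambda>i. x i \<omega>)) A) \<in> borel_measurable M"
  proof (rule measurable_cong[THEN iffD1, rotated])
    fix \<omega> assume "\<omega> \<in> space M"
    then show "(\<Sum>i. if i \<in> I \<omega> \<and> x i \<omega> \<in> A then 1 else 0::ennreal) =
        emeasure (points S (I \<omega>) (\<lambda>i. x i \<omega>)) A"
      using A measurable_space[OF x] by (subst emeasure_points) auto
  qed
qed simp

section \<open>Poisson random measures\<close>

text \<open>Finitely many sets of finite mass are unions of finitely many disjoint ones, the cells of the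
  points of their union: two points share a cell if they belong to the same sets. The empty set is
  added to the cells to make the family nonempty in all cases.\<close>

lemma finite_disjoint_refinement:
  assumes "finite \<C>" and \<C>: "\<C> \<subseteq> {B \<in> sets \<nu>. emeasure \<nu> B < \<infinity>}"
  obtains F where "finite F" "F \<noteq> {}" "F \<subseteq> {B \<in> sets \<nu>. emeasure \<nu> B < \<infinity>}" "disjoint F"
    "\<And>C. C \<in> \<C> \<Longrightarrow> C = \<Union>{B \<in> F. B \<subseteq> C}"
proof -
  define cell where "cell x = {y \<in> \<Union>\<C>. \<forall>C\<in>\<C>. x \<in> C \<longleftrightarrow> y \<in> C}" for x
  define F where "F = insert {} (cell ` \<Union>\<C>)"
  have "F \<subseteq> insert {} ((\<lambda>S. {y \<in> \<Union>\<C>. \<forall>C\<in>\<C>. C \<in> S \<longleftrightarrow> y \<in> C}) ` Pow \<C>)"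
  proof -
    have "cell x \<in> (\<lambda>S. {y \<in> \<Union>\<C>. \<forall>C\<in>\<C>. C \<in> S \<longleftrightarrow> y \<in> C}) ` Pow \<C>" for x
      by (rule image_eqI[of _ _ "{C \<in> \<C>. x \<in> C}"]) (auto simp: cell_def)
    then show ?thesis by (auto simp: F_def)
  qed
  then have "finite F" by (rule finite_subset) (simp add: \<open>finite \<C>\<close>)
  moreover have "B \<in> sets \<nu> \<and> emeasure \<nu> B < \<infinity>" if BF: "B \<in> F" for B
  proof (cases "B = {}")
    case False
    then obtain x where x: "x \<in> \<Union>\<C>" "B = cell x" using BF False unfolding F_def by blast
    then obtain C where C: "C \<in> \<C>" "x \<in> C" by auto
    have "cell x = {y \<in> space \<nu>. y \<in> \<Union>\<C> \<and> (\<forall>D\<in>\<C>. x \<in> D \<longleftrightarrow> y \<in> D)}"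
      using \<C> by (auto simp: cell_def dest: sets.sets_into_space)
    also have "\<dots> \<in> sets \<nu>"
    proof (intro sets.sets_Collect_conj sets.sets_Collect_finite_All \<open>finite \<C>\<close>)
      have "{y \<in> space \<nu>. y \<in> \<Union> \<C>} = \<Union>\<C>"
        using \<C> by (auto dest: sets.sets_into_space)
      then show "{y \<in> space \<nu>. y \<in> \<Union> \<C>} \<in> sets \<nu>"
        using \<C> \<open>finite \<C>\<close> by auto
      show "{y \<in> space \<nu>. (x \<in> D) = (y \<in> D)} \<in> sets \<nu>" if "D \<in> \<C>" for D
      proof -
        have D: "D \<in> sets \<nu>" using that \<C> by auto
        have "{y \<in> space \<nu>. (x \<in> D) = (y \<in> D)} = (if x \<in> D then D else space \<nu> - D)"
          using sets.sets_into_space[OF D] by auto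
        then show ?thesis using D by auto
      qed
    qed
    finally have "cell x \<in> sets \<nu>" .
    moreover have "cell x \<subseteq> C" using C by (auto simp: cell_def)
    then have "emeasure \<nu> (cell x) \<le> emeasure \<nu> C"
      using C \<C> by (intro emeasure_mono) auto
    ultimately show ?thesis using C \<C> x by (auto intro: le_less_trans)
  qed auto
  moreover have "disjoint F"
  proof (rule disjointI)
    fix A B assume "A \<in> F" "B \<in> F" "A \<noteq> B"
    then show "A \<inter> B = {}" by (auto simp: F_def cell_def)
  qed
  moreover have "C = \<Union>{B \<in> F. B \<subseteq> C}" if "C \<in> \<C>" for C
  proof safe
    fix x assume "x \<in> C"
    then have "x \<in> cell x" "cell x \<in> F" "cell x \<subseteq> C"
      using that by (auto simp: cell_def F_def)
    then show "x \<in> \<Union>{B \<in> F. B \<subseteq> C}" by auto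
  qed blast
  ultimately show ?thesis by (intro that[of F]) (auto simp: F_def)
qed

text \<open>A finite measure on the space of measures is determined by the joint laws of the masses of
  finitely many disjoint sets; it suffices to consider families in which a given set \<open>A\<close> is the
  union of some members.\<close>

lemma measure_algebra_eqI:
  fixes \<nu> :: "'b measure"
  assumes "sigma_finite_measure \<nu>"
    and sets [measurable_cong]: "sets Q1 = sets (measure_algebra \<nu>)" "sets Q2 = sets (measure_algebra \<nu>)"
    and fin: "finite_measure Q1"
    and A: "A \<in> sets \<nu>" "emeasure \<nu> A < \<infinity>"
    and eq: "\<And>F. finite F \<Longrightarrow> F \<noteq> {} \<Longrightarrow> F \<subseteq> {B \<in> sets \<nu>. emeasure \<nu> B < \<infinity>} \<Longrightarrow> disjoint F \<Longrightarrow>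
        A = \<Union>{B \<in> F. B \<subseteq> A} \<Longrightarrow>
        distr Q1 (\<Pi>\<^sub>M B\<in>F. borel) (\<lambda>\<eta>. \<lambda>B\<in>F. emeasure \<eta> B) =
        distr Q2 (\<Pi>\<^sub>M B\<in>F. borel) (\<lambda>\<eta>. \<lambda>B\<in>F. emeasure \<eta> B)"
  shows "Q1 = Q2"
proof -
  interpret sigma_finite_measure \<nu> by fact
  define I where "I = {B \<in> sets \<nu>. emeasure \<nu> B < \<infinity>}"
  define \<Omega> where "\<Omega> = {N. sets N = sets \<nu>}"
  define f where "f N = (\<lambda>C\<in>I. emeasure N C)" for N :: "'b measure"
  define P :: "('b set \<Rightarrow> ennreal) measure" where "P = (\<Pi>\<^sub>M C\<in>I. borel)"
  have space_ma: "space (measure_algebra \<nu>) = \<Omega>" by (simp add: space_measure_algebra \<Omega>_def)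
  have space_Q: "space Q1 = \<Omega>" "space Q2 = \<Omega>"
    using sets_eq_imp_space_eq[OF sets(1)] sets_eq_imp_space_eq[OF sets(2)] space_ma by auto
  have f: "f \<in> measure_algebra \<nu> \<rightarrow>\<^sub>M P"
    unfolding f_def P_def by (rule measurable_restrict) (auto simp: I_def)
  then have f1: "f \<in> Q1 \<rightarrow>\<^sub>M P" and f2: "f \<in> Q2 \<rightarrow>\<^sub>M P"
    by (simp_all add: sets cong: measurable_cong_sets)
  have law: "distr Q1 P f = distr Q2 P f"
  proof (rule measure_eqI_PiM_infinite[where I=I and M="\<lambda>_. borel"])
    fix X :: "'b set \<Rightarrow> ennreal set" and J assume J: "finite J" "J \<subseteq> I"
      and X: "\<And>i. i \<in> J \<Longrightarrow> X i \<in> sets borel"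
    have "finite (insert A J)" "insert A J \<subseteq> {B \<in> sets \<nu>. emeasure \<nu> B < \<infinity>}"
      using J A by (auto simp: I_def)
    then obtain F where F: "finite F" "F \<noteq> {}" "F \<subseteq> {B \<in> sets \<nu>. emeasure \<nu> B < \<infinity>}" "disjoint F"
      and ref: "\<And>C. C \<in> insert A J \<Longrightarrow> C = \<Union>{B \<in> F. B \<subseteq> C}"
      by (rule finite_disjoint_refinement) blast
    let ?g = "\<lambda>\<eta>. \<lambda>B\<in>F. emeasure \<eta> B"
    let ?D = "{v \<in> space (\<Pi>\<^sub>M B\<in>F. borel). \<forall>C\<in>J. (\<Sum>B\<in>{B \<in> F. B \<subseteq> C}. v B) \<in> X C}"
    have D: "?D \<in> sets (\<Pi>\<^sub>M B\<in>F. borel)"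
    proof (intro sets.sets_Collect_finite_All \<open>finite J\<close>)
      fix C assume "C \<in> J"
      have "(\<lambda>v. \<Sum>B\<in>{B \<in> F. B \<subseteq> C}. v B :: ennreal) \<in> borel_measurable (\<Pi>\<^sub>M B\<in>F. borel)"
          by (intro borel_measurable_sum measurable_component_singleton[where M="\<lambda>_. borel"]) auto
      from measurable_sets[OF this X[OF \<open>C \<in> J\<close>]]
      show "{v \<in> space (\<Pi>\<^sub>M B\<in>F. borel). (\<Sum>B\<in>{B \<in> F. B \<subseteq> C}. v B) \<in> X C} \<in> sets (\<Pi>\<^sub>M B\<in>F. borel)"
        by (simp add: vimage_def Int_def conj_commute)
    qed
    have E: "prod_emb I (\<lambda>_. borel) J (Pi\<^sub>E J X) \<in> sets P"
      unfolding P_def using J X by (intro sets_PiM_I) auto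
    have g: "?g \<in> measure_algebra \<nu> \<rightarrow>\<^sub>M (\<Pi>\<^sub>M B\<in>F. borel)"
      using F by (intro measurable_restrict) auto
    then have g1: "?g \<in> Q1 \<rightarrow>\<^sub>M (\<Pi>\<^sub>M B\<in>F. borel)" and g2: "?g \<in> Q2 \<rightarrow>\<^sub>M (\<Pi>\<^sub>M B\<in>F. borel)"
      by (simp_all add: sets cong: measurable_cong_sets)
    have "f N \<in> prod_emb I (\<lambda>_. borel) J (Pi\<^sub>E J X) \<longleftrightarrow> ?g N \<in> ?D" if "N \<in> \<Omega>" for N
    proof -
      have N: "sets N = sets \<nu>" using that by (simp add: \<Omega>_def)
      have *: "(\<Sum>B\<in>{B \<in> F. B \<subseteq> C}. ?g N B) = emeasure N C" if "C \<in> J" for C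
      proof -
        have "(\<Sum>B\<in>{B \<in> F. B \<subseteq> C}. ?g N B) = (\<Sum>B\<in>{B \<in> F. B \<subseteq> C}. emeasure N B)"
          by (intro sum.cong) auto
        also have "\<dots> = emeasure N (\<Union>B\<in>{B \<in> F. B \<subseteq> C}. B)"
          using F N by (intro sum_emeasure) (auto simp: disjoint_family_on_def disjoint_def)
        also have "(\<Union>B\<in>{B \<in> F. B \<subseteq> C}. B) = C" using ref[of C] that by auto
        finally show ?thesis .
      qed
      have "f N \<in> prod_emb I (\<lambda>_. borel) J (Pi\<^sub>E J X) \<longleftrightarrow> (\<forall>C\<in>J. emeasure N C \<in> X C)"
        using J by (auto simp: prod_emb_iff f_def PiE_iff subset_eq)
      also have "\<dots> \<longleftrightarrow> ?g N \<in> ?D"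
        using * by (simp add: space_PiM del: restrict_apply)
      finally show ?thesis .
    qed
    then have vim: "f -` prod_emb I (\<lambda>_. borel) J (Pi\<^sub>E J X) \<inter> \<Omega> = ?g -` ?D \<inter> \<Omega>" by auto
    have "emeasure (distr Q1 P f) (prod_emb I (\<lambda>_. borel) J (Pi\<^sub>E J X)) =
        emeasure (distr Q1 (\<Pi>\<^sub>M B\<in>F. borel) ?g) ?D"
      using vim by (simp add: emeasure_distr f1 g1 D E space_Q)
    also have "distr Q1 (\<Pi>\<^sub>M B\<in>F. borel) ?g = distr Q2 (\<Pi>\<^sub>M B\<in>F. borel) ?g"
      using F ref[of A] by (intro eq) auto
    also have "emeasure (distr Q2 (\<Pi>\<^sub>M B\<in>F. borel) ?g) ?D =
        emeasure (distr Q2 P f) (prod_emb I (\<lambda>_. borel) J (Pi\<^sub>E J X))"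
      using vim by (simp add: emeasure_distr f2 g2 D E space_Q)
    finally show "emeasure (distr Q1 P f) (prod_emb I (\<lambda>_. borel) J (Pi\<^sub>E J X)) =
      emeasure (distr Q2 P f) (prod_emb I (\<lambda>_. borel) J (Pi\<^sub>E J X))" .
  next
    show "finite_measure (distr Q1 P f)"
      by (rule finite_measure.finite_measure_distr[OF fin f1])
  qed (simp_all add: P_def)
  \<comment> \<open>By sigma-finiteness, the masses of the sets of finite mass generate the sigma-algebra.\<close>
  have id: "(\<lambda>x. x) \<in> vimage_algebra \<Omega> f P \<rightarrow>\<^sub>M measure_algebra \<nu>"
  proof (rule measurable_measure_algebra)
    fix N assume "N \<in> space (vimage_algebra \<Omega> f P)" then show "sets N = sets \<nu>" by (simp add: \<Omega>_def)
  next
    fix C assume C: "C \<in> sets \<nu>"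
    obtain B :: "nat \<Rightarrow> 'b set" where B: "range B \<subseteq> sets \<nu>" "(\<Union>i. B i) = space \<nu>"
      "\<And>i. emeasure \<nu> (B i) \<noteq> \<infinity>" "disjoint_family B"
      using sigma_finite_disjoint by blast
    have CB: "C \<inter> B i \<in> I" for i
      using B(1,3)[of] C emeasure_mono[of "C \<inter> B i" "B i" \<nu>]
      by (auto simp: I_def top.not_eq_extremum intro: le_less_trans)
    have [measurable]: "(\<lambda>N. emeasure N (C \<inter> B i)) \<in> borel_measurable (vimage_algebra \<Omega> f P)" for i
    proof -
      have "(\<lambda>N. f N (C \<inter> B i)) \<in> borel_measurable (vimage_algebra \<Omega> f P)"
        using CB f unfolding P_def
        by (intro measurable_compose[OF measurable_vimage_algebra1 measurable_component_singleton])
           (auto simp: space_PiM f_def)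
      then show ?thesis using CB by (simp add: f_def)
    qed
    have "(\<lambda>N. emeasure N C) \<in> borel_measurable (vimage_algebra \<Omega> f P) \<longleftrightarrow>
       (\<lambda>N. \<Sum>i. emeasure N (C \<inter> B i)) \<in> borel_measurable (vimage_algebra \<Omega> f P)"
    proof (rule measurable_cong)
      fix N assume "N \<in> space (vimage_algebra \<Omega> f P)"
      then have N: "sets N = sets \<nu>" by (simp add: \<Omega>_def)
      have "(\<Sum>i. emeasure N (C \<inter> B i)) = emeasure N (\<Union>i. C \<inter> B i)"
      proof (rule suminf_emeasure)
        show "range (\<lambda>i. C \<inter> B i) \<subseteq> sets N" using B(1) C N by auto
        show "disjoint_family (\<lambda>i. C \<inter> B i)"
          using B(4) unfolding disjoint_family_on_def by blast
      qed
      also have "(\<Union>i. C \<inter> B i) = C" using B sets.sets_into_space[OF C] by auto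
      finally show "emeasure N C = (\<Sum>i. emeasure N (C \<inter> B i))" by simp
    qed
    also have "\<dots>" by measurable
    finally show "(\<lambda>N. emeasure N C) \<in> borel_measurable (vimage_algebra \<Omega> f P)" .
  qed
  show ?thesis
  proof (rule measure_eqI)
    fix G assume "G \<in> sets Q1"
    then have G: "G \<in> sets (measure_algebra \<nu>)" by (simp add: sets)
    have "G \<in> sets (vimage_algebra \<Omega> f P)"
      using measurable_sets[OF id G] sets.sets_into_space[OF G] by (simp add: space_ma Int_absorb2)
    then obtain D where D: "D \<in> sets P" "G = f -` D \<inter> \<Omega>"
      using measurable_space[OF f] by (subst (asm) sets_vimage_algebra2) (auto simp: space_ma)
    have "emeasure Q1 G = emeasure (distr Q1 P f) D"
      using D by (simp add: emeasure_distr f1 space_Q)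
    also have "\<dots> = emeasure Q2 G"
      using D by (simp add: emeasure_distr f2 space_Q law)
    finally show "emeasure Q1 G = emeasure Q2 G" .
  qed (simp add: sets)
qed

text \<open>A Poisson random measure with intensity \<open>\<nu>\<close>, as a random element of the space of measures. Unlike
  in \<^const>\<open>poisson_point_process\<close>, no enumeration of the points is given, and the independence is
  only demanded for sets of finite mass.\<close>

definition poisson_random_measure ::
  "'w measure \<Rightarrow> 'b measure \<Rightarrow> ('w \<Rightarrow> 'b measure) \<Rightarrow> bool" where
  "poisson_random_measure M \<nu> \<eta> \<longleftrightarrow>
    \<eta> \<in> M \<rightarrow>\<^sub>M measure_algebra \<nu> \<and>
    (\<forall>B\<in>sets \<nu>. emeasure \<nu> B < \<infinity> \<longrightarrow>
      (\<forall>k. measure M {\<omega> \<in> space M. emeasure (\<eta> \<omega>) B = of_nat k} =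
        measure \<nu> B ^ k / fact k * exp (- measure \<nu> B))) \<and>
    (\<forall>F. finite F \<and> F \<subseteq> {B \<in> sets \<nu>. emeasure \<nu> B < \<infinity>} \<and> disjoint F \<longrightarrow>
      prob_space.indep_vars M (\<lambda>_. borel) (\<lambda>B \<omega>. emeasure (\<eta> \<omega>) B) F)"

lemma (in prob_space) nn_integral_poisson:
  fixes Y :: "'a \<Rightarrow> ennreal" and c :: real
  assumes Y [measurable]: "Y \<in> borel_measurable M" and "0 \<le> c"
    and pois: "\<And>k::nat. prob {\<omega> \<in> space M. Y \<omega> = of_nat k} = c ^ k / fact k * exp (- c)"
    and g [measurable]: "g \<in> borel_measurable borel"
  shows "(\<integral>\<^sup>+\<omega>. g (Y \<omega>) \<partial>M) = (\<Sum>k. ennreal (c ^ k / fact k * exp (- c)) * g (of_nat k))"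
proof -
  have [measurable]: "{\<omega> \<in> space M. Y \<omega> = of_nat k} \<in> sets M" for k by measurable
  have "(\<lambda>k. prob {\<omega> \<in> space M. Y \<omega> = of_nat k}) sums prob (\<Union>k::nat. {\<omega> \<in> space M. Y \<omega> = of_nat k})"
    by (rule finite_measure_UNION) (auto simp: disjoint_family_on_def)
  moreover have "(\<lambda>k. c ^ k / fact k * exp (- c)) sums (exp c * exp (- c))"
    using sums_mult2[OF exp_converges[of c], of "exp (- c)"] by (simp add: field_simps)
  \<comment> \<open>The weights add up to \<open>1\<close>, so \<open>Y\<close> is almost surely a natural number.\<close>
  ultimately have "prob (\<Union>k::nat. {\<omega> \<in> space M. Y \<omega> = of_nat k}) = 1"
    unfolding pois by (auto dest: sums_unique2 simp: exp_minus)
  then have "AE \<omega> in M. \<omega> \<in> (\<Union>k::nat. {\<omega> \<in> space M. Y \<omega> = of_nat k})"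
    by (subst (asm) prob_eq_1) auto
  then have "(\<integral>\<^sup>+\<omega>. g (Y \<omega>) \<partial>M) =
      (\<integral>\<^sup>+\<omega>. (\<Sum>k. g (of_nat k) * indicator {\<omega> \<in> space M. Y \<omega> = of_nat k} \<omega>) \<partial>M)"
  proof (intro nn_integral_cong_AE, eventually_elim)
    fix \<omega> assume "\<omega> \<in> (\<Union>k::nat. {\<omega> \<in> space M. Y \<omega> = of_nat k})"
    then obtain k0 :: nat where k0: "\<omega> \<in> space M" "Y \<omega> = of_nat k0" by auto
    have "(\<Sum>k. g (of_nat k) * indicator {\<omega> \<in> space M. Y \<omega> = of_nat k} \<omega>) =
        (\<Sum>k\<in>{k0}. g (of_nat k) * indicator {\<omega> \<in> space M. Y \<omega> = of_nat k} \<omega>)"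
      using k0 by (intro suminf_finite) auto
    then show "g (Y \<omega>) = (\<Sum>k. g (of_nat k) * indicator {\<omega> \<in> space M. Y \<omega> = of_nat k} \<omega>)"
      using k0 by simp
  qed
  also have "\<dots> = (\<Sum>k. g (of_nat k) * emeasure M {\<omega> \<in> space M. Y \<omega> = of_nat k})"
    by (subst nn_integral_suminf) (auto simp: nn_integral_cmult_indicator)
  also have "\<dots> = (\<Sum>k. ennreal (c ^ k / fact k * exp (- c)) * g (of_nat k))"
    by (simp add: emeasure_eq_measure pois mult.commute)
  finally show ?thesis .
qed

lemma (in prob_space) poisson_random_measure_joint_law:
  assumes \<eta>: "poisson_random_measure M \<nu> \<eta>"
    and F: "finite F" "F \<noteq> {}" "F \<subseteq> {B \<in> sets \<nu>. emeasure \<nu> B < \<infinity>}" "disjoint F"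
  shows "distr M (\<Pi>\<^sub>M B\<in>F. borel) (\<lambda>\<omega>. \<lambda>B\<in>F. emeasure (\<eta> \<omega>) B) =
    (\<Pi>\<^sub>M B\<in>F. distr M borel (\<lambda>\<omega>. emeasure (\<eta> \<omega>) B))"
proof (rule iffD1[OF indep_vars_iff_distr_eq_PiM'])
  show "indep_vars (\<lambda>_. borel) (\<lambda>B \<omega>. emeasure (\<eta> \<omega>) B) F"
    using \<eta> F by (auto simp: poisson_random_measure_def)
  show "(\<lambda>\<omega>. emeasure (\<eta> \<omega>) B) \<in> borel_measurable M" if "B \<in> F" for B
    using \<eta> F that
    by (intro measurable_emeasure_measure_algebra_compose[of _ _ \<nu>])
       (auto simp: poisson_random_measure_def)
qed (use F in auto)

lemma poisson_random_measure_nn_integral: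
  assumes "prob_space M" and \<eta>: "poisson_random_measure M \<nu> \<eta>"
    and B: "B \<in> sets \<nu>" "emeasure \<nu> B < \<infinity>"
    and g: "g \<in> borel_measurable borel"
  shows "(\<integral>\<^sup>+\<omega>. g (emeasure (\<eta> \<omega>) B) \<partial>M) =
    (\<Sum>k. ennreal (measure \<nu> B ^ k / fact k * exp (- measure \<nu> B)) * g (of_nat k))"
proof -
  interpret prob_space M by fact
  show ?thesis
    using \<eta> B g
    by (intro nn_integral_poisson measurable_emeasure_measure_algebra_compose[of _ _ \<nu>])
       (auto simp: poisson_random_measure_def)
qed

theorem poisson_random_measure_unique:
  assumes "sigma_finite_measure \<nu>" "prob_space M" "prob_space M'"
    and \<eta>: "poisson_random_measure M \<nu> \<eta>" and \<eta>': "poisson_random_measure M' \<nu> \<eta>'"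
  shows "distr M (measure_algebra \<nu>) \<eta> = distr M' (measure_algebra \<nu>) \<eta>'"
proof (rule measure_algebra_eqI[where A="{}" and \<nu>=\<nu>])
  interpret M: prob_space M by fact
  interpret M': prob_space M' by fact
  have m: "\<eta> \<in> M \<rightarrow>\<^sub>M measure_algebra \<nu>" "\<eta>' \<in> M' \<rightarrow>\<^sub>M measure_algebra \<nu>"
    using \<eta> \<eta>' by (auto simp: poisson_random_measure_def)
  show "finite_measure (distr M (measure_algebra \<nu>) \<eta>)"
    by (rule M.finite_measure_distr[OF m(1)])
  fix F assume F: "finite F" "F \<noteq> {}" "F \<subseteq> {B \<in> sets \<nu>. emeasure \<nu> B < \<infinity>}" "disjoint F"
  have g: "(\<lambda>\<eta>. \<lambda>B\<in>F. emeasure \<eta> B) \<in> measure_algebra \<nu> \<rightarrow>\<^sub>M (\<Pi>\<^sub>M B\<in>F. borel)"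
    using F by (intro measurable_restrict) auto
  have "distr M borel (\<lambda>\<omega>. emeasure (\<eta> \<omega>) B) = distr M' borel (\<lambda>\<omega>. emeasure (\<eta>' \<omega>) B)"
    if "B \<in> F" for B
  proof (rule measure_eqI)
    fix D assume D: "D \<in> sets (distr M borel (\<lambda>\<omega>. emeasure (\<eta> \<omega>) B))"
    have B: "B \<in> sets \<nu>" "emeasure \<nu> B < \<infinity>" using F that by auto
    have [measurable]: "D \<in> sets borel" using D by simp
    have m1: "(\<lambda>\<omega>. emeasure (\<eta> \<omega>) B) \<in> borel_measurable M"
      and m2: "(\<lambda>\<omega>. emeasure (\<eta>' \<omega>) B) \<in> borel_measurable M'"
      using measurable_emeasure_measure_algebra_compose[OF m(1) B(1)]
        measurable_emeasure_measure_algebra_compose[OF m(2) B(1)] by auto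
    have "emeasure (distr M borel (\<lambda>\<omega>. emeasure (\<eta> \<omega>) B)) D =
        (\<integral>\<^sup>+\<omega>. indicator D (emeasure (\<eta> \<omega>) B) \<partial>M)"
      using m1 by (subst nn_integral_distr[symmetric, of _ M borel]) auto
    also have "\<dots> = (\<integral>\<^sup>+\<omega>. indicator D (emeasure (\<eta>' \<omega>) B) \<partial>M')"
      by (simp add: poisson_random_measure_nn_integral[OF \<open>prob_space M\<close> \<eta> B]
        poisson_random_measure_nn_integral[OF \<open>prob_space M'\<close> \<eta>' B])
    also have "\<dots> = emeasure (distr M' borel (\<lambda>\<omega>. emeasure (\<eta>' \<omega>) B)) D"
      using m2 by (subst nn_integral_distr[symmetric, of _ M' borel]) auto
    finally show "emeasure (distr M borel (\<lambda>\<omega>. emeasure (\<eta> \<omega>) B)) D =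
        emeasure (distr M' borel (\<lambda>\<omega>. emeasure (\<eta>' \<omega>) B)) D" .
  qed simp
  then show "distr (distr M (measure_algebra \<nu>) \<eta>) (\<Pi>\<^sub>M B\<in>F. borel) (\<lambda>\<eta>. \<lambda>B\<in>F. emeasure \<eta> B) =
    distr (distr M' (measure_algebra \<nu>) \<eta>') (\<Pi>\<^sub>M B\<in>F. borel) (\<lambda>\<eta>. \<lambda>B\<in>F. emeasure \<eta> B)"
    using M.poisson_random_measure_joint_law[OF \<eta> F] M'.poisson_random_measure_joint_law[OF \<eta>' F]
    by (simp add: distr_distr g m comp_def cong: PiM_cong)
qed (use assms in auto)

section \<open>The Mecke equation\<close>

lemma suminf_ennreal_split_at:
  fixes f :: "nat \<Rightarrow> ennreal"
  shows "(\<Sum>j. f j) = f i + (\<Sum>j. if j = i then 0 else f j)"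
proof -
  have "(\<Sum>j. f j) = (\<Sum>j. (if j = i then f i else 0) + (if j = i then 0 else f j))"
    by (intro arg_cong[where f=suminf] ext) auto
  also have "\<dots> = (\<Sum>j. if j = i then f i else 0) + (\<Sum>j. if j = i then 0 else f j)"
    by (intro suminf_add[symmetric] summableI)
  also have "(\<Sum>j. if j = i then f i else 0) = (\<Sum>j\<in>{i}. if j = i then f i else 0)"
    by (rule suminf_finite) auto
  finally show ?thesis by simp
qed

lemma emeasure_points_remove:
  assumes x: "\<And>j::nat. x j \<in> space S" and B: "B \<in> sets S"
  shows "emeasure (points S (UNIV - {i}) x) B = emeasure (points S UNIV x) B - indicator B (x i)"
proof -
  have "emeasure (points S UNIV x) B = indicator B (x i) + emeasure (points S (UNIV - {i}) x) B"
  proof -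
    have "emeasure (points S UNIV x) B = (\<Sum>j. if x j \<in> B then 1 else 0)"
      using x B by (subst emeasure_points) auto
    also have "\<dots> = (if x i \<in> B then 1 else 0) + (\<Sum>j. if j = i then 0 else if x j \<in> B then 1 else 0)"
      by (rule suminf_ennreal_split_at)
    also have "(\<Sum>j. if j = i then 0 else if x j \<in> B then 1 else 0) = emeasure (points S (UNIV - {i}) x) B"
      using x B by (subst emeasure_points) (auto intro!: arg_cong[where f=suminf])
    finally show ?thesis by (simp add: indicator_def)
  qed
  then show ?thesis by (simp add: indicator_def)
qed

lemma poisson_point_process_points_measurable:
  assumes "poisson_point_process M \<nu> X"
  shows "(\<lambda>\<omega>. points \<nu> I (\<lambda>i. X i \<omega>)) \<in> M \<rightarrow>\<^sub>M measure_algebra \<nu>"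
  using assms by (intro measurable_points) (auto simp: poisson_point_process_def Let_def)

lemma poisson_point_process_random_measure:
  assumes "poisson_point_process M \<nu> X"
  shows "poisson_random_measure M \<nu> (\<lambda>\<omega>. points \<nu> UNIV (\<lambda>i. X i \<omega>))"
  using assms poisson_point_process_points_measurable[OF assms, of UNIV]
  by (auto simp: poisson_random_measure_def poisson_point_process_def Let_def)

text \<open>Size-biasing a Poisson variable amounts to adding one.\<close>

lemma poisson_random_measure_size_bias:
  assumes "prob_space M" and \<eta>: "poisson_random_measure M \<nu> \<eta>"
    and B: "B \<in> sets \<nu>" "emeasure \<nu> B < \<infinity>"
    and g [measurable]: "g \<in> borel_measurable borel"
  shows "(\<integral>\<^sup>+\<omega>. emeasure (\<eta> \<omega>) B * g (emeasure (\<eta> \<omega>) B - 1) \<partial>M) =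
    emeasure \<nu> B * (\<integral>\<^sup>+\<omega>. g (emeasure (\<eta> \<omega>) B) \<partial>M)"
proof -
  let ?c = "measure \<nu> B"
  let ?p = "\<lambda>k. ennreal (?c ^ k / fact k * exp (- ?c))"
  have p: "?p (Suc k) * of_nat (Suc k) = ennreal ?c * ?p k" for k
  proof -
    have "?p (Suc k) * of_nat (Suc k) = ennreal (?c ^ Suc k / fact (Suc k) * exp (- ?c) * real (Suc k))"
      by (subst ennreal_of_nat_eq_real_of_nat, subst ennreal_mult[symmetric]) auto
    also have "?c ^ Suc k / fact (Suc k) * exp (- ?c) * real (Suc k) = ?c * (?c ^ k / fact k * exp (- ?c))"
      by (simp add: fact_Suc field_simps del: of_nat_Suc)
    finally show ?thesis by (simp only: ennreal_mult'[OF measure_nonneg])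
  qed
  have "(\<integral>\<^sup>+\<omega>. emeasure (\<eta> \<omega>) B * g (emeasure (\<eta> \<omega>) B - 1) \<partial>M) =
      (\<Sum>k. ?p k * (of_nat k * g (of_nat k - 1)))"
    by (subst poisson_random_measure_nn_integral[OF assms(1) \<eta> B, where g="\<lambda>n. n * g (n - 1)"]) auto
  also have "\<dots> = (\<Sum>k. ?p (k + 1) * (of_nat (k + 1) * g (of_nat (k + 1) - 1)))"
    by (subst suminf_offset[where i=1]) (auto intro: summableI)
  also have "\<dots> = (\<Sum>k. ennreal ?c * (?p k * g (of_nat k)))"
  proof (intro arg_cong[where f=suminf] ext)
    fix k
    have "of_nat (k + 1) - 1 = (of_nat k :: ennreal)"
      using ennreal_add_diff_cancel_left[of 1 "of_nat k"] by simp
    then show "?p (k + 1) * (of_nat (k + 1) * g (of_nat (k + 1) - 1)) = ennreal ?c * (?p k * g (of_nat k))"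
      using p[of k] by (metis Suc_eq_plus1 mult.assoc)
  qed
  also have "\<dots> = ennreal ?c * (\<Sum>k. ?p k * g (of_nat k))" by simp
  also have "\<dots> = emeasure \<nu> B * (\<integral>\<^sup>+\<omega>. g (emeasure (\<eta> \<omega>) B) \<partial>M)"
    using B by (simp add: poisson_random_measure_nn_integral[OF assms(1) \<eta> B g] emeasure_eq_ennreal_measure)
  finally show ?thesis .
qed

text \<open>The same for one of finitely many disjoint sets and jointly with the masses of the others: these
  are independent of it, so that Fubini's theorem reduces the claim to one variable.\<close>

lemma (in prob_space) poisson_random_measure_joint_size_bias:
  assumes \<eta>: "poisson_random_measure M \<nu> \<eta>"
    and F: "finite F" "F \<subseteq> {B \<in> sets \<nu>. emeasure \<nu> B < \<infinity>}" "disjoint F" and B: "B \<in> F"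
    and h: "h \<in> borel_measurable (\<Pi>\<^sub>M B\<in>F. borel)"
  shows "(\<integral>\<^sup>+\<omega>. emeasure (\<eta> \<omega>) B * h ((\<lambda>C\<in>F. emeasure (\<eta> \<omega>) C)(B := emeasure (\<eta> \<omega>) B - 1)) \<partial>M) =
    emeasure \<nu> B * (\<integral>\<^sup>+\<omega>. h (\<lambda>C\<in>F. emeasure (\<eta> \<omega>) C) \<partial>M)"
proof -
  define \<pi> where "\<pi> C = distr M borel (\<lambda>\<omega>. emeasure (\<eta> \<omega>) C)" for C
  define F' where "F' = F - {B}"
  have F': "F = insert B F'" "B \<notin> F'" "finite F'" using B F by (auto simp: F'_def)
  have m [measurable]: "(\<lambda>\<omega>. emeasure (\<eta> \<omega>) C) \<in> borel_measurable M" if "C \<in> F" for C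
    using \<eta> F that by (intro measurable_emeasure_measure_algebra_compose[of _ _ \<nu>])
      (auto simp: poisson_random_measure_def)
  have ps: "prob_space (\<pi> C)" if "C \<in> F" for C
    unfolding \<pi>_def using that by (intro prob_space_distr) auto
  define \<rho> where "\<rho> C = (if C \<in> F then \<pi> C else return borel 0)" for C
  have "sigma_finite_measure (\<rho> C)" for C
    by (cases "C \<in> F") (auto simp: \<rho>_def intro!: prob_space_imp_sigma_finite ps prob_space_return)
  then interpret product_sigma_finite \<rho>
    by (simp add: product_sigma_finite_def)
  have law: "distr M (\<Pi>\<^sub>M B\<in>F. borel) (\<lambda>\<omega>. \<lambda>B\<in>F. emeasure (\<eta> \<omega>) B) = PiM F \<rho>"
    using poisson_random_measure_joint_law[OF \<eta> F(1) _ F(2,3)] B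
    by (auto simp: \<rho>_def \<pi>_def cong: PiM_cong)
  have sets_\<rho> [measurable_cong]: "sets (\<rho> C) = sets borel" for C by (simp add: \<rho>_def \<pi>_def)
  have sets_P [measurable_cong]: "sets (PiM F \<rho>) = sets (\<Pi>\<^sub>M B\<in>F. borel)" "sets (PiM F' \<rho>) = sets (\<Pi>\<^sub>M B\<in>F'. borel)"
    by (auto intro!: sets_PiM_cong simp: sets_\<rho>)
  have h1 [measurable]: "h \<in> borel_measurable (PiM F \<rho>)"
    using h by (simp cong: measurable_cong_sets add: sets_P)
  have r [measurable]: "(\<lambda>\<omega>. \<lambda>C\<in>F. emeasure (\<eta> \<omega>) C) \<in> M \<rightarrow>\<^sub>M (\<Pi>\<^sub>M B\<in>F. borel)"
    by (rule measurable_restrict) auto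
  have c [measurable]: "(\<lambda>v. v B) \<in> borel_measurable (PiM F \<rho>)"
    using measurable_component_singleton[of B F \<rho>] B by (simp add: sets_\<rho> cong: measurable_cong_sets)
  have u [measurable]: "(\<lambda>v. v(B := v B - 1)) \<in> PiM F \<rho> \<rightarrow>\<^sub>M PiM F \<rho>"
    by (rule measurable_fun_upd[where J=F]) (use B in \<open>auto simp: sets_\<rho> cong: measurable_cong_sets\<close>)
  have hu: "(\<lambda>v. v B * h (v(B := v B - 1))) \<in> borel_measurable (PiM F \<rho>)"
    using measurable_compose[OF u h1] by measurable
  have "(\<integral>\<^sup>+\<omega>. emeasure (\<eta> \<omega>) B * h ((\<lambda>C\<in>F. emeasure (\<eta> \<omega>) C)(B := emeasure (\<eta> \<omega>) B - 1)) \<partial>M) =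
      (\<integral>\<^sup>+v. v B * h (v(B := v B - 1)) \<partial>PiM F \<rho>)"
    unfolding law[symmetric] using hu B
    by (subst nn_integral_distr) (auto simp: sets_P cong: measurable_cong_sets)
  also have "\<dots> = (\<integral>\<^sup>+v. (\<integral>\<^sup>+n. n * h (v(B := n - 1)) \<partial>\<rho> B) \<partial>PiM F' \<rho>)"
    using hu F' by (subst F'(1), subst product_nn_integral_insert) auto
  also have "\<dots> = (\<integral>\<^sup>+v. emeasure \<nu> B * (\<integral>\<^sup>+n. h (v(B := n)) \<partial>\<rho> B) \<partial>PiM F' \<rho>)"
  proof (rule nn_integral_cong)
    fix v assume v: "v \<in> space (PiM F' \<rho>)"
    have "(\<lambda>n. v(B := n)) \<in> borel \<rightarrow>\<^sub>M PiM F \<rho>"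
      by (rule measurable_fun_upd[where J=F']) (use F' v in \<open>auto simp: sets_\<rho> cong: measurable_cong_sets\<close>)
    from measurable_compose[OF this h1]
    have hv [measurable]: "(\<lambda>n. h (v(B := n))) \<in> borel_measurable borel" .
    have BF: "B \<in> sets \<nu>" "emeasure \<nu> B < \<infinity>" using B F by auto
    have "(\<integral>\<^sup>+n. n * h (v(B := n - 1)) \<partial>\<rho> B) =
        (\<integral>\<^sup>+\<omega>. emeasure (\<eta> \<omega>) B * h (v(B := emeasure (\<eta> \<omega>) B - 1)) \<partial>M)"
      using B by (simp add: \<rho>_def \<pi>_def nn_integral_distr)
    also have "\<dots> = emeasure \<nu> B * (\<integral>\<^sup>+\<omega>. h (v(B := emeasure (\<eta> \<omega>) B)) \<partial>M)"
      by (rule poisson_random_measure_size_bias[OF prob_space_axioms \<eta> BF hv])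
    also have "(\<integral>\<^sup>+\<omega>. h (v(B := emeasure (\<eta> \<omega>) B)) \<partial>M) = (\<integral>\<^sup>+n. h (v(B := n)) \<partial>\<rho> B)"
      using B by (simp add: \<rho>_def \<pi>_def nn_integral_distr)
    finally show "(\<integral>\<^sup>+n. n * h (v(B := n - 1)) \<partial>\<rho> B) = emeasure \<nu> B * (\<integral>\<^sup>+n. h (v(B := n)) \<partial>\<rho> B)" .
  qed
  also have "\<dots> = emeasure \<nu> B * (\<integral>\<^sup>+v. (\<integral>\<^sup>+n. h (v(B := n)) \<partial>\<rho> B) \<partial>PiM F' \<rho>)"
  proof (rule nn_integral_cmult)
    have "(\<lambda>(v, n). v(B := n)) \<in> PiM F' \<rho> \<Otimes>\<^sub>M \<rho> B \<rightarrow>\<^sub>M PiM F \<rho>"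
      using measurable_add_dim[of B F' \<rho>] F' by simp
    from measurable_compose[OF this h1]
    have "(\<lambda>(v, n). h (v(B := n))) \<in> borel_measurable (PiM F' \<rho> \<Otimes>\<^sub>M \<rho> B)"
      by (simp add: split_beta')
    then show "(\<lambda>v. \<integral>\<^sup>+n. h (v(B := n)) \<partial>\<rho> B) \<in> borel_measurable (PiM F' \<rho>)"
      by (rule sigma_finite_measure.borel_measurable_nn_integral[OF sigma_finite_measures])
  qed
  also have "(\<integral>\<^sup>+v. (\<integral>\<^sup>+n. h (v(B := n)) \<partial>\<rho> B) \<partial>PiM F' \<rho>) = (\<integral>\<^sup>+v. h v \<partial>PiM F \<rho>)"
    using h1 F' by (subst F'(1), subst product_nn_integral_insert) auto
  also have "\<dots> = (\<integral>\<^sup>+\<omega>. h (\<lambda>C\<in>F. emeasure (\<eta> \<omega>) C) \<partial>M)"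
    unfolding law[symmetric] using h by (subst nn_integral_distr) auto
  finally show ?thesis .
qed

lemma nn_integral_count_space_nat_pair:
  assumes "sigma_finite_measure M" "f \<in> borel_measurable (count_space (UNIV::nat set) \<Otimes>\<^sub>M M)"
  shows "(\<integral>\<^sup>+z. f z \<partial>(count_space UNIV \<Otimes>\<^sub>M M)) = (\<integral>\<^sup>+\<omega>. (\<Sum>i. f (i, \<omega>)) \<partial>M)"
proof -
  interpret M: sigma_finite_measure M by fact
  interpret pair_sigma_finite "count_space (UNIV::nat set)" M
    by unfold_locales (rule sigma_finite_measure.sigma_finite_countable[OF sigma_finite_measure_count_space])
  show ?thesis using assms(2) by (simp add: nn_integral_snd[symmetric] nn_integral_count_space_nat)
qed

text \<open>The Mecke equation as an identity of measures. Points are removed by index, so the equation is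
  correct also where points coincide.\<close>

theorem (in prob_space) mecke_law:
  assumes "sigma_finite_measure \<nu>" and X: "poisson_point_process M \<nu> X"
  shows "\<nu> \<Otimes>\<^sub>M distr M (measure_algebra \<nu>) (\<lambda>\<omega>. points \<nu> UNIV (\<lambda>i. X i \<omega>)) =
    distr (count_space UNIV \<Otimes>\<^sub>M M) (\<nu> \<Otimes>\<^sub>M measure_algebra \<nu>)
      (\<lambda>(i, \<omega>). (X i \<omega>, points \<nu> (UNIV - {i}) (\<lambda>j. X j \<omega>)))"
    (is "_ = ?Q")
proof (rule pair_measure_eqI)
  interpret \<nu>: sigma_finite_measure \<nu> by fact
  let ?N = "\<lambda>\<omega>. points \<nu> UNIV (\<lambda>i. X i \<omega>)"
  let ?R = "\<lambda>i \<omega>. points \<nu> (UNIV - {i}) (\<lambda>j. X j \<omega>)"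
  let ?C = "count_space (UNIV :: nat set) \<Otimes>\<^sub>M M"
  have mN [measurable]: "?N \<in> M \<rightarrow>\<^sub>M measure_algebra \<nu>" "\<And>i. ?R i \<in> M \<rightarrow>\<^sub>M measure_algebra \<nu>"
    using poisson_point_process_points_measurable[OF X] by auto
  have mX [measurable]: "\<And>i. X i \<in> M \<rightarrow>\<^sub>M \<nu>"
    using X by (simp add: poisson_point_process_def Let_def)
  have spX: "X i \<omega> \<in> space \<nu>" if "\<omega> \<in> space M" for i \<omega>
    using measurable_space[OF mX that] .
  have mXC [measurable]: "(\<lambda>(i, \<omega>). X i \<omega>) \<in> ?C \<rightarrow>\<^sub>M \<nu>"
    by (rule measurable_pair_measure_countable1) auto
  have mRC [measurable]: "(\<lambda>(i, \<omega>). ?R i \<omega>) \<in> ?C \<rightarrow>\<^sub>M measure_algebra \<nu>"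
    by (rule measurable_pair_measure_countable1) auto
  have mXR: "(\<lambda>(i, \<omega>). (X i \<omega>, ?R i \<omega>)) \<in> ?C \<rightarrow>\<^sub>M \<nu> \<Otimes>\<^sub>M measure_algebra \<nu>"
    using measurable_Pair[OF mXC mRC] by (simp add: split_beta')
  have prm: "poisson_random_measure M \<nu> ?N" by (rule poisson_point_process_random_measure[OF X])
  have Q: "emeasure ?Q (A \<times> G) = (\<integral>\<^sup>+\<omega>. (\<Sum>i. indicator A (X i \<omega>) * indicator G (?R i \<omega>)) \<partial>M)"
    if [measurable]: "A \<in> sets \<nu>" "G \<in> sets (measure_algebra \<nu>)" for A G
  proof -
    have "emeasure ?Q (A \<times> G) = (\<integral>\<^sup>+z. indicator (A \<times> G) z \<partial>?Q)" by simp
    also have "\<dots> = (\<integral>\<^sup>+(i, \<omega>). indicator A (X i \<omega>) * indicator G (?R i \<omega>) \<partial>?C)"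
      by (subst nn_integral_distr[OF mXR]) (auto simp: split_beta' indicator_times)
    also have "\<dots> = (\<integral>\<^sup>+\<omega>. (\<Sum>i. indicator A (X i \<omega>) * indicator G (?R i \<omega>)) \<partial>M)"
      by (subst nn_integral_count_space_nat_pair) (auto simp: sigma_finite_measure_axioms)
    finally show ?thesis .
  qed
  \<comment> \<open>For a fixed set \<open>A\<close> of finite mass, both sides are finite measures in \<open>G\<close>, and it suffices to
    compare the masses of finitely many disjoint sets of which some have union \<open>A\<close>.\<close>
  have fin: "emeasure \<nu> A * emeasure (distr M (measure_algebra \<nu>) ?N) G = emeasure ?Q (A \<times> G)"
    if A [measurable]: "A \<in> sets \<nu>" and Af: "emeasure \<nu> A < \<infinity>"
      and G [measurable]: "G \<in> sets (measure_algebra \<nu>)" for A G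
  proof -
    define Q1 where "Q1 = density (distr M (measure_algebra \<nu>) ?N) (\<lambda>_. emeasure \<nu> A)"
    define Q2 where "Q2 = distr (density ?C (\<lambda>(i, \<omega>). indicator A (X i \<omega>))) (measure_algebra \<nu>) (\<lambda>(i, \<omega>). ?R i \<omega>)"
    have int1: "(\<integral>\<^sup>+\<eta>. h \<eta> \<partial>Q1) = emeasure \<nu> A * (\<integral>\<^sup>+\<omega>. h (?N \<omega>) \<partial>M)"
      if [measurable]: "h \<in> borel_measurable (measure_algebra \<nu>)" for h
      unfolding Q1_def by (simp add: nn_integral_density nn_integral_cmult nn_integral_distr)
    have int2: "(\<integral>\<^sup>+\<eta>. h \<eta> \<partial>Q2) = (\<integral>\<^sup>+\<omega>. (\<Sum>i. indicator A (X i \<omega>) * h (?R i \<omega>)) \<partial>M)"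
      if [measurable]: "h \<in> borel_measurable (measure_algebra \<nu>)" for h
    proof -
      have "(\<integral>\<^sup>+\<eta>. h \<eta> \<partial>Q2) = (\<integral>\<^sup>+(i, \<omega>). indicator A (X i \<omega>) * h (?R i \<omega>) \<partial>?C)"
        unfolding Q2_def by (simp add: nn_integral_distr nn_integral_density split_beta')
      also have "\<dots> = (\<integral>\<^sup>+\<omega>. (\<Sum>i. indicator A (X i \<omega>) * h (?R i \<omega>)) \<partial>M)"
        by (subst nn_integral_count_space_nat_pair) (auto simp: sigma_finite_measure_axioms)
      finally show ?thesis .
    qed
    have "Q1 = Q2"
    proof (rule measure_algebra_eqI[where A=A and \<nu>=\<nu>])
      show "finite_measure Q1"
        by (rule finite_measureI) (use Af int1[of "\<lambda>_. 1"] in \<open>simp add: emeasure_space_1\<close>)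
      fix F assume F: "finite F" "F \<noteq> {}" "F \<subseteq> {B \<in> sets \<nu>. emeasure \<nu> B < \<infinity>}" "disjoint F"
        and AF: "A = \<Union>{B \<in> F. B \<subseteq> A}"
      let ?P = "\<Pi>\<^sub>M B\<in>F. (borel :: ennreal measure)"
      let ?g = "\<lambda>\<eta>. \<lambda>B\<in>F. emeasure \<eta> B"
      let ?FA = "{B \<in> F. B \<subseteq> A}"
      have g [measurable]: "?g \<in> measure_algebra \<nu> \<rightarrow>\<^sub>M ?P"
        using F by (intro measurable_restrict) auto
      have sFA: "(\<Sum>B\<in>?FA. f B) = f C" if "C \<in> ?FA" "\<And>B. B \<in> ?FA \<Longrightarrow> B \<noteq> C \<Longrightarrow> f B = 0" for f :: "'b set \<Rightarrow> ennreal" and C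
        using sum.mono_neutral_right[of ?FA "{C}" f] that F(1) by auto
      have indA: "indicator A x = (\<Sum>B\<in>?FA. indicator B x :: ennreal)" for x
      proof (cases "x \<in> A")
        case True
        then obtain C where C: "C \<in> ?FA" "x \<in> C" using AF by blast
        then have "indicator B x = (0::ennreal)" if "B \<in> ?FA" "B \<noteq> C" for B
          using F(4) that by (auto simp: disjoint_def indicator_def)
        from sFA[OF C(1) this] show ?thesis using True C by simp
      next
        case False
        then have "(\<Sum>B\<in>?FA. indicator B x :: ennreal) = 0"
          by (intro sum.neutral) (auto simp: indicator_def)
        then show ?thesis using False by simp
      qed
      have \<nu>A: "emeasure \<nu> A = (\<Sum>B\<in>?FA. emeasure \<nu> B)"
      proof -
        have "(\<Sum>B\<in>?FA. emeasure \<nu> B) = emeasure \<nu> (\<Union>B\<in>?FA. B)"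
          using F by (intro sum_emeasure) (auto simp: disjoint_family_on_def disjoint_def)
        also have "(\<Union>B\<in>?FA. B) = A" using AF by auto
        finally show ?thesis by simp
      qed
      show "distr Q1 ?P ?g = distr Q2 ?P ?g"
      proof (rule measure_eqI)
        fix D assume "D \<in> sets (distr Q1 ?P ?g)"
        then have D [measurable]: "D \<in> sets ?P" by simp
        have hD: "(\<lambda>\<eta>. indicator D (?g \<eta>) :: ennreal) \<in> borel_measurable (measure_algebra \<nu>)"
          by measurable
        have "emeasure (distr Q2 ?P ?g) D = (\<integral>\<^sup>+\<eta>. indicator D (?g \<eta>) \<partial>Q2)"
          by (subst nn_integral_distr[symmetric, where M'="?P"]) (auto simp: Q2_def)
        also have "\<dots> = (\<integral>\<^sup>+\<omega>. (\<Sum>i. indicator A (X i \<omega>) * indicator D (?g (?R i \<omega>))) \<partial>M)"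
          by (rule int2[OF hD])
        also have "\<dots> = (\<integral>\<^sup>+\<omega>. (\<Sum>B\<in>?FA. emeasure (?N \<omega>) B * indicator D ((?g (?N \<omega>))(B := emeasure (?N \<omega>) B - 1))) \<partial>M)"
        proof (rule nn_integral_cong)
          fix \<omega> assume \<omega>: "\<omega> \<in> space M"
          have "(\<Sum>i. indicator A (X i \<omega>) * indicator D (?g (?R i \<omega>))) =
              (\<Sum>i. \<Sum>B\<in>?FA. indicator B (X i \<omega>) * indicator D (?g (?R i \<omega>)) :: ennreal)"
            by (simp add: indA sum_distrib_right)
          also have "\<dots> = (\<Sum>B\<in>?FA. \<Sum>i. indicator B (X i \<omega>) * indicator D (?g (?R i \<omega>)))"
            by (rule suminf_sum) (rule summableI)
          also have "\<dots> = (\<Sum>B\<in>?FA. emeasure (?N \<omega>) B * indicator D ((?g (?N \<omega>))(B := emeasure (?N \<omega>) B - 1)))"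
          proof (rule sum.cong[OF refl])
            fix B assume B: "B \<in> ?FA"
            let ?v = "(?g (?N \<omega>))(B := emeasure (?N \<omega>) B - 1)"
            \<comment> \<open>Removing a point in \<open>B\<close> lowers the count in \<open>B\<close> by one and leaves the other counts unchanged.\<close>
            have "?g (?R i \<omega>) = ?v" if "X i \<omega> \<in> B" for i
            proof
              fix C
              show "?g (?R i \<omega>) C = ?v C"
                using F B that \<omega> spX
                by (auto simp: emeasure_points_remove disjoint_def indicator_def subset_eq)
            qed
            then have "(\<Sum>i. indicator B (X i \<omega>) * indicator D (?g (?R i \<omega>))) =
                (\<Sum>i. indicator B (X i \<omega>) * indicator D ?v :: ennreal)"
              by (intro arg_cong[where f=suminf] ext) (auto simp: indicator_def)
            also have "\<dots> = (\<Sum>i. indicator B (X i \<omega>)) * indicator D ?v" by simp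
            also have "(\<Sum>i. indicator B (X i \<omega>)) = emeasure (?N \<omega>) B"
              using B F \<omega> spX by (subst emeasure_points) (auto simp: indicator_def intro!: arg_cong[where f=suminf])
            finally show "(\<Sum>i. indicator B (X i \<omega>) * indicator D (?g (?R i \<omega>))) =
              emeasure (?N \<omega>) B * indicator D ?v" .
          qed
          finally show "(\<Sum>i. indicator A (X i \<omega>) * indicator D (?g (?R i \<omega>))) =
              (\<Sum>B\<in>?FA. emeasure (?N \<omega>) B * indicator D ((?g (?N \<omega>))(B := emeasure (?N \<omega>) B - 1)))" .
        qed
        also have "\<dots> = (\<Sum>B\<in>?FA. \<integral>\<^sup>+\<omega>. emeasure (?N \<omega>) B * indicator D ((?g (?N \<omega>))(B := emeasure (?N \<omega>) B - 1)) \<partial>M)"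
        proof (rule nn_integral_sum)
          fix B assume B: "B \<in> ?FA"
          have [measurable]: "(\<lambda>\<omega>. emeasure (?N \<omega>) B) \<in> borel_measurable M"
            using B F by (intro measurable_emeasure_measure_algebra_compose[OF mN(1)]) auto
          have "(\<lambda>\<omega>. (?g (?N \<omega>))(B := emeasure (?N \<omega>) B - 1)) \<in> M \<rightarrow>\<^sub>M ?P"
            by (rule measurable_fun_upd[where J=F]) (use B in auto)
          then show "(\<lambda>\<omega>. emeasure (?N \<omega>) B * indicator D ((?g (?N \<omega>))(B := emeasure (?N \<omega>) B - 1))) \<in> borel_measurable M"
            by measurable
        qed
        also have "\<dots> = (\<Sum>B\<in>?FA. emeasure \<nu> B * (\<integral>\<^sup>+\<omega>. indicator D (?g (?N \<omega>)) \<partial>M))"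
          using F by (intro sum.cong refl poisson_random_measure_joint_size_bias[OF prm]) auto
        also have "\<dots> = emeasure \<nu> A * (\<integral>\<^sup>+\<omega>. indicator D (?g (?N \<omega>)) \<partial>M)"
          by (simp add: \<nu>A sum_distrib_right)
        also have "\<dots> = (\<integral>\<^sup>+\<eta>. indicator D (?g \<eta>) \<partial>Q1)" by (rule int1[OF hD, symmetric])
        also have "\<dots> = emeasure (distr Q1 ?P ?g) D"
          by (subst nn_integral_distr[symmetric, where M'="?P"]) (auto simp: Q1_def)
        finally show "emeasure (distr Q1 ?P ?g) D = emeasure (distr Q2 ?P ?g) D" by simp
      qed simp
    qed (use A Af assms in \<open>auto simp: Q1_def Q2_def\<close>)
    then have "(\<integral>\<^sup>+\<eta>. indicator G \<eta> \<partial>Q1) = (\<integral>\<^sup>+\<eta>. indicator G \<eta> \<partial>Q2)" by simp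
    moreover have "emeasure (distr M (measure_algebra \<nu>) ?N) G = (\<integral>\<^sup>+\<omega>. indicator G (?N \<omega>) \<partial>M)"
      by (subst nn_integral_distr[symmetric, where M'="measure_algebra \<nu>"]) auto
    ultimately show ?thesis by (simp add: int1 int2 Q)
  qed
  show "sigma_finite_measure \<nu>" by fact
  show "sigma_finite_measure (distr M (measure_algebra \<nu>) ?N)"
    by (intro prob_space_imp_sigma_finite prob_space_distr) simp
  show "sets (\<nu> \<Otimes>\<^sub>M distr M (measure_algebra \<nu>) ?N) = sets ?Q" by simp
  \<comment> \<open>The general case follows by splitting \<open>A\<close> into sets of finite mass.\<close>
  fix A G assume A: "A \<in> sets \<nu>" and "G \<in> sets (distr M (measure_algebra \<nu>) ?N)"
  then have G: "G \<in> sets (measure_algebra \<nu>)" by simp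
  obtain B :: "nat \<Rightarrow> 'b set" where B: "range B \<subseteq> sets \<nu>" "(\<Union>i. B i) = space \<nu>"
    "\<And>i. emeasure \<nu> (B i) \<noteq> \<infinity>" "disjoint_family B"
    using \<nu>.sigma_finite_disjoint by blast
  have AB: "A \<inter> B i \<in> sets \<nu>" "emeasure \<nu> (A \<inter> B i) < \<infinity>" for i
    using B(1,3)[of] A emeasure_mono[of "A \<inter> B i" "B i" \<nu>]
    by (auto simp: top.not_eq_extremum intro: le_less_trans)
  have dj: "disjoint_family (\<lambda>i. A \<inter> B i)" using B(4) unfolding disjoint_family_on_def by blast
  have un: "(\<Union>i. A \<inter> B i) = A" using B(2) sets.sets_into_space[OF A] by auto
  have sum_A: "(\<Sum>i. emeasure \<nu> (A \<inter> B i)) = emeasure \<nu> (\<Union>i. A \<inter> B i)"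
    by (rule suminf_emeasure) (use AB dj in auto)
  have "emeasure \<nu> A * emeasure (distr M (measure_algebra \<nu>) ?N) G =
      (\<Sum>i. emeasure \<nu> (A \<inter> B i)) * emeasure (distr M (measure_algebra \<nu>) ?N) G"
    unfolding sum_A un ..
  also have "\<dots> = (\<Sum>i. emeasure \<nu> (A \<inter> B i) * emeasure (distr M (measure_algebra \<nu>) ?N) G)"
    by simp
  also have "\<dots> = (\<Sum>i. emeasure ?Q ((A \<inter> B i) \<times> G))"
    by (intro arg_cong[where f=suminf] ext fin AB G)
  also have "\<dots> = emeasure ?Q (\<Union>i. (A \<inter> B i) \<times> G)"
  proof (rule suminf_emeasure)
    show "range (\<lambda>i. (A \<inter> B i) \<times> G) \<subseteq> sets ?Q" using AB G by auto
    show "disjoint_family (\<lambda>i. (A \<inter> B i) \<times> G)" using dj unfolding disjoint_family_on_def by blast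
  qed
  also have "(\<Union>i. (A \<inter> B i) \<times> G) = A \<times> G" using un by blast
  finally show "emeasure \<nu> A * emeasure (distr M (measure_algebra \<nu>) ?N) G = emeasure ?Q (A \<times> G)" .
qed

corollary (in prob_space) mecke:
  assumes "sigma_finite_measure \<nu>" and X: "poisson_point_process M \<nu> X"
    and H: "H \<in> borel_measurable (\<nu> \<Otimes>\<^sub>M measure_algebra \<nu>)"
  shows "(\<integral>\<^sup>+\<omega>. (\<Sum>i. H (X i \<omega>, points \<nu> (UNIV - {i}) (\<lambda>j. X j \<omega>))) \<partial>M) =
    (\<integral>\<^sup>+x. (\<integral>\<^sup>+\<omega>. H (x, points \<nu> UNIV (\<lambda>j. X j \<omega>)) \<partial>M) \<partial>\<nu>)"
proof -
  let ?N = "\<lambda>\<omega>. points \<nu> UNIV (\<lambda>i. X i \<omega>)"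
  let ?R = "\<lambda>i \<omega>. points \<nu> (UNIV - {i}) (\<lambda>j. X j \<omega>)"
  let ?C = "count_space (UNIV :: nat set) \<Otimes>\<^sub>M M"
  have mN [measurable]: "?N \<in> M \<rightarrow>\<^sub>M measure_algebra \<nu>" "\<And>i. ?R i \<in> M \<rightarrow>\<^sub>M measure_algebra \<nu>"
    using poisson_point_process_points_measurable[OF X] by auto
  have mX [measurable]: "\<And>i. X i \<in> M \<rightarrow>\<^sub>M \<nu>"
    using X by (simp add: poisson_point_process_def Let_def)
  have mXR: "(\<lambda>(i, \<omega>). (X i \<omega>, ?R i \<omega>)) \<in> ?C \<rightarrow>\<^sub>M \<nu> \<Otimes>\<^sub>M measure_algebra \<nu>"
    by (rule measurable_pair_measure_countable1) auto
  let ?D = "distr M (measure_algebra \<nu>) ?N"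
  have sf: "sigma_finite_measure ?D"
    by (intro prob_space_imp_sigma_finite prob_space_distr) simp
  have HD: "H \<in> borel_measurable (\<nu> \<Otimes>\<^sub>M ?D)"
    using H by (simp cong: measurable_cong_sets)
  have "(\<integral>\<^sup>+\<omega>. (\<Sum>i. H (X i \<omega>, ?R i \<omega>)) \<partial>M) = (\<integral>\<^sup>+z. H ((\<lambda>(i, \<omega>). (X i \<omega>, ?R i \<omega>)) z) \<partial>?C)"
    by (subst nn_integral_count_space_nat_pair)
       (use measurable_compose[OF mXR H] in \<open>auto simp: sigma_finite_measure_axioms split_beta'\<close>)
  also have "\<dots> = (\<integral>\<^sup>+z. H z \<partial>(\<nu> \<Otimes>\<^sub>M ?D))"
    unfolding mecke_law[OF assms(1) X] by (rule nn_integral_distr[OF mXR, symmetric]) (use H in simp)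
  also have "\<dots> = (\<integral>\<^sup>+x. (\<integral>\<^sup>+\<eta>. H (x, \<eta>) \<partial>?D) \<partial>\<nu>)"
    by (rule sigma_finite_measure.nn_integral_fst[OF sf HD, symmetric])
  also have "\<dots> = (\<integral>\<^sup>+x. (\<integral>\<^sup>+\<omega>. H (x, ?N \<omega>) \<partial>M) \<partial>\<nu>)"
    by (intro nn_integral_cong nn_integral_distr mN(1)) (use measurable_Pair2[OF H] in simp)
  finally show ?thesis .
qed

section \<open>Images of Poisson point processes\<close>

lemma (in prob_space) indep_vars_reindex_inj:
  assumes "indep_vars (\<lambda>_. N) X (f ` I)" and f: "inj_on f I"
  shows "indep_vars (\<lambda>_. N) (\<lambda>i. X (f i)) I"
  unfolding indep_vars_def2
proof safe
  fix i assume "i \<in> I" then show "X (f i) \<in> M \<rightarrow>\<^sub>M N"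
    using assms(1) by (auto simp: indep_vars_def2)
next
  let ?F = "\<lambda>i. {X i -` A \<inter> space M | A. A \<in> sets N}"
  have F: "indep_sets ?F (f ` I)" using assms(1) by (simp add: indep_vars_def2)
  show "indep_sets (\<lambda>i. ?F (f i)) I"
    unfolding indep_sets_def
  proof (intro conjI ballI allI impI)
    fix i assume "i \<in> I" then show "?F (f i) \<subseteq> events"
      using F unfolding indep_sets_def by blast
  next
    fix J A assume J: "J \<subseteq> I" "J \<noteq> {}" "finite J" and A: "A \<in> Pi J (\<lambda>i. ?F (f i))"
    define A' where "A' k = A (inv_into I f k)" for k
    have A'f: "A' (f j) = A j" if "j \<in> J" for j
      using that J f by (auto simp: A'_def inv_into_f_f)
    have "A' \<in> Pi (f ` J) ?F" using A A'f by (auto simp: Pi_iff)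
    moreover have "f ` J \<subseteq> f ` I" "f ` J \<noteq> {}" "finite (f ` J)" using J by auto
    ultimately have "prob (\<Inter>k\<in>f ` J. A' k) = (\<Prod>k\<in>f ` J. prob (A' k))"
      using F unfolding indep_sets_def by blast
    moreover have "(\<Prod>k\<in>f ` J. prob (A' k)) = (\<Prod>j\<in>J. prob (A' (f j)))"
      using inj_on_subset[OF f J(1)] by (simp add: prod.reindex)
    ultimately show "prob (\<Inter>j\<in>J. A j) = (\<Prod>j\<in>J. prob (A j))"
      using A'f by (simp cong: prod.cong INF_cong_simp)
  qed
qed

text \<open>The mapping theorem for Poisson processes. Surjectivity only serves to make the preimages of
  disjoint nonempty sets distinct.\<close>

lemma (in prob_space) poisson_point_process_image:
  assumes X: "poisson_point_process M \<nu> X"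
    and A: "A \<in> sets \<nu>" and g [measurable]: "g \<in> \<nu> \<rightarrow>\<^sub>M \<kappa>" and surj: "space \<kappa> \<subseteq> g ` A"
    and int: "\<And>C. C \<in> sets \<kappa> \<Longrightarrow> emeasure \<nu> (g -` C \<inter> A) = emeasure \<kappa> C"
  shows "poisson_random_measure M \<kappa> (\<lambda>\<omega>. points \<kappa> {i. X i \<omega> \<in> A} (\<lambda>i. g (X i \<omega>)))"
proof -
  let ?N = "\<lambda>\<omega>. points \<nu> UNIV (\<lambda>i. X i \<omega>)"
  let ?\<eta> = "\<lambda>\<omega>. points \<kappa> {i. X i \<omega> \<in> A} (\<lambda>i. g (X i \<omega>))"
  define \<phi> where "\<phi> C = g -` C \<inter> A" for C
  have mX [measurable]: "\<And>i. X i \<in> M \<rightarrow>\<^sub>M \<nu>"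
    using X by (simp add: poisson_point_process_def Let_def)
  have \<phi>: "\<phi> C \<in> sets \<nu>" "emeasure \<nu> (\<phi> C) = emeasure \<kappa> C" "measure \<nu> (\<phi> C) = measure \<kappa> C"
    if "C \<in> sets \<kappa>" for C
  proof -
    have "\<phi> C = (g -` C \<inter> space \<nu>) \<inter> A" using sets.sets_into_space[OF A] by (auto simp: \<phi>_def)
    then show "\<phi> C \<in> sets \<nu>" using that A measurable_sets[OF g] by simp
    show "emeasure \<nu> (\<phi> C) = emeasure \<kappa> C" using int[OF that] by (simp add: \<phi>_def)
    then show "measure \<nu> (\<phi> C) = measure \<kappa> C" by (simp add: measure_def)
  qed
  have N\<phi>: "emeasure (?\<eta> \<omega>) C = emeasure (?N \<omega>) (\<phi> C)" if "C \<in> sets \<kappa>" "\<omega> \<in> space M" for C \<omega>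
    using that measurable_space[OF mX that(2)] measurable_space[OF g] \<phi>(1)[OF that(1)]
    by (auto simp: emeasure_points \<phi>_def intro!: arg_cong[where f=suminf])
  have prm: "poisson_random_measure M \<nu> ?N" by (rule poisson_point_process_random_measure[OF X])
  show ?thesis
    unfolding poisson_random_measure_def
  proof (intro conjI ballI allI impI)
    show "?\<eta> \<in> M \<rightarrow>\<^sub>M measure_algebra \<kappa>"
    proof (rule measurable_points)
      fix i
      show "{\<omega> \<in> space M. i \<in> {i. X i \<omega> \<in> A}} \<in> events"
        using A by simp
      show "(\<lambda>\<omega>. g (X i \<omega>)) \<in> M \<rightarrow>\<^sub>M \<kappa>" by measurable
    qed
  next
    fix C and k :: nat assume C: "C \<in> sets \<kappa>" "emeasure \<kappa> C < \<infinity>"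
    have "{\<omega> \<in> space M. emeasure (?\<eta> \<omega>) C = of_nat k} = {\<omega> \<in> space M. emeasure (?N \<omega>) (\<phi> C) = of_nat k}"
      using N\<phi>[OF C(1)] by auto
    moreover have "prob {\<omega> \<in> space M. emeasure (?N \<omega>) (\<phi> C) = of_nat k} =
        measure \<nu> (\<phi> C) ^ k / fact k * exp (- measure \<nu> (\<phi> C))"
      using prm \<phi>(1,2)[OF C(1)] C(2) by (simp add: poisson_random_measure_def)
    ultimately show "prob {\<omega> \<in> space M. emeasure (?\<eta> \<omega>) C = of_nat k} =
        measure \<kappa> C ^ k / fact k * exp (- measure \<kappa> C)"
      using \<phi>(3)[OF C(1)] by simp
  next
    fix F assume F: "finite F \<and> F \<subseteq> {B \<in> sets \<kappa>. emeasure \<kappa> B < \<infinity>} \<and> disjoint F"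
    have inj: "inj_on \<phi> F"
    proof (rule inj_onI)
      fix C D assume CD: "C \<in> F" "D \<in> F" "\<phi> C = \<phi> D"
      then have sp: "C \<subseteq> space \<kappa>" "D \<subseteq> space \<kappa>" using F by (auto dest: sets.sets_into_space)
      have "C \<subseteq> g ` \<phi> C" "D \<subseteq> g ` \<phi> D" "g ` \<phi> C \<subseteq> C" "g ` \<phi> D \<subseteq> D"
        using sp surj by (auto simp: \<phi>_def)
      then show "C = D" using CD(3) by (metis subset_antisym)
    qed
    have dj: "disjoint (\<phi> ` F)"
    proof (rule disjointI)
      fix a b assume "a \<in> \<phi> ` F" "b \<in> \<phi> ` F" "a \<noteq> b"
      then obtain C D where CD: "C \<in> F" "D \<in> F" "a = \<phi> C" "b = \<phi> D" "C \<noteq> D" by auto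
      then have "C \<inter> D = {}" using F by (auto simp: disjoint_def)
      then show "a \<inter> b = {}" using CD by (auto simp: \<phi>_def)
    qed
    have "\<phi> ` F \<subseteq> {B \<in> sets \<nu>. emeasure \<nu> B < \<infinity>}"
    proof safe
      fix C assume "C \<in> F"
      then have "C \<in> sets \<kappa>" "emeasure \<kappa> C < \<infinity>" using F by auto
      then show "\<phi> C \<in> sets \<nu>" "emeasure \<nu> (\<phi> C) < \<infinity>" using \<phi> by simp_all
    qed
    with dj F have "indep_vars (\<lambda>_. borel) (\<lambda>B \<omega>. emeasure (?N \<omega>) B) (\<phi> ` F)"
      by (intro prm[unfolded poisson_random_measure_def, THEN conjunct2, THEN conjunct2, rule_format] conjI)
        auto
    from indep_vars_reindex_inj[OF this inj]
    have iv: "indep_vars (\<lambda>_. borel) (\<lambda>C \<omega>. emeasure (?N \<omega>) (\<phi> C)) F" .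
    have eq: "(\<lambda>\<omega>. emeasure (?\<eta> \<omega>) C) -` E \<inter> space M = (\<lambda>\<omega>. emeasure (?N \<omega>) (\<phi> C)) -` E \<inter> space M"
      if "C \<in> F" for C and E :: "ennreal set"
    proof -
      have "C \<in> sets \<kappa>" using that F by auto
      from N\<phi>[OF this] show ?thesis by (auto simp: vimage_def)
    qed
    show "indep_vars (\<lambda>_. borel) (\<lambda>C \<omega>. emeasure (?\<eta> \<omega>) C) F"
      unfolding indep_vars_def2
    proof safe
      fix C assume "C \<in> F"
      then show "(\<lambda>\<omega>. emeasure (?\<eta> \<omega>) C) \<in> borel_measurable M"
        using F A by (intro measurable_emeasure_measure_algebra_compose[OF measurable_points]) auto
    next
      have "indep_sets (\<lambda>C. {(\<lambda>\<omega>. emeasure (?N \<omega>) (\<phi> C)) -` A \<inter> space M |A. A \<in> sets borel}) F"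
        using iv by (simp add: indep_vars_def2)
      then show "indep_sets (\<lambda>C. {(\<lambda>\<omega>. emeasure (?\<eta> \<omega>) C) -` A \<inter> space M |A. A \<in> sets borel}) F"
        by (rule iffD1[OF indep_sets_cong, rotated 2]) (auto simp: eq)
    qed
  qed
qed

section \<open>Sections of locally finite measures\<close>

text \<open>The mass of a section depends measurably on the section and on the measure, as far as the measure is
  finite on the members \<open>B n\<close> of a fixed partition. Without this restriction, the sets \<open>D\<close> with that
  property need not be closed under complements.\<close>

lemma measurable_emeasure_section:
  fixes B :: "nat \<Rightarrow> 'b set"
  assumes B: "range B \<subseteq> sets K" "disjoint_family B" "(\<Union>n. B n) = space K"
    and D: "D \<in> sets (Y \<Otimes>\<^sub>M K)"
  shows "(\<lambda>(y, \<eta>). if \<forall>n. emeasure \<eta> (B n) < \<infinity> then emeasure \<eta> (Pair y -` D) else 0)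
    \<in> borel_measurable (Y \<Otimes>\<^sub>M measure_algebra K)"
proof -
  let ?YK = "Y \<Otimes>\<^sub>M measure_algebra K"
  let ?lf = "\<lambda>\<eta>. \<forall>n. emeasure \<eta> (B n) < \<infinity>"
  have e [measurable]: "(\<lambda>z. emeasure (snd z) C) \<in> borel_measurable ?YK" if "C \<in> sets K" for C
    by (rule measurable_compose[OF measurable_snd measurable_emeasure_measure_algebra[OF that]])
  have Bn [measurable]: "B n \<in> sets K" for n using B(1) by auto
  have lf [measurable]: "Measurable.pred ?YK (\<lambda>z. ?lf (snd z))" by measurable
  have sK: "sets \<eta> = sets K" if "z \<in> space ?YK" "\<eta> = snd z" for z \<eta>
    using measurable_space[OF measurable_snd that(1)] that(2) by (simp add: space_measure_algebra)
  have sec: "Pair y -` C \<in> sets K" if "C \<in> sets (Y \<Otimes>\<^sub>M K)" for y C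
    using sets_Pair1[OF that] .
  have part: "(\<lambda>z. if ?lf (snd z) then emeasure (snd z) (B n \<inter> Pair (fst z) -` D) else 0) \<in> borel_measurable ?YK" for n
  proof -
    let ?G = "{a \<times> b | a b. a \<in> sets Y \<and> b \<in> sets K}"
    have D': "D \<in> sigma_sets (space Y \<times> space K) ?G" using D by (simp add: sets_pair_measure)
    show ?thesis
      using Int_stable_pair_measure_generator pair_measure_closed D'
    proof (induction rule: sigma_sets_induct_disjoint)
      case (basic A)
      then obtain a b where ab [measurable]: "A = a \<times> b" "a \<in> sets Y" "b \<in> sets K" by auto
      have "(\<lambda>z. if ?lf (snd z) \<and> fst z \<in> a then emeasure (snd z) (B n \<inter> b) else 0) \<in> borel_measurable ?YK"
        using ab by measurable
      then show ?case
        by (rule measurable_cong[THEN iffD1, rotated]) (auto simp: ab)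
    next
      case empty
      show ?case by (simp cong: if_cong)
    next
      case (compl A)
      have A: "A \<in> sets (Y \<Otimes>\<^sub>M K)" using compl(1) by (simp add: sets_pair_measure)
      have "(\<lambda>z. if ?lf (snd z) then emeasure (snd z) (B n) -
          (if ?lf (snd z) then emeasure (snd z) (B n \<inter> Pair (fst z) -` A) else 0) else 0) \<in> borel_measurable ?YK"
        using compl(2) by measurable
      then show ?case
      proof (rule measurable_cong[THEN iffD1, rotated])
        fix z assume z: "z \<in> space ?YK"
        then have y: "fst z \<in> space Y" by (auto simp: space_pair_measure)
        note s = sK[OF z refl]
        show "(if ?lf (snd z) then emeasure (snd z) (B n) -
          (if ?lf (snd z) then emeasure (snd z) (B n \<inter> Pair (fst z) -` A) else 0) else 0) =
          (if ?lf (snd z) then emeasure (snd z) (B n \<inter> Pair (fst z) -` (space Y \<times> space K - A)) else 0)"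
        proof (cases "?lf (snd z)")
          case True
          have *: "B n \<inter> Pair (fst z) -` (space Y \<times> space K - A) = B n - B n \<inter> Pair (fst z) -` A"
            using y sets.sets_into_space[OF Bn[of n]] by auto
          have "emeasure (snd z) (B n \<inter> Pair (fst z) -` A) \<noteq> \<infinity>"
            using True emeasure_mono[of "B n \<inter> Pair (fst z) -` A" "B n" "snd z"] s Bn[of n]
            by (metis Int_lower1 infinity_ennreal_def order_le_less_trans order_less_irrefl)
          then show ?thesis
            using True s sec[OF A] Bn[of n] unfolding * by (subst emeasure_Diff) auto
        next
          case False
          then show ?thesis by (simp only: if_False)
        qed
      qed
    next
      case (union A)
      have A: "A i \<in> sets (Y \<Otimes>\<^sub>M K)" for i
        using union(2) unfolding sets_pair_measure by blast
      have "(\<lambda>z. \<Sum>i. if ?lf (snd z) then emeasure (snd z) (B n \<inter> Pair (fst z) -` A i) else 0) \<in> borel_measurable ?YK"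
        using union(3) by measurable
      then show ?case
      proof (rule measurable_cong[THEN iffD1, rotated])
        fix z assume z: "z \<in> space ?YK"
        note s = sK[OF z refl]
        have "(\<Sum>i. emeasure (snd z) (B n \<inter> Pair (fst z) -` A i)) =
            emeasure (snd z) (\<Union>i. B n \<inter> Pair (fst z) -` A i)"
        proof (rule suminf_emeasure)
          show "range (\<lambda>i. B n \<inter> Pair (fst z) -` A i) \<subseteq> sets (snd z)"
            using s sec[OF A] Bn[of n] by auto
          show "disjoint_family (\<lambda>i. B n \<inter> Pair (fst z) -` A i)"
            using union(1) unfolding disjoint_family_on_def by blast
        qed
        also have "(\<Union>i. B n \<inter> Pair (fst z) -` A i) = B n \<inter> Pair (fst z) -` (\<Union>i. A i)" by auto
        finally show "(\<Sum>i. if ?lf (snd z) then emeasure (snd z) (B n \<inter> Pair (fst z) -` A i) else 0) =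
          (if ?lf (snd z) then emeasure (snd z) (B n \<inter> Pair (fst z) -` (\<Union>i. A i)) else 0)"
          by (cases "?lf (snd z)") (simp_all only: simp_thms if_True if_False suminf_zero)
      qed
    qed
  qed
  have "(\<lambda>z. \<Sum>n. if ?lf (snd z) then emeasure (snd z) (B n \<inter> Pair (fst z) -` D) else 0) \<in> borel_measurable ?YK"
    by (intro borel_measurable_suminf_order part)
  then show ?thesis
  proof (rule measurable_cong[THEN iffD1, rotated])
    fix z assume z: "z \<in> space ?YK"
    note s = sK[OF z refl]
    have "(\<Sum>n. emeasure (snd z) (B n \<inter> Pair (fst z) -` D)) = emeasure (snd z) (\<Union>n. B n \<inter> Pair (fst z) -` D)"
    proof (rule suminf_emeasure)
      show "range (\<lambda>n. B n \<inter> Pair (fst z) -` D) \<subseteq> sets (snd z)"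
        using s sec[OF D] Bn by auto
      show "disjoint_family (\<lambda>n. B n \<inter> Pair (fst z) -` D)"
        using B(2) unfolding disjoint_family_on_def by blast
    qed
    also have "(\<Union>n. B n \<inter> Pair (fst z) -` D) = Pair (fst z) -` D"
      using B(3) sets.sets_into_space[OF sec[OF D]] by blast
    finally show "(\<Sum>n. if ?lf (snd z) then emeasure (snd z) (B n \<inter> Pair (fst z) -` D) else 0) =
      (case z of (y, \<eta>) \<Rightarrow> if ?lf \<eta> then emeasure \<eta> (Pair y -` D) else 0)"
      by (cases "?lf (snd z)") (simp_all only: simp_thms if_True if_False suminf_zero split_beta')
  qed
qed

text \<open>Restricting a locally finite measure to a section and mapping the section by a function that may
  depend on it; all other measures are sent to the null measure.\<close>

lemma measurable_restricted_image:
  fixes B :: "nat \<Rightarrow> 'b set"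
  assumes B: "range B \<subseteq> sets K" "disjoint_family B" "(\<Union>n. B n) = space K"
    and D: "D \<in> sets (Y \<Otimes>\<^sub>M K)" and g: "g \<in> Y \<Otimes>\<^sub>M K \<rightarrow>\<^sub>M S"
  shows "(\<lambda>(y, \<eta>). if \<forall>n. emeasure \<eta> (B n) < \<infinity>
      then distr (density \<eta> (indicator (Pair y -` D))) S (\<lambda>x. g (y, x)) else null_measure S)
    \<in> Y \<Otimes>\<^sub>M measure_algebra K \<rightarrow>\<^sub>M measure_algebra S"
proof (rule measurable_measure_algebra)
  let ?YK = "Y \<Otimes>\<^sub>M measure_algebra K"
  fix C assume C: "C \<in> sets S"
  have DC: "g -` C \<inter> D \<in> sets (Y \<Otimes>\<^sub>M K)"
    using measurable_sets[OF g C] D sets.sets_into_space[OF D]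
    by (metis inf.absorb_iff2 inf_assoc sets.Int)
  show "(\<lambda>z. emeasure (case z of (y, \<eta>) \<Rightarrow> if \<forall>n. emeasure \<eta> (B n) < \<infinity>
      then distr (density \<eta> (indicator (Pair y -` D))) S (\<lambda>x. g (y, x)) else null_measure S) C)
      \<in> borel_measurable ?YK"
    using measurable_emeasure_section[OF B DC]
  proof (rule measurable_cong[THEN iffD1, rotated])
    fix z assume z: "z \<in> space ?YK"
    obtain y \<eta> where z_eq: "z = (y, \<eta>)" by (cases z)
    have y: "y \<in> space Y" and s [measurable_cong]: "sets \<eta> = sets K"
      using z by (auto simp: z_eq space_pair_measure space_measure_algebra)
    have gy: "(\<lambda>x. g (y, x)) \<in> \<eta> \<rightarrow>\<^sub>M S"
      using measurable_Pair2[OF g y] by (simp cong: measurable_cong_sets add: s)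
    have Dy: "Pair y -` D \<in> sets \<eta>" using sets_Pair1[OF D] s by simp
    have "emeasure (distr (density \<eta> (indicator (Pair y -` D))) S (\<lambda>x. g (y, x))) C =
        emeasure (density \<eta> (indicator (Pair y -` D))) ((\<lambda>x. g (y, x)) -` C \<inter> space \<eta>)"
      using gy C by (subst emeasure_distr) auto
    also have "\<dots> = (\<integral>\<^sup>+x. indicator (Pair y -` D) x * indicator ((\<lambda>x. g (y, x)) -` C \<inter> space \<eta>) x \<partial>\<eta>)"
      using gy C Dy by (subst emeasure_density) auto
    also have "\<dots> = (\<integral>\<^sup>+x. indicator (Pair y -` (g -` C \<inter> D)) x \<partial>\<eta>)"
      by (intro nn_integral_cong) (auto simp: indicator_def)
    also have "\<dots> = emeasure \<eta> (Pair y -` (g -` C \<inter> D))"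
      using sets_Pair1[OF DC] s by simp
    finally show "(case z of (y, \<eta>) \<Rightarrow> if \<forall>n. emeasure \<eta> (B n) < \<infinity> then emeasure \<eta> (Pair y -` (g -` C \<inter> D)) else 0) =
      emeasure (case z of (y, \<eta>) \<Rightarrow> if \<forall>n. emeasure \<eta> (B n) < \<infinity>
      then distr (density \<eta> (indicator (Pair y -` D))) S (\<lambda>x. g (y, x)) else null_measure S) C"
      by (simp add: z_eq)
  qed
next
  fix z assume "z \<in> space (Y \<Otimes>\<^sub>M measure_algebra K)"
  show "sets (case z of (y, \<eta>) \<Rightarrow> if \<forall>n. emeasure \<eta> (B n) < \<infinity>
      then distr (density \<eta> (indicator (Pair y -` D))) S (\<lambda>x. g (y, x)) else null_measure S) = sets S"
    by (cases z) simp
qed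

lemma restricted_image_points:
  fixes I :: "nat set"
  assumes x: "\<And>i. x i \<in> space K" and A: "A \<in> sets K" and g: "g \<in> K \<rightarrow>\<^sub>M S"
  shows "distr (density (points K I x) (indicator A)) S g = points S {i \<in> I. x i \<in> A} (\<lambda>i. g (x i))"
proof (rule measure_eqI)
  fix C assume "C \<in> sets (distr (density (points K I x) (indicator A)) S g)"
  then have C: "C \<in> sets S" by simp
  have gC: "g -` C \<inter> space K \<in> sets K" using measurable_sets[OF g C] .
  have gp: "g \<in> points K I x \<rightarrow>\<^sub>M S" using g by (simp cong: measurable_cong_sets)
  have "emeasure (distr (density (points K I x) (indicator A)) S g) C =
      emeasure (density (points K I x) (indicator A)) (g -` C \<inter> space K)"
    using gp C by (subst emeasure_distr) auto
  also have "\<dots> = (\<integral>\<^sup>+y. indicator A y * indicator (g -` C \<inter> space K) y \<partial>points K I x)"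
    using gC A by (subst emeasure_density) auto
  also have "\<dots> = (\<Sum>i. if i \<in> I then indicator A (x i) * indicator (g -` C \<inter> space K) (x i) else 0)"
    using x gC A by (subst nn_integral_points) auto
  also have "\<dots> = emeasure (points S {i \<in> I. x i \<in> A} (\<lambda>i. g (x i))) C"
    using x C measurable_space[OF g]
    by (subst emeasure_points) (auto intro!: arg_cong[where f=suminf] simp: indicator_def)
  finally show "emeasure (distr (density (points K I x) (indicator A)) S g) C =
    emeasure (points S {i \<in> I. x i \<in> A} (\<lambda>i. g (x i))) C" .
qed simp

section \<open>Two changes of variables\<close>

text \<open>Substitution by a decreasing function on an interval \<open>S\<close> that is exhausted by compact intervals. A
  reflection reduces the compact case to the rule for increasing functions.\<close>

lemma nn_integral_substitution_decreasing:
  fixes g g' :: "real \<Rightarrow> real" and h :: "real \<Rightarrow> ennreal" and l r :: "nat \<Rightarrow> real"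
  assumes [measurable]: "g \<in> borel_measurable borel" "g' \<in> borel_measurable borel" "h \<in> borel_measurable borel"
    and S: "(\<Union>n. {l n..r n}) = S" and lr: "decseq l" "incseq r" "\<And>n. l n < r n"
    and R: "g ` S = R" and conv: "\<And>x y z. x \<in> R \<Longrightarrow> z \<in> R \<Longrightarrow> x \<le> y \<Longrightarrow> y \<le> z \<Longrightarrow> y \<in> R"
    and deriv: "\<And>x. x \<in> S \<Longrightarrow> (g has_real_derivative - g' x) (at x)"
    and cont: "continuous_on S g'" and nonneg: "\<And>x. x \<in> S \<Longrightarrow> 0 \<le> g' x"
    and anti: "\<And>x y. x \<in> S \<Longrightarrow> y \<in> S \<Longrightarrow> x \<le> y \<Longrightarrow> g y \<le> g x"
  shows "(\<integral>\<^sup>+x. h x * indicator R x \<partial>lborel) = (\<integral>\<^sup>+y. h (g y) * ennreal (g' y) * indicator S y \<partial>lborel)"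
proof -
  have sub: "{l n..r n} \<subseteq> S" for n using S by auto
  have lS: "l n \<in> S" "r n \<in> S" for n using sub[of n] lr(3)[of n] by auto
  have [measurable]: "S \<in> sets borel" unfolding S[symmetric] by measurable
  have R_eq: "(\<Union>n. {g (r n)..g (l n)}) = R"
  proof safe
    fix n x assume "x \<in> {g (r n)..g (l n)}"
    then show "x \<in> R" using conv[of "g (r n)" "g (l n)" x] lS[of n] R by auto
  next
    fix x assume "x \<in> R"
    then obtain y where y: "y \<in> S" "x = g y" using R by auto
    then obtain n where "y \<in> {l n..r n}" using S by auto
    then show "x \<in> (\<Union>n. {g (r n)..g (l n)})"
      using anti[of "l n" y] anti[of y "r n"] y lS[of n] by auto
  qed
  have [measurable]: "R \<in> sets borel" unfolding R_eq[symmetric] by measurable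
  have n_eq: "(\<integral>\<^sup>+x. h x * indicator {g (r n)..g (l n)} x \<partial>lborel) =
      (\<integral>\<^sup>+y. h (g y) * ennreal (g' y) * indicator {l n..r n} y \<partial>lborel)" for n
  proof -
    have "(\<integral>\<^sup>+x. h x * indicator {g (r n)..g (l n)} x \<partial>lborel) =
        (\<integral>\<^sup>+x. h (- x) * indicator {g (r n)..g (l n)} (- x) \<partial>lborel)"
      by (subst nn_integral_real_affine[where c="-1" and t=0]) auto
    also have "\<dots> = (\<integral>\<^sup>+x. (\<lambda>x. h (- x)) x * indicator {- g (l n)..- g (r n)} x \<partial>lborel)"
      by (intro nn_integral_cong) (auto simp: indicator_def)
    also have "\<dots> = (\<integral>\<^sup>+x. h (- (- g x)) * ennreal (g' x) * indicator {l n..r n} x \<partial>lborel)"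
    proof (rule nn_integral_substitution_aux[where g="\<lambda>x. - g x"])
      show "((\<lambda>x. - g x) has_real_derivative g' x) (at x)" if "x \<in> {l n..r n}" for x
        using DERIV_minus[OF deriv[of x]] that sub[of n] by auto
    qed (use lr(3) sub[of n] nonneg continuous_on_subset[OF cont] in auto)
    finally show ?thesis by simp
  qed
  have "(\<integral>\<^sup>+x. h x * indicator R x \<partial>lborel) = emeasure (density lborel h) (\<Union>n. {g (r n)..g (l n)})"
    unfolding R_eq by (simp add: emeasure_density)
  also have "\<dots> = (SUP n. emeasure (density lborel h) {g (r n)..g (l n)})"
  proof (rule SUP_emeasure_incseq[symmetric])
    show "incseq (\<lambda>n. {g (r n)..g (l n)})"
    proof (rule incseq_SucI)
      fix n
      have "g (r (Suc n)) \<le> g (r n)" "g (l n) \<le> g (l (Suc n))"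
        using lr by (auto intro!: anti lS simp: incseq_Suc_iff decseq_Suc_iff)
      then show "{g (r n)..g (l n)} \<subseteq> {g (r (Suc n))..g (l (Suc n))}" by auto
    qed
  qed auto
  also have "\<dots> = (SUP n. emeasure (density lborel (\<lambda>y. h (g y) * ennreal (g' y))) {l n..r n})"
    using n_eq by (simp add: emeasure_density)
  also have "\<dots> = emeasure (density lborel (\<lambda>y. h (g y) * ennreal (g' y))) (\<Union>n. {l n..r n})"
  proof (rule SUP_emeasure_incseq)
    show "incseq (\<lambda>n. {l n..r n})"
    proof (rule incseq_SucI)
      fix n
      have "r n \<le> r (Suc n)" "l (Suc n) \<le> l n"
        using lr by (auto simp: incseq_Suc_iff decseq_Suc_iff)
      then show "{l n..r n} \<subseteq> {l (Suc n)..r (Suc n)}" by auto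
    qed
  qed auto
  also have "\<dots> = (\<integral>\<^sup>+y. h (g y) * ennreal (g' y) * indicator S y \<partial>lborel)"
    unfolding S by (simp add: emeasure_density)
  finally show ?thesis .
qed

lemma Union_Icc_Ioi: "(\<Union>n. {1 / (real n + 2)..real n + 2}) = {0<..}"
proof safe
  fix x :: real assume "x > 0"
  obtain n :: nat where n: "max x (1 / x) \<le> real n" using real_arch_simple by blast
  then have "1 / (real n + 2) \<le> x" "x \<le> real n + 2"
    using \<open>x > 0\<close> by (auto simp: field_simps)
  then show "x \<in> (\<Union>n. {1 / (real n + 2)..real n + 2})" by auto
qed (auto intro: less_le_trans[rotated])

lemma Union_Icc_Ioo: "(\<Union>n. {1 / (real n + 3)..1 - 1 / (real n + 3)}) = {0<..<1}"
proof safe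
  fix x :: real assume x: "x \<in> {0<..<1}"
  obtain n :: nat where n: "max (1 / (1 - x)) (1 / x) \<le> real n" using real_arch_simple by blast
  have "1 / x \<le> real n + 3" "1 / (1 - x) \<le> real n + 3" using n by auto
  then have "1 / (real n + 3) \<le> x" "1 / (real n + 3) \<le> 1 - x"
    using x by (auto simp: field_simps)
  then show "x \<in> (\<Union>n. {1 / (real n + 3)..1 - 1 / (real n + 3)})" by auto
next
  fix x n assume "x \<in> {1 / (real n + 3)..1 - 1 / (real n + 3)}"
  moreover have "0 < 1 / (real n + 3)" by simp
  ultimately have "0 < x" "x < 1" unfolding atLeastAtMost_iff by linarith+
  then show "x \<in> {0<..<1}" by simp
qed

text \<open>Conditioned to exceed \<open>\<kappa>\<close>, a jump is distributed as \<open>\<kappa> w\<^sup>-\<^sup>1\<^sup>/\<^sup>\<alpha>\<close> with \<open>w\<close> uniform on the unit interval;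
  here without the normalisation.\<close>

lemma nn_integral_pareto:
  fixes h :: "real \<Rightarrow> ennreal"
  assumes \<alpha>: "0 < \<alpha>" and \<kappa>: "0 < \<kappa>" and [measurable]: "h \<in> borel_measurable borel"
  shows "(\<integral>\<^sup>+u. h u * ennreal (u powr (- \<alpha> - 1)) * indicator {\<kappa><..} u \<partial>lborel) =
    ennreal (\<kappa> powr (- \<alpha>) / \<alpha>) * (\<integral>\<^sup>+w. h (\<kappa> * w powr (- 1 / \<alpha>)) * indicator {0<..<1} w \<partial>lborel)"
proof -
  let ?g = "\<lambda>w. \<kappa> * w powr (- 1 / \<alpha>)"
  let ?g' = "\<lambda>w. \<kappa> / \<alpha> * w powr (- 1 / \<alpha> - 1)"
  have "(\<integral>\<^sup>+u. h u * ennreal (u powr (- \<alpha> - 1)) * indicator {\<kappa><..} u \<partial>lborel) =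
      (\<integral>\<^sup>+w. h (?g w) * ennreal (?g w powr (- \<alpha> - 1)) * ennreal (?g' w) * indicator {0<..<1} w \<partial>lborel)"
  proof (rule nn_integral_substitution_decreasing[OF _ _ _ Union_Icc_Ioo])
    show "decseq (\<lambda>n. 1 / (real n + 3))" by (auto simp: decseq_def field_simps)
    show "incseq (\<lambda>n. 1 - 1 / (real n + 3))" by (auto simp: incseq_def field_simps)
    show "1 / (real n + 3) < 1 - 1 / (real n + 3)" for n by (auto simp: field_simps)
    show "?g ` {0<..<1} = {\<kappa><..}"
    proof safe
      fix w :: real assume w: "w \<in> {0<..<1}"
      have "1 powr (- 1 / \<alpha>) < w powr (- 1 / \<alpha>)"
        using w \<alpha> by (intro powr_less_mono2_neg) (auto simp: field_simps)
      then show "\<kappa> < ?g w" using \<kappa> by simp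
    next
      fix u assume u: "\<kappa> < u"
      have "(u / \<kappa>) powr (- \<alpha>) < 1 powr (- \<alpha>)"
        using u \<kappa> \<alpha> by (intro powr_less_mono2_neg) (auto simp: field_simps)
      moreover have "u = ?g ((u / \<kappa>) powr (- \<alpha>))"
        using u \<kappa> \<alpha> by (simp add: powr_powr)
      ultimately show "u \<in> ?g ` {0<..<1}" using u \<kappa> by (intro image_eqI[of _ _ "(u / \<kappa>) powr (- \<alpha>)"]) auto
    qed
    show "(?g has_real_derivative - ?g' w) (at w)" if "w \<in> {0<..<1}" for w
      using that \<alpha> by (auto intro!: derivative_eq_intros simp: field_simps)
    show "continuous_on {0<..<1} ?g'" by (intro continuous_intros) auto
    show "0 \<le> ?g' w" for w using \<alpha> \<kappa> by simp
    show "?g y \<le> ?g x" if "x \<in> {0<..<1}" "y \<in> {0<..<1}" "x \<le> y" for x y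
      using that \<alpha> \<kappa> by (auto intro!: powr_mono2')
  qed auto
  also have "\<dots> = (\<integral>\<^sup>+w. ennreal (\<kappa> powr (- \<alpha>) / \<alpha>) * (h (?g w) * indicator {0<..<1} w) \<partial>lborel)"
  proof (rule nn_integral_cong)
    fix w :: real
    show "h (?g w) * ennreal (?g w powr (- \<alpha> - 1)) * ennreal (?g' w) * indicator {0<..<1} w =
      ennreal (\<kappa> powr (- \<alpha>) / \<alpha>) * (h (?g w) * indicator {0<..<1} w)"
    proof (cases "w \<in> {0<..<1}")
      case True
      then have w: "0 < w" by simp
      have "?g w powr (- \<alpha> - 1) * ?g' w = \<kappa> powr (- \<alpha>) / \<alpha>"
      proof -
        have "?g w powr (- \<alpha> - 1) = \<kappa> powr (- \<alpha> - 1) * w powr (1 + 1 / \<alpha>)"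
        proof -
          have e: "- 1 / \<alpha> * (- \<alpha> - 1) = 1 + 1 / \<alpha>" using \<alpha> by (simp add: field_simps)
          have "?g w powr (- \<alpha> - 1) = \<kappa> powr (- \<alpha> - 1) * (w powr (- 1 / \<alpha>)) powr (- \<alpha> - 1)"
            using \<kappa> by (simp add: powr_mult)
          also have "(w powr (- 1 / \<alpha>)) powr (- \<alpha> - 1) = w powr (1 + 1 / \<alpha>)"
            unfolding powr_powr e ..
          finally show ?thesis .
        qed
        moreover have "w powr (1 + 1 / \<alpha>) * w powr (- 1 / \<alpha> - 1) = 1"
          using w by (simp flip: powr_add)
        moreover have "\<kappa> powr (- \<alpha> - 1) * \<kappa> = \<kappa> powr (- \<alpha>)"
          using \<kappa> by (simp add: powr_mult_base mult.commute)
        ultimately show ?thesis by (simp add: field_simps)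
      qed
      then have "ennreal (?g w powr (- \<alpha> - 1)) * ennreal (?g' w) = ennreal (\<kappa> powr (- \<alpha>) / \<alpha>)"
        using \<alpha> \<kappa> by (subst ennreal_mult[symmetric]) auto
      then show ?thesis using True by (simp add: mult.commute mult.left_commute)
    qed simp
  qed
  also have "\<dots> = ennreal (\<kappa> powr (- \<alpha>) / \<alpha>) * (\<integral>\<^sup>+w. h (?g w) * indicator {0<..<1} w \<partial>lborel)"
    by (rule nn_integral_cmult) measurable
  finally show ?thesis .
qed

text \<open>The substitution \<open>s = (T / (y + \<tau>))\<^sup>\<alpha>\<close>. The times with \<open>s\<^sup>1\<^sup>/\<^sup>\<alpha> \<tau> < T\<close> correspond to \<open>y > 0\<close>.\<close>

lemma nn_integral_level_substitution:
  fixes h :: "real \<Rightarrow> ennreal"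
  assumes \<alpha>: "0 < \<alpha>" and T: "0 < T" and \<tau>: "0 < \<tau>" and [measurable]: "h \<in> borel_measurable borel"
  shows "(\<integral>\<^sup>+s. h s * indicator {0<..<(T / \<tau>) powr \<alpha>} s \<partial>lborel) =
    (\<integral>\<^sup>+y. h ((T / (y + \<tau>)) powr \<alpha>) * ennreal (\<alpha> * T powr \<alpha> * (y + \<tau>) powr (- \<alpha> - 1)) *
       indicator {0<..} y \<partial>lborel)"
proof (rule nn_integral_substitution_decreasing[OF _ _ _ Union_Icc_Ioi])
  let ?g = "\<lambda>y. (T / (y + \<tau>)) powr \<alpha>"
  let ?g' = "\<lambda>y. \<alpha> * T powr \<alpha> * (y + \<tau>) powr (- \<alpha> - 1)"
  show "decseq (\<lambda>n. 1 / (real n + 2))" by (auto simp: decseq_def field_simps)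
  show "incseq (\<lambda>n. real n + 2)" by (auto simp: incseq_def)
  show "1 / (real n + 2) < real n + 2" for n
    by (rule less_le_trans[of _ 1]) auto
  show "?g ` {0<..} = {0<..<(T / \<tau>) powr \<alpha>}"
  proof safe
    fix y :: real assume y: "y > 0"
    show "?g y \<in> {0<..<(T / \<tau>) powr \<alpha>}"
      using y T \<tau> \<alpha> by (auto intro!: powr_less_mono2 divide_strict_left_mono)
  next
    fix s assume s: "s \<in> {0<..<(T / \<tau>) powr \<alpha>}"
    have "s powr (1 / \<alpha>) < ((T / \<tau>) powr \<alpha>) powr (1 / \<alpha>)"
      using s \<alpha> by (intro powr_less_mono2) auto
    then have *: "s powr (1 / \<alpha>) < T / \<tau>" using \<alpha> T \<tau> by (simp add: powr_powr)
    have s0: "0 < s powr (1 / \<alpha>)" using s by simp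
    have "s = ?g (T / s powr (1 / \<alpha>) - \<tau>)" using \<alpha> s T by (simp add: powr_powr)
    moreover have "0 < T / s powr (1 / \<alpha>) - \<tau>" using * s0 \<tau> by (simp add: field_simps)
    ultimately show "s \<in> ?g ` {0<..}" by blast
  qed
  show "(?g has_real_derivative - ?g' y) (at y)" if "y \<in> {0<..}" for y
  proof -
    have "((\<lambda>y. T powr \<alpha> * (y + \<tau>) powr (- \<alpha>)) has_real_derivative - ?g' y) (at y)"
      using that \<tau> by (auto intro!: derivative_eq_intros)
    then show ?thesis
    proof (rule has_field_derivative_transform_within_open)
      show "open {0::real<..}" by simp
      show "T powr \<alpha> * (x + \<tau>) powr (- \<alpha>) = ?g x" if "x \<in> {0<..}" for x
        using that T \<tau> by (simp add: powr_divide powr_minus_divide)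
    qed fact
  qed
  show "continuous_on {0<..} ?g'" using \<tau> by (intro continuous_intros) auto
  show "0 \<le> ?g' y" for y using \<alpha> by simp
  show "?g y \<le> ?g x" if "x \<in> {0<..}" "y \<in> {0<..}" "x \<le> y" for x y
    using that T \<tau> \<alpha> by (intro powr_mono2) (auto intro!: divide_left_mono)
qed auto

text \<open>Both changes of variables together: \<open>s = (T / (y + \<tau>))\<^sup>\<alpha>\<close> and
  \<open>u = (T y / (y + \<tau>)) w\<^sup>-\<^sup>1\<^sup>/\<^sup>\<alpha>\<close>. The result does not depend on \<open>T\<close>.\<close>

lemma nn_integral_crossing_substitution:
  fixes f :: "real \<times> real \<times> real \<Rightarrow> ennreal"
  assumes \<alpha>: "0 < \<alpha>" and T: "0 < T" and \<tau>: "0 < \<tau>"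
    and f [measurable]: "f \<in> borel_measurable (borel \<Otimes>\<^sub>M borel \<Otimes>\<^sub>M borel)"
  shows "(\<integral>\<^sup>+s. (\<integral>\<^sup>+u. (if s powr (1 / \<alpha>) * \<tau> < T \<and> T < s powr (1 / \<alpha>) * \<tau> + u
        then f ((T - s powr (1 / \<alpha>) * \<tau>) / T, s powr (1 / \<alpha>) / T, (s powr (1 / \<alpha>) * \<tau> + u - T) / T) else 0)
        * ennreal (u powr (- \<alpha> - 1)) * indicator {0<..} u \<partial>lborel) * indicator {0<..} s \<partial>lborel) =
    (\<integral>\<^sup>+y. ennreal (y powr (- \<alpha>) / (y + \<tau>)) *
      (\<integral>\<^sup>+w. f (y / (y + \<tau>), 1 / (y + \<tau>), y / (y + \<tau>) * (w powr (- 1 / \<alpha>) - 1)) * indicator {0<..<1} w \<partial>lborel) *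
        indicator {0<..} y \<partial>lborel)" (is "(\<integral>\<^sup>+s. ?I s * _ \<partial>lborel) = ?R")
proof -
  \<comment> \<open>The value of the integral over \<open>u\<close>, where \<open>u\<close> has to exceed \<open>T - s\<^sup>1\<^sup>/\<^sup>\<alpha> \<tau>\<close>\<close>
  define K where "K s = ennreal ((T - s powr (1 / \<alpha>) * \<tau>) powr (- \<alpha>) / \<alpha>) *
      (\<integral>\<^sup>+w. f ((T - s powr (1 / \<alpha>) * \<tau>) / T, s powr (1 / \<alpha>) / T,
          (T - s powr (1 / \<alpha>) * \<tau>) / T * (w powr (- 1 / \<alpha>) - 1)) * indicator {0<..<1} w \<partial>lborel)" for s
  have [measurable]: "K \<in> borel_measurable borel" unfolding K_def by measurable
  have pos: "s powr (1 / \<alpha>) * \<tau> < T \<longleftrightarrow> s < (T / \<tau>) powr \<alpha>" if "0 < s" for s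
  proof -
    have "s powr (1 / \<alpha>) * \<tau> < T \<longleftrightarrow> s powr (1 / \<alpha>) < T / \<tau>" using \<tau> by (simp add: field_simps)
    also have "\<dots> \<longleftrightarrow> (s powr (1 / \<alpha>)) powr \<alpha> < (T / \<tau>) powr \<alpha>"
      using powr_less_mono2[OF \<alpha>, of "s powr (1 / \<alpha>)" "T / \<tau>"]
        powr_mono2[of \<alpha> "T / \<tau>" "s powr (1 / \<alpha>)"] \<alpha> T \<tau> by fastforce
    finally show ?thesis using \<alpha> that by (simp add: powr_powr)
  qed
  have inner: "?I s * indicator {0<..} s = K s * indicator {0<..<(T / \<tau>) powr \<alpha>} s" for s
  proof (cases "0 < s \<and> s powr (1 / \<alpha>) * \<tau> < T")
    case True
    let ?m = "s powr (1 / \<alpha>) * \<tau>"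
    let ?\<kappa> = "T - ?m"
    have "?I s = (\<integral>\<^sup>+u. f (?\<kappa> / T, s powr (1 / \<alpha>) / T, (?m + u - T) / T) * ennreal (u powr (- \<alpha> - 1)) * indicator {?\<kappa><..} u \<partial>lborel)"
      using True by (intro nn_integral_cong) (auto simp: indicator_def)
    also have "\<dots> = ennreal (?\<kappa> powr (- \<alpha>) / \<alpha>) *
        (\<integral>\<^sup>+w. f (?\<kappa> / T, s powr (1 / \<alpha>) / T, (?m + ?\<kappa> * w powr (- 1 / \<alpha>) - T) / T) * indicator {0<..<1} w \<partial>lborel)"
      using True \<alpha> by (intro nn_integral_pareto) auto
    also have "\<dots> = K s"
      unfolding K_def
    proof (intro arg_cong2[where f="(*)"] refl nn_integral_cong)
      fix w :: real
      have "(?m + ?\<kappa> * w powr (- 1 / \<alpha>) - T) / T = ?\<kappa> / T * (w powr (- 1 / \<alpha>) - 1)"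
        using T by (simp add: field_simps)
      then show "f (?\<kappa> / T, s powr (1 / \<alpha>) / T, (?m + ?\<kappa> * w powr (- 1 / \<alpha>) - T) / T) =
        f (?\<kappa> / T, s powr (1 / \<alpha>) / T, ?\<kappa> / T * (w powr (- 1 / \<alpha>) - 1))" by (simp only:)
    qed
    finally show ?thesis using True pos[of s] by simp
  next
    case False
    then show ?thesis using pos[of s] by (auto simp: indicator_def)
  qed
  have "(\<integral>\<^sup>+s. ?I s * indicator {0<..} s \<partial>lborel) =
      (\<integral>\<^sup>+y. K ((T / (y + \<tau>)) powr \<alpha>) * ennreal (\<alpha> * T powr \<alpha> * (y + \<tau>) powr (- \<alpha> - 1)) * indicator {0<..} y \<partial>lborel)"
    unfolding inner by (rule nn_integral_level_substitution[OF \<alpha> T \<tau>]) measurable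
  also have "\<dots> = ?R"
  proof (intro nn_integral_cong)
    fix y :: real
    let ?J = "\<integral>\<^sup>+w. f (y / (y + \<tau>), 1 / (y + \<tau>), y / (y + \<tau>) * (w powr (- 1 / \<alpha>) - 1)) * indicator {0<..<1} w \<partial>lborel"
    show "K ((T / (y + \<tau>)) powr \<alpha>) * ennreal (\<alpha> * T powr \<alpha> * (y + \<tau>) powr (- \<alpha> - 1)) * indicator {0<..} y =
      ennreal (y powr (- \<alpha>) / (y + \<tau>)) * ?J * indicator {0<..} y"
    proof (cases "0 < y")
      case True
      let ?s = "(T / (y + \<tau>)) powr \<alpha>"
      have s: "?s powr (1 / \<alpha>) = T / (y + \<tau>)" using True T \<tau> \<alpha> by (simp add: powr_powr)
      have \<kappa>: "T - T / (y + \<tau>) * \<tau> = T * y / (y + \<tau>)" using True \<tau> by (simp add: field_simps)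
      have 1: "T * y / (y + \<tau>) / T = y / (y + \<tau>)" "T / (y + \<tau>) / T = 1 / (y + \<tau>)" using T by auto
      have K_eq: "K ?s = ennreal ((T * y / (y + \<tau>)) powr (- \<alpha>) / \<alpha>) * ?J"
        unfolding K_def s \<kappa> 1 ..
      have "(T * y / (y + \<tau>)) powr (- \<alpha>) / \<alpha> * (\<alpha> * T powr \<alpha> * (y + \<tau>) powr (- \<alpha> - 1)) =
          y powr (- \<alpha>) / (y + \<tau>)"
      proof -
        have e1: "(T * y / (y + \<tau>)) powr (- \<alpha>) = T powr (- \<alpha>) * y powr (- \<alpha>) * (y + \<tau>) powr \<alpha>"
          using True T \<tau> by (simp add: powr_mult powr_divide powr_minus field_simps)
        have e2: "T powr (- \<alpha>) * T powr \<alpha> = 1" using T by (simp flip: powr_add)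
        have e3: "(y + \<tau>) powr \<alpha> * (y + \<tau>) powr (- \<alpha> - 1) = 1 / (y + \<tau>)"
          using True \<tau> by (simp flip: powr_add add: powr_minus_divide)
        have "(T * y / (y + \<tau>)) powr (- \<alpha>) / \<alpha> * (\<alpha> * T powr \<alpha> * (y + \<tau>) powr (- \<alpha> - 1)) =
            (T powr (- \<alpha>) * T powr \<alpha>) * y powr (- \<alpha>) * ((y + \<tau>) powr \<alpha> * (y + \<tau>) powr (- \<alpha> - 1))"
          unfolding e1 using \<alpha> by simp
        then show ?thesis unfolding e2 e3 by simp
      qed
      then have "ennreal ((T * y / (y + \<tau>)) powr (- \<alpha>) / \<alpha>) * ennreal (\<alpha> * T powr \<alpha> * (y + \<tau>) powr (- \<alpha> - 1)) =
          ennreal (y powr (- \<alpha>) / (y + \<tau>))"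
        using \<alpha> by (subst ennreal_mult[symmetric]) auto
      moreover have "K ?s * ennreal (\<alpha> * T powr \<alpha> * (y + \<tau>) powr (- \<alpha> - 1)) =
          ennreal ((T * y / (y + \<tau>)) powr (- \<alpha>) / \<alpha>) * ennreal (\<alpha> * T powr \<alpha> * (y + \<tau>) powr (- \<alpha> - 1)) * ?J"
        unfolding K_eq by (simp only: mult_ac)
      ultimately show ?thesis by simp
    qed simp
  qed
  finally show ?thesis .
qed

section \<open>The Poisson point process of the stable subordinator\<close>

lemma space_stable_jump_measure: "space (stable_jump_measure \<alpha>) = {0<..}"
  by (simp add: stable_jump_measure_def space_restrict_space)

lemma sets_stable_jump_measure: "sets (stable_jump_measure \<alpha>) = sets (restrict_space borel {0<..})"
  by (simp add: stable_jump_measure_def sets_restrict_space)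

lemma measurable_from_stable_jump_measure:
  "f \<in> borel \<rightarrow>\<^sub>M N \<Longrightarrow> f \<in> stable_jump_measure \<alpha> \<rightarrow>\<^sub>M N"
  using measurable_restrict_space1[of f borel N "{0<..}"]
    measurable_cong_sets[OF sets_stable_jump_measure refl] by blast

lemma nn_integral_stable_jump_measure:
  assumes [measurable]: "f \<in> borel_measurable (stable_jump_measure \<alpha>)"
  shows "(\<integral>\<^sup>+u. f u \<partial>stable_jump_measure \<alpha>) =
    (\<integral>\<^sup>+u. f u * ennreal (\<alpha> / Gamma (1 - \<alpha>) * u powr (- \<alpha> - 1)) * indicator {0<..} u \<partial>lborel)"
proof -
  have f: "f \<in> borel_measurable (restrict_space lborel {0<..})"
  proof -
    have "sets (restrict_space lborel {0<..}) = sets (stable_jump_measure \<alpha>)"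
      by (simp add: stable_jump_measure_def)
    then show ?thesis using assms measurable_cong_sets by blast
  qed
  have w: "(\<lambda>u. ennreal (\<alpha> / Gamma (1 - \<alpha>) * u powr (- \<alpha> - 1))) \<in> borel_measurable (restrict_space lborel {0<..})"
    by (rule measurable_restrict_space1) measurable
  show ?thesis
    unfolding stable_jump_measure_def
    using f w by (simp add: nn_integral_density nn_integral_restrict_space mult.commute)
qed

lemma sigma_finite_stable_jump_measure: "sigma_finite_measure (stable_jump_measure \<alpha>)"
proof -
  interpret sigma_finite_measure "restrict_space lborel {0::real<..}"
    by (rule sigma_finite_measure_restrict_space) (auto simp: sigma_finite_lborel)
  have "(\<lambda>u. ennreal (\<alpha> / Gamma (1 - \<alpha>) * u powr (- \<alpha> - 1))) \<in> borel_measurable (restrict_space lborel {0<..})"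
    by (rule measurable_restrict_space1) measurable
  then show ?thesis
    unfolding stable_jump_measure_def by (subst sigma_finite_iff_density_finite) auto
qed

text \<open>Scaling the jumps by \<open>r\<close> multiplies the jump measure by \<open>r\<^sup>\<alpha>\<close>.\<close>

lemma stable_jump_measure_scaling:
  assumes r: "0 < r" and C: "C \<in> sets (stable_jump_measure \<alpha>)"
  shows "emeasure (stable_jump_measure \<alpha>) ((\<lambda>u. r * u) -` C \<inter> {0<..}) =
    ennreal (r powr \<alpha>) * emeasure (stable_jump_measure \<alpha>) C"
proof -
  let ?w = "\<lambda>u. \<alpha> / Gamma (1 - \<alpha>) * u powr (- \<alpha> - 1)"
  have C0: "C \<subseteq> {0<..}" using sets.sets_into_space[OF C] by (simp add: space_stable_jump_measure)
  have Cb [measurable]: "C \<in> sets borel"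
    using C by (auto simp: sets_stable_jump_measure sets_restrict_space)
  have Db: "(\<lambda>u. r * u) -` C \<inter> {0<..} \<in> sets (stable_jump_measure \<alpha>)"
    by (auto simp: sets_stable_jump_measure sets_restrict_space
        intro!: image_eqI[of _ _ "(\<lambda>u. r * u) -` C"] measurable_sets_borel[of _ borel])
  have "emeasure (stable_jump_measure \<alpha>) C = (\<integral>\<^sup>+u. indicator C u \<partial>stable_jump_measure \<alpha>)"
    using C by simp
  also have "\<dots> = (\<integral>\<^sup>+u. indicator C u * ennreal (?w u) * indicator {0<..} u \<partial>lborel)"
    using C by (subst nn_integral_stable_jump_measure) auto
  also have "\<dots> = ennreal r * (\<integral>\<^sup>+u. indicator C (r * u) * ennreal (?w (r * u)) * indicator {0<..} (r * u) \<partial>lborel)"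
    using r by (subst nn_integral_real_affine[where c=r and t=0]) auto
  finally have 1: "emeasure (stable_jump_measure \<alpha>) C =
    ennreal r * (\<integral>\<^sup>+u. indicator C (r * u) * ennreal (?w (r * u)) * indicator {0<..} (r * u) \<partial>lborel)" .
  have "ennreal (r powr \<alpha>) * emeasure (stable_jump_measure \<alpha>) C =
      (\<integral>\<^sup>+u. ennreal (r powr \<alpha> * r) * (indicator C (r * u) * ennreal (?w (r * u)) * indicator {0<..} (r * u)) \<partial>lborel)"
    unfolding 1 using r by (simp add: nn_integral_cmult ennreal_mult' mult.assoc)
  also have "\<dots> = (\<integral>\<^sup>+u. indicator ((\<lambda>u. r * u) -` C \<inter> {0<..}) u * ennreal (?w u) * indicator {0<..} u \<partial>lborel)"
  proof (rule nn_integral_cong)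
    fix u :: real
    show "ennreal (r powr \<alpha> * r) * (indicator C (r * u) * ennreal (?w (r * u)) * indicator {0<..} (r * u)) =
      indicator ((\<lambda>u. r * u) -` C \<inter> {0<..}) u * ennreal (?w u) * indicator {0<..} u"
    proof (cases "0 < u")
      case True
      have "r powr \<alpha> * r * ?w (r * u) = (r powr \<alpha> * r powr 1 * r powr (- \<alpha> - 1)) * ?w u"
        using r True by (simp add: powr_mult mult.assoc mult.left_commute)
      also have "r powr \<alpha> * r powr 1 * r powr (- \<alpha> - 1) = 1"
        using r unfolding powr_add[symmetric] by simp
      finally have w: "r powr \<alpha> * r * ?w (r * u) = ?w u" by (simp only: mult_1)
      have "ennreal (r powr \<alpha> * r) * ennreal (?w (r * u)) = ennreal (r powr \<alpha> * r * ?w (r * u))"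
        using r by (intro ennreal_mult'[symmetric]) auto
      then have "ennreal (r powr \<alpha> * r) * ennreal (?w (r * u)) = ennreal (?w u)" unfolding w .
      then show ?thesis using True r
        by (simp add: indicator_def)
    qed (use r in \<open>simp add: zero_less_mult_iff\<close>)
  qed
  also have "\<dots> = (\<integral>\<^sup>+u. indicator ((\<lambda>u. r * u) -` C \<inter> {0<..}) u \<partial>stable_jump_measure \<alpha>)"
    using Db by (subst nn_integral_stable_jump_measure) auto
  also have "\<dots> = emeasure (stable_jump_measure \<alpha>) ((\<lambda>u. r * u) -` C \<inter> {0<..})"
    using Db by simp
  finally show ?thesis by simp
qed

lemma space_stable_intensity: "space (stable_intensity \<alpha>) = {0<..} \<times> {0<..}"
  by (simp add: stable_intensity_def space_pair_measure space_restrict_space space_stable_jump_measure)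

lemma sigma_finite_stable_intensity: "sigma_finite_measure (stable_intensity \<alpha>)"
proof -
  interpret A: sigma_finite_measure "restrict_space lborel {0::real<..}"
    by (rule sigma_finite_measure_restrict_space) (auto simp: sigma_finite_lborel)
  interpret B: sigma_finite_measure "stable_jump_measure \<alpha>"
    by (rule sigma_finite_stable_jump_measure)
  interpret pair_sigma_finite "restrict_space lborel {0::real<..}" "stable_jump_measure \<alpha>" ..
  show ?thesis unfolding stable_intensity_def by unfold_locales
qed

lemma measurable_from_stable_intensity:
  assumes "f \<in> borel \<Otimes>\<^sub>M borel \<rightarrow>\<^sub>M N"
  shows "f \<in> stable_intensity \<alpha> \<rightarrow>\<^sub>M N"
proof -
  have 1: "(\<lambda>x. x) \<in> restrict_space lborel {0<..} \<rightarrow>\<^sub>M (borel :: real measure)"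
    by (rule measurable_restrict_space1) simp
  have 2: "(\<lambda>x. x) \<in> stable_jump_measure \<alpha> \<rightarrow>\<^sub>M (borel :: real measure)"
    by (rule measurable_from_stable_jump_measure) simp
  have "(\<lambda>x. (fst x, snd x)) \<in> stable_intensity \<alpha> \<rightarrow>\<^sub>M borel \<Otimes>\<^sub>M borel"
    unfolding stable_intensity_def
    by (intro measurable_Pair measurable_compose[OF measurable_fst 1] measurable_compose[OF measurable_snd 2])
  then show ?thesis using measurable_compose[OF _ assms] by simp
qed

lemma nn_integral_stable_intensity:
  assumes H: "H \<in> borel_measurable (stable_intensity \<alpha>)"
  shows "(\<integral>\<^sup>+x. H x \<partial>stable_intensity \<alpha>) =
    (\<integral>\<^sup>+s. (\<integral>\<^sup>+u. H (s, u) \<partial>stable_jump_measure \<alpha>) * indicator {0<..} s \<partial>lborel)"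
proof -
  interpret sigma_finite_measure "stable_jump_measure \<alpha>" by (rule sigma_finite_stable_jump_measure)
  show ?thesis
    using H unfolding stable_intensity_def
    by (subst nn_integral_fst[symmetric]) (auto simp: nn_integral_restrict_space)
qed

text \<open>The points \<open>(t i, p i)\<close> are the times and sizes of the jumps of the \<open>\<alpha>\<close>-stable subordinator; the marks
  play no role yet.\<close>

locale stable_points = prob_space M for M :: "'w measure" +
  fixes \<alpha> :: real and t p :: "nat \<Rightarrow> 'w \<Rightarrow> real"
  assumes \<alpha>: "0 < \<alpha>" "\<alpha> < 1"
    and ppp: "poisson_point_process M (stable_intensity \<alpha>) (\<lambda>i \<omega>. (t i \<omega>, p i \<omega>))"
begin

abbreviation "\<nu> \<equiv> stable_intensity \<alpha>"
abbreviation "\<mu> \<equiv> stable_jump_measure \<alpha>"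
text \<open>The density of \<open>\<mu>\<close>, and the times, the sizes, and the sizes up to time \<open>1\<close> scaled by a factor, of the
  jumps of one realisation\<close>

abbreviation (input) "jump_density u \<equiv> ennreal (\<alpha> / Gamma (1 - \<alpha>) * u powr (- \<alpha> - 1))"
abbreviation (input) "jump_times \<omega> \<equiv> \<lambda>j. t j \<omega>"
abbreviation (input) "jump_sizes \<omega> \<equiv> \<lambda>j. p j \<omega>"
abbreviation (input) "scaled_jumps r \<omega> \<equiv> points borel {j. t j \<omega> \<le> 1} (\<lambda>j. r * p j \<omega>)"

lemma X_measurable [measurable]: "(\<lambda>\<omega>. (t i \<omega>, p i \<omega>)) \<in> M \<rightarrow>\<^sub>M \<nu>"
  using ppp by (simp add: poisson_point_process_def Let_def)

lemma t_measurable [measurable]: "t i \<in> borel_measurable M"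
  and p_measurable [measurable]: "p i \<in> borel_measurable M"
proof -
  show "t i \<in> borel_measurable M"
    using measurable_compose[OF X_measurable[of i] measurable_from_stable_intensity[OF measurable_fst]] by simp
  show "p i \<in> borel_measurable M"
    using measurable_compose[OF X_measurable[of i] measurable_from_stable_intensity[OF measurable_snd]] by simp
qed

lemma t_pos: "\<omega> \<in> space M \<Longrightarrow> 0 < t i \<omega>" and p_pos: "\<omega> \<in> space M \<Longrightarrow> 0 < p i \<omega>"
  using measurable_space[OF X_measurable, of \<omega> i] by (auto simp: space_stable_intensity)

lemma X_space: "\<omega> \<in> space M \<Longrightarrow> (t i \<omega>, p i \<omega>) \<in> space \<nu>"
  using measurable_space[OF X_measurable] .

text \<open>The total size of the points with indices in \<open>J\<close>\<close>

definition mass_in :: "nat set \<Rightarrow> 'w \<Rightarrow> ennreal" where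
  "mass_in J \<omega> = (\<Sum>j. if j \<in> J then ennreal (p j \<omega>) else 0)"

text \<open>The Mecke equation for functionals that see, from a point \<open>X = (s, u)\<close> of the process, the
  total size of the other points at the times \<open>s'\<close> with \<open>a s s'\<close> and the counting measure of their
  sizes, rescaled by a factor that may depend on \<open>X\<close> and on that total size.\<close>

lemma mecke_sections:
  fixes a :: "real \<Rightarrow> real \<Rightarrow> bool" and c :: "(real \<times> real) \<times> ennreal \<Rightarrow> real"
    and G :: "(real \<times> real) \<times> ennreal \<times> real measure \<Rightarrow> ennreal"
  assumes a: "Measurable.pred (borel \<Otimes>\<^sub>M borel) (\<lambda>z. a (fst z) (snd z))"
    and c: "c \<in> borel_measurable (\<nu> \<Otimes>\<^sub>M borel)"
    and G: "G \<in> borel_measurable (\<nu> \<Otimes>\<^sub>M borel \<Otimes>\<^sub>M measure_algebra borel)"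
  shows "(\<integral>\<^sup>+\<omega>. (\<Sum>i. let x = (t i \<omega>, p i \<omega>); J = {j. a (t i \<omega>) (t j \<omega>)} - {i} in
        G (x, mass_in J \<omega>, points borel J (\<lambda>j. c (x, mass_in J \<omega>) * p j \<omega>))) \<partial>M) =
    (\<integral>\<^sup>+x. (\<integral>\<^sup>+\<omega>. (let J = {j. a (fst x) (t j \<omega>)} in
        G (x, mass_in J \<omega>, points borel J (\<lambda>j. c (x, mass_in J \<omega>) * p j \<omega>))) \<partial>M) \<partial>\<nu>)"
    (is "(\<integral>\<^sup>+\<omega>. (\<Sum>i. ?other \<omega> i) \<partial>M) = (\<integral>\<^sup>+x. (\<integral>\<^sup>+\<omega>. ?all x \<omega> \<partial>M) \<partial>\<nu>)")
proof -
  define D where "D = {(x, y). a (fst x) (fst y)} \<inter> space (\<nu> \<Otimes>\<^sub>M \<nu>)"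
  define others where "others s \<omega> = {j. a s (t j \<omega>)}" for s \<omega>
  have D: "D \<in> sets (\<nu> \<Otimes>\<^sub>M \<nu>)"
  proof -
    have f: "fst \<in> borel_measurable \<nu>" by (rule measurable_from_stable_intensity) simp
    have "(\<lambda>z. (fst (fst z), fst (snd z))) \<in> \<nu> \<Otimes>\<^sub>M \<nu> \<rightarrow>\<^sub>M borel \<Otimes>\<^sub>M borel"
      by (intro measurable_Pair measurable_compose[OF measurable_fst f] measurable_compose[OF measurable_snd f])
    from measurable_compose[OF this a] show ?thesis
      by (simp add: D_def pred_def split_beta' Collect_conj_eq Int_commute)
  qed
  have memD: "(x, (t j \<omega>, p j \<omega>)) \<in> D \<longleftrightarrow> j \<in> others (fst x) \<omega>"
    if "\<omega> \<in> space M" "x \<in> space \<nu>" for x j \<omega>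
    using that X_space[OF that(1), of j] by (simp add: D_def others_def space_pair_measure)
  let ?N = "\<lambda>I \<omega>. points \<nu> I (\<lambda>i. (t i \<omega>, p i \<omega>))"
  interpret \<nu>: sigma_finite_measure \<nu> by (rule sigma_finite_stable_intensity)
  obtain B :: "nat \<Rightarrow> (real \<times> real) set" where B: "range B \<subseteq> sets \<nu>" "(\<Union>i. B i) = space \<nu>"
    "\<And>i. emeasure \<nu> (B i) \<noteq> \<infinity>" "disjoint_family B"
    using \<nu>.sigma_finite_disjoint by blast
  let ?lf = "\<lambda>\<eta>. \<forall>n. emeasure \<eta> (B n) < \<infinity>"
  let ?MA = "measure_algebra (borel :: real measure)"
  let ?MN = "measure_algebra \<nu>"
  have [measurable]: "B n \<in> sets \<nu>" for n using B(1) by auto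
  have snd_\<nu>: "snd \<in> borel_measurable \<nu>" by (rule measurable_from_stable_intensity) simp
  \<comment> \<open>\<open>K1\<close> counts the sizes in a section of \<open>D\<close>, and \<open>K2\<close> counts them after scaling. The factor is an additional
    coordinate of the argument of \<open>K2\<close>, and \<open>D2\<close> is \<open>D\<close> extended by that coordinate.\<close>
  define K1 :: "(real \<times> real) \<times> (real \<times> real) measure \<Rightarrow> real measure"
    where "K1 = (\<lambda>(x, \<eta>). if ?lf \<eta> then distr (density \<eta> (indicator (Pair x -` D))) borel (\<lambda>y. snd (snd (x, y))) else null_measure borel)"
  define D2 where "D2 = (\<lambda>z :: ((real \<times> real) \<times> real) \<times> (real \<times> real). (fst (fst z), snd z)) -` D \<inter> space ((\<nu> \<Otimes>\<^sub>M borel) \<Otimes>\<^sub>M \<nu>)"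
  define K2 :: "((real \<times> real) \<times> real) \<times> (real \<times> real) measure \<Rightarrow> real measure"
    where "K2 = (\<lambda>(x, \<eta>). if ?lf \<eta> then distr (density \<eta> (indicator (Pair x -` D2))) borel
      (\<lambda>y. snd (fst (x, y)) * snd (snd (x, y))) else null_measure borel)"
  have K1 [measurable]: "K1 \<in> \<nu> \<Otimes>\<^sub>M ?MN \<rightarrow>\<^sub>M ?MA"
    unfolding K1_def
    by (rule measurable_restricted_image[OF B(1,4,2) D]) (rule measurable_compose[OF measurable_snd snd_\<nu>])
  have D2: "D2 \<in> sets ((\<nu> \<Otimes>\<^sub>M borel) \<Otimes>\<^sub>M \<nu>)"
    unfolding D2_def by (rule measurable_sets[OF _ D]) measurable
  have K2 [measurable]: "K2 \<in> (\<nu> \<Otimes>\<^sub>M borel) \<Otimes>\<^sub>M ?MN \<rightarrow>\<^sub>M ?MA"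
    unfolding K2_def
  proof (rule measurable_restricted_image[OF B(1,4,2) D2])
    note [measurable] = snd_\<nu>
    show "(\<lambda>z. snd (fst z) * snd (snd z)) \<in> borel_measurable ((\<nu> \<Otimes>\<^sub>M borel) \<Otimes>\<^sub>M \<nu>)"
      by measurable
  qed
  define m where "m z = (\<integral>\<^sup>+r. ennreal r \<partial>K1 z)" for z
  have m [measurable]: "m \<in> borel_measurable (\<nu> \<Otimes>\<^sub>M ?MN)"
    unfolding m_def by (rule measurable_compose[OF K1 nn_integral_measurable_measure_algebra]) simp
  define H where "H z = (if ?lf (snd z) then G (fst z, m z, K2 ((fst z, c (fst z, m z)), snd z)) else 0)" for z
  have lf [measurable]: "Measurable.pred (\<nu> \<Otimes>\<^sub>M ?MN) (\<lambda>z. ?lf (snd z))"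
  proof -
    have [measurable]: "(\<lambda>z. emeasure (snd z) (B n)) \<in> borel_measurable (\<nu> \<Otimes>\<^sub>M ?MN)" for n
      by (rule measurable_compose[OF measurable_snd measurable_emeasure_measure_algebra]) simp
    show ?thesis by measurable
  qed
  have cm [measurable]: "(\<lambda>z. c (fst z, m z)) \<in> borel_measurable (\<nu> \<Otimes>\<^sub>M ?MN)"
    by (rule measurable_compose[OF _ c]) measurable
  have k2 [measurable]: "(\<lambda>z. K2 ((fst z, c (fst z, m z)), snd z)) \<in> \<nu> \<Otimes>\<^sub>M ?MN \<rightarrow>\<^sub>M ?MA"
    by (rule measurable_compose[OF _ K2]) measurable
  have g [measurable]: "(\<lambda>z. G (fst z, m z, K2 ((fst z, c (fst z, m z)), snd z))) \<in> borel_measurable (\<nu> \<Otimes>\<^sub>M ?MN)"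
    by (rule measurable_compose[OF _ G]) measurable
  have H [measurable]: "H \<in> borel_measurable (\<nu> \<Otimes>\<^sub>M ?MN)"
    unfolding H_def by measurable
  have eval: "H (x, ?N I \<omega>) = G (x, mass_in (others (fst x) \<omega> \<inter> I) \<omega>,
      points borel (others (fst x) \<omega> \<inter> I) (\<lambda>j. c (x, mass_in (others (fst x) \<omega> \<inter> I) \<omega>) * p j \<omega>))"
    if \<omega>: "\<omega> \<in> space M" and lf: "?lf (?N I \<omega>)" and x: "x \<in> space \<nu>" for x \<omega> and I :: "nat set"
  proof -
    have Dx: "Pair x -` D \<in> sets \<nu>" by (rule sets_Pair1[OF D])
    have K1_eq: "K1 (x, ?N I \<omega>) = points borel (others (fst x) \<omega> \<inter> I) (jump_sizes \<omega>)"
    proof -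
      have "K1 (x, ?N I \<omega>) = distr (density (?N I \<omega>) (indicator (Pair x -` D))) borel snd"
        using lf by (simp add: K1_def)
      also have "\<dots> = points borel {i \<in> I. (t i \<omega>, p i \<omega>) \<in> Pair x -` D} (\<lambda>i. snd (t i \<omega>, p i \<omega>))"
        by (rule restricted_image_points[OF X_space[OF \<omega>] Dx snd_\<nu>])
      also have "\<dots> = points borel (others (fst x) \<omega> \<inter> I) (jump_sizes \<omega>)"
        by (rule points_cong) (auto simp: memD[OF \<omega> x])
      finally show ?thesis .
    qed
    have m_eq: "m (x, ?N I \<omega>) = mass_in (others (fst x) \<omega> \<inter> I) \<omega>"
      unfolding m_def K1_eq by (subst nn_integral_points) (auto simp: mass_in_def)
    have K2_eq: "K2 ((x, r), ?N I \<omega>) = points borel (others (fst x) \<omega> \<inter> I) (\<lambda>j. r * p j \<omega>)" for r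
    proof -
      have D2x: "Pair (x, r) -` D2 = Pair x -` D"
        using x sets.sets_into_space[OF Dx] by (auto simp: D2_def space_pair_measure)
      have "K2 ((x, r), ?N I \<omega>) = distr (density (?N I \<omega>) (indicator (Pair x -` D))) borel (\<lambda>y. r * snd y)"
        using lf by (simp add: K2_def D2x)
      also have "\<dots> = points borel {i \<in> I. (t i \<omega>, p i \<omega>) \<in> Pair x -` D} (\<lambda>i. r * snd (t i \<omega>, p i \<omega>))"
        using snd_\<nu> by (intro restricted_image_points[OF X_space[OF \<omega>] Dx]) simp
      also have "\<dots> = points borel (others (fst x) \<omega> \<inter> I) (\<lambda>j. r * p j \<omega>)"
        by (rule points_cong) (auto simp: memD[OF \<omega> x])
      finally show ?thesis .
    qed
    show ?thesis using lf by (simp add: H_def m_eq K2_eq)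
  qed
  \<comment> \<open>The expected number of points in \<open>B n\<close> is finite.\<close>
  have lf_AE: "AE \<omega> in M. ?lf (?N UNIV \<omega>)"
  proof (subst AE_all_countable, intro allI)
    fix n
    have prm: "poisson_random_measure M \<nu> (?N UNIV)" by (rule poisson_point_process_random_measure[OF ppp])
    have [measurable]: "(\<lambda>\<omega>. emeasure (?N UNIV \<omega>) (B n)) \<in> borel_measurable M"
      by (rule measurable_emeasure_measure_algebra_compose[OF poisson_point_process_points_measurable[OF ppp]]) simp
    have "(\<integral>\<^sup>+\<omega>. emeasure (?N UNIV \<omega>) (B n) \<partial>M) = emeasure \<nu> (B n)"
      using poisson_random_measure_size_bias[OF prob_space_axioms prm, of "B n" "\<lambda>_. 1"] B(3)[of n]
      by (simp add: top.not_eq_extremum emeasure_space_1)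
    then have "AE \<omega> in M. emeasure (?N UNIV \<omega>) (B n) \<noteq> \<infinity>"
      using B(3)[of n] by (intro nn_integral_PInf_AE) auto
    then show "AE \<omega> in M. emeasure (?N UNIV \<omega>) (B n) < \<infinity>"
      by (simp add: top.not_eq_extremum)
  qed
  have lf_mono: "?lf (?N I \<omega>)" if "?lf (?N UNIV \<omega>)" "\<omega> \<in> space M" for I \<omega>
  proof
    fix n
    have "emeasure (?N I \<omega>) (B n) \<le> emeasure (?N UNIV \<omega>) (B n)"
      using that(2) X_space by (auto simp: emeasure_points intro!: suminf_le summableI)
    also have "\<dots> < \<infinity>" using that(1) by (rule spec)
    finally show "emeasure (?N I \<omega>) (B n) < \<infinity>" .
  qed
  have "(\<integral>\<^sup>+\<omega>. (\<Sum>i. ?other \<omega> i) \<partial>M) =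
      (\<integral>\<^sup>+\<omega>. (\<Sum>i. H ((t i \<omega>, p i \<omega>), ?N (UNIV - {i}) \<omega>)) \<partial>M)"
  proof (rule nn_integral_cong_AE)
    show "AE \<omega> in M. (\<Sum>i. ?other \<omega> i) =
      (\<Sum>i. H ((t i \<omega>, p i \<omega>), ?N (UNIV - {i}) \<omega>))"
      using lf_AE
    proof (rule AE_mp, intro AE_I2 impI)
      fix \<omega> assume \<omega>: "\<omega> \<in> space M" "?lf (?N UNIV \<omega>)"
      show "(\<Sum>i. ?other \<omega> i) =
        (\<Sum>i. H ((t i \<omega>, p i \<omega>), ?N (UNIV - {i}) \<omega>))"
      proof (intro arg_cong[where f=suminf] ext)
        fix i
        have "others (t i \<omega>) \<omega> \<inter> (UNIV - {i}) = {j. a (t i \<omega>) (t j \<omega>)} - {i}"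
          by (auto simp: others_def)
        then show "?other \<omega> i =
          H ((t i \<omega>, p i \<omega>), ?N (UNIV - {i}) \<omega>)"
          unfolding eval[OF \<omega>(1) lf_mono[OF \<omega>(2,1)] X_space[OF \<omega>(1)]] Let_def fst_conv by (simp only:)
      qed
    qed
  qed
  also have "\<dots> = (\<integral>\<^sup>+x. (\<integral>\<^sup>+\<omega>. H (x, ?N UNIV \<omega>) \<partial>M) \<partial>\<nu>)"
    by (rule mecke[OF sigma_finite_stable_intensity ppp H])
  also have "\<dots> = (\<integral>\<^sup>+x. (\<integral>\<^sup>+\<omega>. ?all x \<omega> \<partial>M) \<partial>\<nu>)"
  proof (rule nn_integral_cong, rule nn_integral_cong_AE)
    fix x assume x: "x \<in> space \<nu>"
    show "AE \<omega> in M. H (x, ?N UNIV \<omega>) = ?all x \<omega>"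
      using lf_AE
    proof (rule AE_mp, intro AE_I2 impI)
      fix \<omega> assume \<omega>: "\<omega> \<in> space M" "?lf (?N UNIV \<omega>)"
      show "H (x, ?N UNIV \<omega>) = ?all x \<omega>"
        unfolding eval[OF \<omega>(1) \<omega>(2) x] Let_def others_def by simp
    qed
  qed
  finally show ?thesis .
qed

text \<open>Self-similarity: the jumps up to time \<open>s\<close> are jointly distributed as \<open>s\<^sup>1\<^sup>/\<^sup>\<alpha>\<close> times the jumps
  up to time \<open>1\<close>.\<close>

lemma jumps_self_similar:
  assumes s: "0 < s" and k: "k \<in> borel_measurable (measure_algebra (borel :: real measure))"
  shows "(\<integral>\<^sup>+\<omega>. k (points borel {j. t j \<omega> < s} (jump_sizes \<omega>)) \<partial>M) =
    (\<integral>\<^sup>+\<omega>. k (scaled_jumps (s powr (1 / \<alpha>)) \<omega>) \<partial>M)"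
proof -
  define r where "r = s powr (1 / \<alpha>)"
  have r: "0 < r" "r powr \<alpha> = s" using s \<alpha> by (auto simp: r_def powr_powr)
  \<comment> \<open>Both families of sizes form Poisson random measures with intensity \<open>\<kappa> = s \<mu>\<close>.\<close>
  define \<kappa> where "\<kappa> = density \<mu> (\<lambda>_. ennreal s)"
  have sets_\<kappa>: "sets \<kappa> = sets \<mu>" and space_\<kappa>: "space \<kappa> = {0<..}"
    by (simp_all add: \<kappa>_def space_stable_jump_measure)
  have \<kappa>: "emeasure \<kappa> C = ennreal s * emeasure \<mu> C" if "C \<in> sets \<mu>" for C
    using that unfolding \<kappa>_def by (subst emeasure_density) (auto simp: nn_integral_cmult)
  interpret \<mu>: sigma_finite_measure \<mu> by (rule sigma_finite_stable_jump_measure)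
  have sf: "sigma_finite_measure \<kappa>"
    unfolding \<kappa>_def by (subst \<mu>.sigma_finite_iff_density_finite) auto
  have time: "emeasure (restrict_space lborel {0<..}) A = emeasure lborel A"
    if "A \<in> sets borel" "A \<subseteq> {0<..}" for A :: "real set"
    using that by (subst emeasure_restrict_space) auto
  have rect: "emeasure \<nu> (A \<times> C) = emeasure lborel A * emeasure \<mu> C"
    if "A \<in> sets borel" "A \<subseteq> {0<..}" "C \<in> sets \<mu>" for A C
    using that unfolding stable_intensity_def
    by (subst \<mu>.emeasure_pair_measure_Times) (auto simp: time sets_restrict_space)
  have snd_meas: "(\<lambda>x. b * snd x) \<in> \<nu> \<rightarrow>\<^sub>M \<kappa>" if "0 < b" for b
  proof -
    have "(\<lambda>u. b * u) \<in> restrict_space borel {0<..} \<rightarrow>\<^sub>M restrict_space borel {0::real<..}"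
      using that by (intro measurable_restrict_space2 measurable_restrict_space1) (auto simp: space_restrict_space)
    then have "(\<lambda>u. b * u) \<in> \<mu> \<rightarrow>\<^sub>M \<kappa>"
      by (simp cong: measurable_cong_sets add: sets_\<kappa> sets_stable_jump_measure)
    then show ?thesis
      unfolding stable_intensity_def by (rule measurable_compose[OF measurable_snd])
  qed
  have A1: "{0<..<s} \<times> {0<..} \<in> sets \<nu>" and A2: "{0<..1} \<times> {0<..} \<in> sets \<nu>"
  proof -
    have "A \<times> {0<..} \<in> sets \<nu>" if "A \<in> sets borel" "A \<subseteq> {0<..}" for A :: "real set"
      unfolding stable_intensity_def using that sets.top[of \<mu>]
      by (intro pair_measureI) (auto simp: sets_restrict_space space_stable_jump_measure Int_absorb1 intro!: image_eqI[of _ _ A])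
    from this[of "{0<..<s}"] this[of "{0<..1}"]
    show "{0<..<s} \<times> {0<..} \<in> sets \<nu>" "{0<..1} \<times> {0<..} \<in> sets \<nu>" by (auto simp: subset_eq)
  qed
  have sub: "C \<subseteq> {0<..}" if "C \<in> sets \<kappa>" for C
    using sets.sets_into_space[OF that] by (simp add: space_\<kappa>)
  let ?N1 = "\<lambda>\<omega>. points \<kappa> {i. (t i \<omega>, p i \<omega>) \<in> {0<..<s} \<times> {0<..}} (\<lambda>i. 1 * snd (t i \<omega>, p i \<omega>))"
  let ?N2 = "\<lambda>\<omega>. points \<kappa> {i. (t i \<omega>, p i \<omega>) \<in> {0<..1} \<times> {0<..}} (\<lambda>i. r * snd (t i \<omega>, p i \<omega>))"
  have prm1: "poisson_random_measure M \<kappa> ?N1"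
  proof (rule poisson_point_process_image[OF ppp A1 snd_meas])
    show "space \<kappa> \<subseteq> (\<lambda>x. 1 * snd x) ` ({0<..<s} \<times> {0<..})"
    proof
      fix x assume "x \<in> space \<kappa>"
      then show "x \<in> (\<lambda>x. 1 * snd x) ` ({0<..<s} \<times> {0<..})"
        using s by (intro image_eqI[of _ _ "(s / 2, x)"]) (auto simp: space_\<kappa>)
    qed
    fix C assume C: "C \<in> sets \<kappa>"
    have "(\<lambda>x. 1 * snd x) -` C \<inter> ({0<..<s} \<times> {0<..}) = {0<..<s} \<times> C" using sub[OF C] by auto
    then show "emeasure \<nu> ((\<lambda>x. 1 * snd x) -` C \<inter> ({0<..<s} \<times> {0<..})) = emeasure \<kappa> C"
      using C s rect[of "{0<..<s}" C] by (simp add: \<kappa> sets_\<kappa> subset_eq)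
  qed simp
  have prm2: "poisson_random_measure M \<kappa> ?N2"
  proof (rule poisson_point_process_image[OF ppp A2 snd_meas[OF r(1)]])
    show "space \<kappa> \<subseteq> (\<lambda>x. r * snd x) ` ({0::real<..1} \<times> {0<..})"
    proof
      fix x assume "x \<in> space \<kappa>"
      then show "x \<in> (\<lambda>x. r * snd x) ` ({0::real<..1} \<times> {0<..})"
        using r by (intro image_eqI[of _ _ "(1, x / r)"]) (auto simp: space_\<kappa>)
    qed
    fix C assume C: "C \<in> sets \<kappa>"
    have rC: "(\<lambda>u. r * u) -` C \<inter> {0<..} \<in> sets \<mu>"
    proof -
      have "(\<lambda>u. r * u) \<in> restrict_space borel {0<..} \<rightarrow>\<^sub>M restrict_space borel {0::real<..}"
        using r by (intro measurable_restrict_space2 measurable_restrict_space1) (auto simp: space_restrict_space)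
      then have "(\<lambda>u. r * u) \<in> \<mu> \<rightarrow>\<^sub>M \<kappa>"
        by (simp cong: measurable_cong_sets add: sets_\<kappa> sets_stable_jump_measure)
      from measurable_sets[OF this C] show ?thesis by (simp add: space_stable_jump_measure)
    qed
    have "(\<lambda>x. r * snd x) -` C \<inter> ({0::real<..1} \<times> {0<..}) = {0<..1} \<times> ((\<lambda>u. r * u) -` C \<inter> {0<..})" by auto
    then show "emeasure \<nu> ((\<lambda>x. r * snd x) -` C \<inter> ({0::real<..1} \<times> {0<..})) = emeasure \<kappa> C"
      using C rC r rect[of "{0<..1}" "(\<lambda>u. r * u) -` C \<inter> {0<..}"]
      by (simp add: \<kappa> sets_\<kappa> stable_jump_measure_scaling subset_eq)
  qed
  have idm: "(\<lambda>x. x) \<in> \<kappa> \<rightarrow>\<^sub>M (borel :: real measure)"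
    using measurable_from_stable_jump_measure[of "\<lambda>x. x" borel \<alpha>]
    by (simp cong: measurable_cong_sets add: sets_\<kappa>)
  have kd: "(\<lambda>\<xi>. k (distr \<xi> borel (\<lambda>x. x))) \<in> borel_measurable (measure_algebra \<kappa>)"
    by (rule measurable_compose[OF measurable_distr_measure_algebra[OF idm] k])
  have m1: "?N1 \<in> M \<rightarrow>\<^sub>M measure_algebra \<kappa>"
    and m2: "?N2 \<in> M \<rightarrow>\<^sub>M measure_algebra \<kappa>"
    using prm1 prm2 by (auto simp: poisson_random_measure_def)
  have "(\<integral>\<^sup>+\<omega>. k (points borel {j. t j \<omega> < s} (jump_sizes \<omega>)) \<partial>M) =
      (\<integral>\<^sup>+\<omega>. k (distr (?N1 \<omega>) borel (\<lambda>x. x)) \<partial>M)"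
  proof (intro nn_integral_cong arg_cong[where f=k])
    fix \<omega> assume \<omega>: "\<omega> \<in> space M"
    show "points borel {j. t j \<omega> < s} (jump_sizes \<omega>) =
      distr (?N1 \<omega>) borel (\<lambda>x. x)"
      using t_pos[OF \<omega>] p_pos[OF \<omega>]
      by (subst distr_points[OF _ idm]) (auto simp: space_\<kappa> intro!: points_cong)
  qed
  also have "\<dots> = (\<integral>\<^sup>+\<xi>. k (distr \<xi> borel (\<lambda>x. x)) \<partial>distr M (measure_algebra \<kappa>)
      ?N1)"
    using kd by (intro nn_integral_distr[OF m1, symmetric]) simp
  also have "\<dots> = (\<integral>\<^sup>+\<xi>. k (distr \<xi> borel (\<lambda>x. x)) \<partial>distr M (measure_algebra \<kappa>)
      ?N2)"
    using poisson_random_measure_unique[OF sf prob_space_axioms prob_space_axioms prm1 prm2] by simp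
  also have "\<dots> = (\<integral>\<^sup>+\<omega>. k (distr (?N2 \<omega>) borel (\<lambda>x. x)) \<partial>M)"
    using kd by (intro nn_integral_distr[OF m2]) simp
  also have "\<dots> = (\<integral>\<^sup>+\<omega>. k (scaled_jumps (s powr (1 / \<alpha>)) \<omega>) \<partial>M)"
  proof (intro nn_integral_cong arg_cong[where f=k])
    fix \<omega> assume \<omega>: "\<omega> \<in> space M"
    show "distr (?N2 \<omega>) borel (\<lambda>x. x) =
      scaled_jumps (s powr (1 / \<alpha>)) \<omega>"
      using t_pos[OF \<omega>] p_pos[OF \<omega>] r
      by (subst distr_points[OF _ idm]) (auto simp: space_\<kappa> r_def intro!: points_cong)
  qed
  finally show ?thesis .
qed

end

section \<open>The common law\<close>

text \<open>The triples consist of the relative undershoot, the other relative masses, and the relative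
  overshoot.\<close>

abbreviation triple_space :: "(real \<times> real measure \<times> real) measure" where
  "triple_space \<equiv> borel \<Otimes>\<^sub>M measure_algebra borel \<Otimes>\<^sub>M borel"

text \<open>The total size of the jumps before the jump with index \<open>i\<close>; here and in the next definition \<open>t\<close>
  and \<open>p\<close> are the times and sizes of one realisation.\<close>

definition mass_before :: "(nat \<Rightarrow> real) \<Rightarrow> (nat \<Rightarrow> real) \<Rightarrow> nat \<Rightarrow> ennreal" where
  "mass_before t p i = (\<Sum>j. if t j < t i then ennreal (p j) else 0)"

text \<open>The functional \<open>F\<close> of the triple at level \<open>T\<close> if this level is crossed by the jump with index \<open>i\<close>,
  and \<open>0\<close> otherwise. A jump does not cross the levels at which it starts and ends.\<close>

definition crossing ::
  "(real \<times> real measure \<times> real \<Rightarrow> ennreal) \<Rightarrow> (nat \<Rightarrow> real) \<Rightarrow> (nat \<Rightarrow> real) \<Rightarrow> real \<Rightarrow> nat \<Rightarrow> ennreal" where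
  "crossing F t p T i =
    (if mass_before t p i < ennreal T \<and> ennreal T < mass_before t p i + ennreal (p i)
     then F ((T - enn2real (mass_before t p i)) / T, points borel {j. t j < t i} (\<lambda>j. 1 / T * p j),
        (enn2real (mass_before t p i) + p i - T) / T)
     else 0)"

lemma measurable_mass_before:
  assumes [measurable]: "\<And>j. t j \<in> borel_measurable N" "\<And>j. p j \<in> borel_measurable N"
  shows "(\<lambda>\<omega>. mass_before (\<lambda>j. t j \<omega>) (\<lambda>j. p j \<omega>) i) \<in> borel_measurable N"
  unfolding mass_before_def by measurable

lemma measurable_crossing:
  assumes [measurable]: "F \<in> borel_measurable triple_space"
    "\<And>j. t j \<in> borel_measurable N" "\<And>j. p j \<in> borel_measurable N" "l \<in> borel_measurable N"
  shows "(\<lambda>\<omega>. crossing F (\<lambda>j. t j \<omega>) (\<lambda>j. p j \<omega>) (l \<omega>) i) \<in> borel_measurable N"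
proof -
  have [measurable]: "(\<lambda>\<omega>. mass_before (\<lambda>j. t j \<omega>) (\<lambda>j. p j \<omega>) i) \<in> borel_measurable N"
    by (rule measurable_mass_before) measurable
  have [measurable]: "(\<lambda>\<omega>. points borel {j. t j \<omega> < t i \<omega>} (\<lambda>j. 1 / l \<omega> * p j \<omega>)) \<in> N \<rightarrow>\<^sub>M measure_algebra borel"
    by (rule measurable_points) measurable
  show ?thesis unfolding crossing_def by measurable
qed

context stable_points
begin

text \<open>The value of the subordinator at time \<open>1\<close>, and its real value, which is \<open>0\<close> where the former is
  infinite\<close>

definition mass_one :: "'w \<Rightarrow> ennreal" where
  "mass_one \<omega> = (\<Sum>j. if t j \<omega> \<le> 1 then ennreal (p j \<omega>) else 0)"

abbreviation "\<tau>\<^sub>1 \<omega> \<equiv> enn2real (mass_one \<omega>)"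

text \<open>The functional \<open>F\<close> of a triple with first mass \<open>y / (y + m)\<close> and other masses \<open>\<xi>\<close>, after integrating
  over the uniform variable \<open>w\<close> in the third component.\<close>

definition biased_value :: "(real \<times> real measure \<times> real \<Rightarrow> ennreal) \<Rightarrow> real \<Rightarrow> real \<Rightarrow> real measure \<Rightarrow> ennreal" where
  "biased_value F y m \<xi> = (\<integral>\<^sup>+w. F (y / (y + m), \<xi>, y / (y + m) * (w powr (- 1 / \<alpha>) - 1)) * indicator {0<..<1} w \<partial>lborel)"

text \<open>The expectation of \<open>F\<close> of each of the three triples: a jump of size \<open>y\<close> is added to the jumps up to time
  \<open>1\<close>, and the masses are relative to the total mass.\<close>

definition common_integral :: "(real \<times> real measure \<times> real \<Rightarrow> ennreal) \<Rightarrow> ennreal" where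
  "common_integral F = (\<integral>\<^sup>+\<omega>. ennreal (\<alpha> / Gamma (1 - \<alpha>)) * (\<integral>\<^sup>+y. ennreal (y powr (- \<alpha>) / (y + \<tau>\<^sub>1 \<omega>)) *
     biased_value F y (\<tau>\<^sub>1 \<omega>) (scaled_jumps (1 / (y + \<tau>\<^sub>1 \<omega>)) \<omega>) *
     indicator {0<..} y \<partial>lborel) \<partial>M)"

lemma mass_one_measurable [measurable]: "mass_one \<in> borel_measurable M"
  unfolding mass_one_def by measurable

lemma constant_nonneg: "0 \<le> \<alpha> / Gamma (1 - \<alpha>)"
  using \<alpha> Gamma_real_pos[of "1 - \<alpha>"] by simp

lemma X_pair_measurable:
  "(\<lambda>z. fst (fst z)) \<in> borel_measurable (\<nu> \<Otimes>\<^sub>M N)" "(\<lambda>z. snd (fst z)) \<in> borel_measurable (\<nu> \<Otimes>\<^sub>M N)"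
  by (rule measurable_compose[OF measurable_fst measurable_from_stable_intensity], simp)+

lemma nn_integral_nu_M_swap:
  assumes [measurable]: "f \<in> borel_measurable (\<nu> \<Otimes>\<^sub>M M)"
  shows "(\<integral>\<^sup>+x. (\<integral>\<^sup>+\<omega>. f (x, \<omega>) \<partial>M) \<partial>\<nu>) =
    (\<integral>\<^sup>+\<omega>. (\<integral>\<^sup>+s. (\<integral>\<^sup>+u. f ((s, u), \<omega>) * jump_density u * indicator {0<..} u \<partial>lborel)
       * indicator {0<..} s \<partial>lborel) \<partial>M)"
proof -
  interpret \<nu>: sigma_finite_measure \<nu> by (rule sigma_finite_stable_intensity)
  interpret pair_sigma_finite \<nu> M ..
  have "(\<integral>\<^sup>+x. (\<integral>\<^sup>+\<omega>. f (x, \<omega>) \<partial>M) \<partial>\<nu>) = (\<integral>\<^sup>+\<omega>. (\<integral>\<^sup>+x. f (x, \<omega>) \<partial>\<nu>) \<partial>M)"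
    using Fubini'[of "\<lambda>x \<omega>. f (x, \<omega>)"] by simp
  also have "\<dots> = (\<integral>\<^sup>+\<omega>. (\<integral>\<^sup>+s. (\<integral>\<^sup>+u. f ((s, u), \<omega>) * jump_density u * indicator {0<..} u \<partial>lborel)
       * indicator {0<..} s \<partial>lborel) \<partial>M)"
  proof (rule nn_integral_cong)
    fix \<omega> assume \<omega>: "\<omega> \<in> space M"
    have f\<omega>: "(\<lambda>x. f (x, \<omega>)) \<in> borel_measurable \<nu>" using \<omega> by measurable
    have "(\<integral>\<^sup>+x. f (x, \<omega>) \<partial>\<nu>) = (\<integral>\<^sup>+s. (\<integral>\<^sup>+u. f ((s, u), \<omega>) \<partial>\<mu>) * indicator {0<..} s \<partial>lborel)"
      by (rule nn_integral_stable_intensity[OF f\<omega>])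
    also have "\<dots> = (\<integral>\<^sup>+s. (\<integral>\<^sup>+u. f ((s, u), \<omega>) * jump_density u * indicator {0<..} u \<partial>lborel)
       * indicator {0<..} s \<partial>lborel)"
    proof (rule nn_integral_cong)
      fix s :: real
      show "(\<integral>\<^sup>+u. f ((s, u), \<omega>) \<partial>\<mu>) * indicator {0<..} s =
        (\<integral>\<^sup>+u. f ((s, u), \<omega>) * jump_density u * indicator {0<..} u \<partial>lborel) * indicator {0<..} s"
      proof (cases "0 < s")
        case True
        then have s: "s \<in> space (restrict_space lborel {0<..})" by (simp add: space_restrict_space)
        have "(\<lambda>u. f ((s, u), \<omega>)) \<in> borel_measurable \<mu>"
          using measurable_compose[OF measurable_Pair1'[OF s] f\<omega>[unfolded stable_intensity_def]] .
        then show ?thesis by (simp add: nn_integral_stable_jump_measure)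
      qed simp
    qed
    finally show "(\<integral>\<^sup>+x. f (x, \<omega>) \<partial>\<nu>) = (\<integral>\<^sup>+s. (\<integral>\<^sup>+u. f ((s, u), \<omega>) * jump_density u * indicator {0<..} u \<partial>lborel)
       * indicator {0<..} s \<partial>lborel)" .
  qed
  finally show ?thesis .
qed

text \<open>The sum over the jumps crossing the level \<open>T\<close>; its expectation does not depend on \<open>T\<close>.\<close>

theorem crossing_integral:
  assumes F [measurable]: "F \<in> borel_measurable triple_space" and T: "0 < T"
    and mass: "AE \<omega> in M. 0 < mass_one \<omega> \<and> mass_one \<omega> < \<infinity>"
  shows "(\<integral>\<^sup>+\<omega>. (\<Sum>i. crossing F (jump_times \<omega>) (jump_sizes \<omega>) T i) \<partial>M) = common_integral F"
proof -
  let ?MA = "measure_algebra (borel :: real measure)"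
  define G :: "(real \<times> real) \<times> ennreal \<times> real measure \<Rightarrow> ennreal" where
    "G = (\<lambda>z. if fst (snd z) < ennreal T \<and> ennreal T < fst (snd z) + ennreal (snd (fst z))
      then F ((T - enn2real (fst (snd z))) / T, snd (snd z), (enn2real (fst (snd z)) + snd (fst z) - T) / T) else 0)"
  have G: "G \<in> borel_measurable (\<nu> \<Otimes>\<^sub>M borel \<Otimes>\<^sub>M ?MA)"
  proof -
    note [measurable] = X_pair_measurable
    show ?thesis unfolding G_def by measurable
  qed
  have "(\<integral>\<^sup>+\<omega>. (\<Sum>i. crossing F (jump_times \<omega>) (jump_sizes \<omega>) T i) \<partial>M) =
      (\<integral>\<^sup>+\<omega>. (\<Sum>i. let x = (t i \<omega>, p i \<omega>); J = {j. t j \<omega> < t i \<omega>} - {i} in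
        G (x, mass_in J \<omega>, points borel J (\<lambda>j. 1 / T * p j \<omega>))) \<partial>M)"
  proof (intro nn_integral_cong arg_cong[where f=suminf] ext)
    fix \<omega> i
    have "{j. t j \<omega> < t i \<omega>} - {i} = {j. t j \<omega> < t i \<omega>}" by auto
    then show "crossing F (jump_times \<omega>) (jump_sizes \<omega>) T i =
      (let x = (t i \<omega>, p i \<omega>); J = {j. t j \<omega> < t i \<omega>} - {i} in
        G (x, mass_in J \<omega>, points borel J (\<lambda>j. 1 / T * p j \<omega>)))"
      by (simp add: Let_def crossing_def G_def mass_in_def mass_before_def)
  qed
  also have "\<dots> = (\<integral>\<^sup>+x. (\<integral>\<^sup>+\<omega>. (let J = {j. t j \<omega> < fst x} in
      G (x, mass_in J \<omega>, points borel J (\<lambda>j. 1 / T * p j \<omega>))) \<partial>M) \<partial>\<nu>)"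
    by (rule mecke_sections[where a="\<lambda>s s'. s' < s" and c="\<lambda>_. 1 / T", OF _ _ G]) simp_all
  also have "\<dots> = (\<integral>\<^sup>+x. (\<integral>\<^sup>+\<omega>. G (x, ennreal (fst x powr (1 / \<alpha>)) * mass_one \<omega>,
      scaled_jumps (fst x powr (1 / \<alpha>) / T) \<omega>) \<partial>M) \<partial>\<nu>)"
  proof (rule nn_integral_cong)
    fix x assume x: "x \<in> space \<nu>"
    then have s: "0 < fst x" by (auto simp: space_stable_intensity)
    \<comment> \<open>The functional in terms of the counting measure of the sizes alone, to which self-similarity
      applies\<close>
    define k where "k \<xi> = G (x, (\<integral>\<^sup>+r. ennreal r \<partial>\<xi>), distr \<xi> borel (\<lambda>r. 1 / T * r))" for \<xi>
    have mk: "k \<in> borel_measurable ?MA"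
    proof -
      have [measurable]: "(\<lambda>\<xi>. \<integral>\<^sup>+r. ennreal r \<partial>\<xi>) \<in> borel_measurable ?MA"
        by (rule nn_integral_measurable_measure_algebra) simp
      have [measurable]: "(\<lambda>\<xi>. distr \<xi> borel (\<lambda>r. 1 / T * r)) \<in> ?MA \<rightarrow>\<^sub>M ?MA"
        by (rule measurable_distr_measure_algebra) simp
      have "(\<lambda>\<xi>. (x, (\<integral>\<^sup>+r. ennreal r \<partial>\<xi>), distr \<xi> borel (\<lambda>r. 1 / T * r))) \<in> ?MA \<rightarrow>\<^sub>M \<nu> \<Otimes>\<^sub>M borel \<Otimes>\<^sub>M ?MA"
        using x by measurable
      from measurable_compose[OF this G] show ?thesis unfolding k_def .
    qed
    have k_points: "k (points borel J q) = G (x, (\<Sum>j. if j \<in> J then ennreal (q j) else 0), points borel J (\<lambda>j. 1 / T * q j))"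
      for J :: "nat set" and q
      unfolding k_def by (simp add: nn_integral_points distr_points)
        have "(\<integral>\<^sup>+\<omega>. (let J = {j. t j \<omega> < fst x} in
        G (x, mass_in J \<omega>, points borel J (\<lambda>j. 1 / T * p j \<omega>))) \<partial>M) = (\<integral>\<^sup>+\<omega>. k (points borel {j. t j \<omega> < fst x} (jump_sizes \<omega>)) \<partial>M)"
      by (simp add: k_points mass_in_def)
    also have "\<dots> = (\<integral>\<^sup>+\<omega>. k (scaled_jumps (fst x powr (1 / \<alpha>)) \<omega>) \<partial>M)"
      by (rule jumps_self_similar[OF s mk])
    also have "\<dots> = (\<integral>\<^sup>+\<omega>. G (x, ennreal (fst x powr (1 / \<alpha>)) * mass_one \<omega>,
      scaled_jumps (fst x powr (1 / \<alpha>) / T) \<omega>) \<partial>M)"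
    proof (rule nn_integral_cong)
      fix \<omega> assume \<omega>: "\<omega> \<in> space M"
      have "(\<Sum>j. if t j \<omega> \<le> 1 then ennreal (fst x powr (1 / \<alpha>) * p j \<omega>) else 0) =
          (\<Sum>j. ennreal (fst x powr (1 / \<alpha>)) * (if t j \<omega> \<le> 1 then ennreal (p j \<omega>) else 0))"
        by (intro arg_cong[where f=suminf] ext) (simp add: ennreal_mult')
      then show "k (scaled_jumps (fst x powr (1 / \<alpha>)) \<omega>) =
        G (x, ennreal (fst x powr (1 / \<alpha>)) * mass_one \<omega>,
          scaled_jumps (fst x powr (1 / \<alpha>) / T) \<omega>)"
        by (simp add: k_points mass_one_def)
    qed
    finally show "(\<integral>\<^sup>+\<omega>. (let J = {j. t j \<omega> < fst x} in
        G (x, mass_in J \<omega>, points borel J (\<lambda>j. 1 / T * p j \<omega>))) \<partial>M) =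
      (\<integral>\<^sup>+\<omega>. G (x, ennreal (fst x powr (1 / \<alpha>)) * mass_one \<omega>,
        scaled_jumps (fst x powr (1 / \<alpha>) / T) \<omega>) \<partial>M)" .
  qed
  also have "\<dots> = (\<integral>\<^sup>+\<omega>. (\<integral>\<^sup>+s. (\<integral>\<^sup>+u. G ((s, u), ennreal (s powr (1 / \<alpha>)) * mass_one \<omega>,
      scaled_jumps (s powr (1 / \<alpha>) / T) \<omega>) *
      jump_density u * indicator {0<..} u \<partial>lborel) * indicator {0<..} s \<partial>lborel) \<partial>M)"
  proof -
    note [measurable] = X_pair_measurable
    have pt [measurable]: "(\<lambda>z. points borel {j. t j (snd z) \<le> 1} (\<lambda>j. fst (fst z) powr (1 / \<alpha>) / T * p j (snd z))) \<in> \<nu> \<Otimes>\<^sub>M M \<rightarrow>\<^sub>M ?MA"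
      by (rule measurable_points) measurable
    have "(\<lambda>z. (fst z, ennreal (fst (fst z) powr (1 / \<alpha>)) * mass_one (snd z),
        points borel {j. t j (snd z) \<le> 1} (\<lambda>j. fst (fst z) powr (1 / \<alpha>) / T * p j (snd z)))) \<in> \<nu> \<Otimes>\<^sub>M M \<rightarrow>\<^sub>M \<nu> \<Otimes>\<^sub>M borel \<Otimes>\<^sub>M ?MA"
      by measurable
    from nn_integral_nu_M_swap[OF measurable_compose[OF this G]] show ?thesis by simp
  qed
  also have "\<dots> = common_integral F"
    unfolding common_integral_def
  proof (rule nn_integral_cong_AE)
    show "AE \<omega> in M. (\<integral>\<^sup>+s. (\<integral>\<^sup>+u. G ((s, u), ennreal (s powr (1 / \<alpha>)) * mass_one \<omega>,
        scaled_jumps (s powr (1 / \<alpha>) / T) \<omega>) *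
        jump_density u * indicator {0<..} u \<partial>lborel) * indicator {0<..} s \<partial>lborel) =
      ennreal (\<alpha> / Gamma (1 - \<alpha>)) * (\<integral>\<^sup>+y. ennreal (y powr (- \<alpha>) / (y + \<tau>\<^sub>1 \<omega>)) *
        biased_value F y (\<tau>\<^sub>1 \<omega>) (scaled_jumps (1 / (y + \<tau>\<^sub>1 \<omega>)) \<omega>) *
        indicator {0<..} y \<partial>lborel)" (is "AE \<omega> in M. ?lhs \<omega> = ?rhs \<omega>")
      using mass
    proof (rule AE_mp, intro AE_I2 impI)
      fix \<omega> assume \<omega>: "\<omega> \<in> space M" and "0 < mass_one \<omega> \<and> mass_one \<omega> < \<infinity>"
      then obtain \<tau> where \<tau>: "mass_one \<omega> = ennreal \<tau>" "0 < \<tau>"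
        by (cases "mass_one \<omega>") auto
      define f where "f = (\<lambda>(a, r, b). F (a, scaled_jumps r \<omega>, b))"
      have f [measurable]: "f \<in> borel_measurable (borel \<Otimes>\<^sub>M borel \<Otimes>\<^sub>M borel)"
      proof -
        have [measurable]: "(\<lambda>z :: real \<times> real \<times> real. scaled_jumps (fst (snd z)) \<omega>) \<in> borel \<Otimes>\<^sub>M borel \<Otimes>\<^sub>M borel \<rightarrow>\<^sub>M ?MA"
          by (rule measurable_points) measurable
        have "(\<lambda>z :: real \<times> real \<times> real. F (fst z, scaled_jumps (fst (snd z)) \<omega>, snd (snd z))) \<in> borel_measurable (borel \<Otimes>\<^sub>M borel \<Otimes>\<^sub>M borel)"
          by measurable
        then show ?thesis by (simp add: f_def split_beta')
      qed
      let ?c = "ennreal (\<alpha> / Gamma (1 - \<alpha>))"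
      let ?g = "\<lambda>s u. if s powr (1 / \<alpha>) * \<tau> < T \<and> T < s powr (1 / \<alpha>) * \<tau> + u
        then f ((T - s powr (1 / \<alpha>) * \<tau>) / T, s powr (1 / \<alpha>) / T, (s powr (1 / \<alpha>) * \<tau> + u - T) / T) else 0"
      have Gg: "G ((s, u), ennreal (s powr (1 / \<alpha>)) * mass_one \<omega>, scaled_jumps (s powr (1 / \<alpha>) / T) \<omega>) *
          jump_density u * indicator {0<..} u =
          ?c * (?g s u * ennreal (u powr (- \<alpha> - 1)) * indicator {0<..} u)" for s u
      proof (cases "0 < u")
        case True
        have m: "ennreal (s powr (1 / \<alpha>)) * mass_one \<omega> = ennreal (s powr (1 / \<alpha>) * \<tau>)"
          by (simp add: \<tau> ennreal_mult')
        have "ennreal (s powr (1 / \<alpha>) * \<tau>) < ennreal T \<longleftrightarrow> s powr (1 / \<alpha>) * \<tau> < T"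
          using \<tau> T by (simp add: ennreal_less_iff)
        moreover have "ennreal T < ennreal (s powr (1 / \<alpha>) * \<tau>) + ennreal u \<longleftrightarrow> T < s powr (1 / \<alpha>) * \<tau> + u"
          using \<tau> T True by (simp add: ennreal_less_iff flip: ennreal_plus)
        moreover have "enn2real (ennreal (s powr (1 / \<alpha>) * \<tau>)) = s powr (1 / \<alpha>) * \<tau>"
          using \<tau> by simp
        ultimately have "G ((s, u), ennreal (s powr (1 / \<alpha>)) * mass_one \<omega>, scaled_jumps (s powr (1 / \<alpha>) / T) \<omega>) = ?g s u"
          unfolding m by (simp add: G_def f_def)
        moreover have "jump_density u = ?c * ennreal (u powr (- \<alpha> - 1))"
          using constant_nonneg by (rule ennreal_mult')
        ultimately show ?thesis by (simp only: mult_ac)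
      qed simp
      have "?lhs \<omega> =
        ?c * (\<integral>\<^sup>+s. (\<integral>\<^sup>+u. ?g s u * ennreal (u powr (- \<alpha> - 1)) * indicator {0<..} u \<partial>lborel) * indicator {0<..} s \<partial>lborel)"
        unfolding Gg by (simp add: nn_integral_cmult mult.assoc)
      also have "\<dots> = ?c * (\<integral>\<^sup>+y. ennreal (y powr (- \<alpha>) / (y + \<tau>)) *
          (\<integral>\<^sup>+w. f (y / (y + \<tau>), 1 / (y + \<tau>), y / (y + \<tau>) * (w powr (- 1 / \<alpha>) - 1)) * indicator {0<..<1} w \<partial>lborel) *
          indicator {0<..} y \<partial>lborel)"
        using nn_integral_crossing_substitution[OF \<alpha>(1) T \<tau>(2) f] by simp
      also have "\<dots> = ?rhs \<omega>"
        using \<tau> by (simp add: f_def biased_value_def)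
      finally show "?lhs \<omega> =
        ?rhs \<omega>" .
    qed
  qed
  finally show ?thesis .
qed

text \<open>The same integral arises from the choice of a jump \<open>i\<close> up to time \<open>1\<close> with probability proportional to
  its size. The terms are written as functionals of the jump and of the other jumps, whose total
  size is \<open>rest i\<close>; the case that it is infinite is excluded by convention.\<close>

theorem size_biased_integral:
  assumes F [measurable]: "F \<in> borel_measurable triple_space"
    and mass: "AE \<omega> in M. mass_one \<omega> < \<infinity>"
  defines "rest \<equiv> \<lambda>i \<omega>. \<Sum>j. if t j \<omega> \<le> 1 \<and> j \<noteq> i then ennreal (p j \<omega>) else 0"
  shows "(\<integral>\<^sup>+\<omega>. (\<Sum>i. if t i \<omega> \<le> 1 \<and> rest i \<omega> < \<infinity> then
      ennreal (p i \<omega> / (p i \<omega> + enn2real (rest i \<omega>))) * biased_value F (p i \<omega>) (enn2real (rest i \<omega>))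
        (points borel {j. t j \<omega> \<le> 1 \<and> j \<noteq> i} (\<lambda>j. 1 / (p i \<omega> + enn2real (rest i \<omega>)) * p j \<omega>)) else 0) \<partial>M) = common_integral F"
    (is "(\<integral>\<^sup>+\<omega>. (\<Sum>i. ?term \<omega> i) \<partial>M) = _")
proof -
  let ?MA = "measure_algebra (borel :: real measure)"
  define c :: "(real \<times> real) \<times> ennreal \<Rightarrow> real" where "c = (\<lambda>z. 1 / (snd (fst z) + enn2real (snd z)))"
  define G :: "(real \<times> real) \<times> ennreal \<times> real measure \<Rightarrow> ennreal" where
    "G = (\<lambda>z. if fst (fst z) \<le> 1 \<and> fst (snd z) < \<infinity> then
      ennreal (snd (fst z) / (snd (fst z) + enn2real (fst (snd z)))) *
        biased_value F (snd (fst z)) (enn2real (fst (snd z))) (snd (snd z)) else 0)"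
  note [measurable] = X_pair_measurable
  have c: "c \<in> borel_measurable (\<nu> \<Otimes>\<^sub>M borel)" unfolding c_def by measurable
  have bvG [measurable]: "(\<lambda>z. biased_value F (snd (fst z)) (enn2real (fst (snd z))) (snd (snd z))) \<in> borel_measurable (\<nu> \<Otimes>\<^sub>M borel \<Otimes>\<^sub>M ?MA)"
    unfolding biased_value_def by measurable
  have G: "G \<in> borel_measurable (\<nu> \<Otimes>\<^sub>M borel \<Otimes>\<^sub>M ?MA)"
    unfolding G_def by measurable
  have "(\<integral>\<^sup>+\<omega>. (\<Sum>i. ?term \<omega> i) \<partial>M) =
      (\<integral>\<^sup>+\<omega>. (\<Sum>i. let x = (t i \<omega>, p i \<omega>); J = {j. t j \<omega> \<le> 1} - {i} in
        G (x, mass_in J \<omega>, points borel J (\<lambda>j. c (x, mass_in J \<omega>) * p j \<omega>))) \<partial>M)"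
  proof (intro nn_integral_cong arg_cong[where f=suminf] ext)
    fix \<omega> i
    have J: "{j. t j \<omega> \<le> 1} - {i} = {j. t j \<omega> \<le> 1 \<and> j \<noteq> i}" by auto
    have rest: "mass_in {j. t j \<omega> \<le> 1 \<and> j \<noteq> i} \<omega> = rest i \<omega>" by (simp add: mass_in_def rest_def)
    show "?term \<omega> i = (let x = (t i \<omega>, p i \<omega>); J = {j. t j \<omega> \<le> 1} - {i} in
        G (x, mass_in J \<omega>, points borel J (\<lambda>j. c (x, mass_in J \<omega>) * p j \<omega>)))"
      unfolding Let_def J rest by (simp add: G_def c_def)
  qed
  also have "\<dots> = (\<integral>\<^sup>+x. (\<integral>\<^sup>+\<omega>. (let J = {j. t j \<omega> \<le> 1} in
      G (x, mass_in J \<omega>, points borel J (\<lambda>j. c (x, mass_in J \<omega>) * p j \<omega>))) \<partial>M) \<partial>\<nu>)"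
    by (rule mecke_sections[where a="\<lambda>s s'. s' \<le> 1", OF _ c G]) simp
  also have "\<dots> = (\<integral>\<^sup>+x. (\<integral>\<^sup>+\<omega>. G (x, mass_one \<omega>, scaled_jumps (c (x, mass_one \<omega>)) \<omega>) \<partial>M) \<partial>\<nu>)"
    by (simp add: mass_in_def mass_one_def)
  also have "\<dots> = (\<integral>\<^sup>+\<omega>. (\<integral>\<^sup>+s. (\<integral>\<^sup>+u. G ((s, u), mass_one \<omega>,
      scaled_jumps (c ((s, u), mass_one \<omega>)) \<omega>) *
      jump_density u * indicator {0<..} u \<partial>lborel) * indicator {0<..} s \<partial>lborel) \<partial>M)"
  proof -
    have [measurable]: "(\<lambda>z. c (fst z, mass_one (snd z))) \<in> borel_measurable (\<nu> \<Otimes>\<^sub>M M)"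
      by (rule measurable_compose[OF _ c]) measurable
    have pt [measurable]: "(\<lambda>z. points borel {j. t j (snd z) \<le> 1} (\<lambda>j. c (fst z, mass_one (snd z)) * p j (snd z))) \<in> \<nu> \<Otimes>\<^sub>M M \<rightarrow>\<^sub>M ?MA"
      by (rule measurable_points) measurable
    have "(\<lambda>z. (fst z, mass_one (snd z),
        points borel {j. t j (snd z) \<le> 1} (\<lambda>j. c (fst z, mass_one (snd z)) * p j (snd z)))) \<in> \<nu> \<Otimes>\<^sub>M M \<rightarrow>\<^sub>M \<nu> \<Otimes>\<^sub>M borel \<Otimes>\<^sub>M ?MA"
      by measurable
    from nn_integral_nu_M_swap[OF measurable_compose[OF this G]] show ?thesis by simp
  qed
  also have "\<dots> = common_integral F"
    unfolding common_integral_def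
  proof (rule nn_integral_cong_AE)
    show "AE \<omega> in M. (\<integral>\<^sup>+s. (\<integral>\<^sup>+u. G ((s, u), mass_one \<omega>,
        scaled_jumps (c ((s, u), mass_one \<omega>)) \<omega>) *
        jump_density u * indicator {0<..} u \<partial>lborel) * indicator {0<..} s \<partial>lborel) =
      ennreal (\<alpha> / Gamma (1 - \<alpha>)) * (\<integral>\<^sup>+y. ennreal (y powr (- \<alpha>) / (y + \<tau>\<^sub>1 \<omega>)) *
        biased_value F y (\<tau>\<^sub>1 \<omega>) (scaled_jumps (1 / (y + \<tau>\<^sub>1 \<omega>)) \<omega>) *
        indicator {0<..} y \<partial>lborel)" (is "AE \<omega> in M. ?lhs \<omega> = ?rhs \<omega>")
      using mass
    proof (rule AE_mp, intro AE_I2 impI)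
      fix \<omega> assume \<omega>: "\<omega> \<in> space M" and "mass_one \<omega> < \<infinity>"
      then obtain \<tau> where \<tau>: "mass_one \<omega> = ennreal \<tau>" "0 \<le> \<tau>"
        by (cases "mass_one \<omega>") auto
      let ?c = "ennreal (\<alpha> / Gamma (1 - \<alpha>))"
      let ?pt = "\<lambda>y. scaled_jumps (1 / (y + \<tau>)) \<omega>"
      let ?k = "\<lambda>y. ennreal (y powr (- \<alpha>) / (y + \<tau>)) * biased_value F y \<tau> (?pt y) * indicator {0<..} y"
      have k: "?k \<in> borel_measurable borel"
      proof -
        have [measurable]: "?pt \<in> borel \<rightarrow>\<^sub>M ?MA"
          by (rule measurable_points) measurable
        show ?thesis unfolding biased_value_def by measurable
      qed
      have Gk: "G ((s, u), mass_one \<omega>, scaled_jumps (c ((s, u), mass_one \<omega>)) \<omega>) *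
          jump_density u * indicator {0<..} u =
          indicator {..1} s * (?c * ?k u)" for s u
      proof (cases "0 < u")
        case True
        have "u * u powr (- \<alpha> - 1) = u powr (- \<alpha>)"
          using True powr_mult_base[of u "- \<alpha> - 1"] by simp
        then have *: "u / (u + \<tau>) * u powr (- \<alpha> - 1) = u powr (- \<alpha>) / (u + \<tau>)" by simp
        have "ennreal (u / (u + \<tau>)) * jump_density u =
            ?c * (ennreal (u / (u + \<tau>)) * ennreal (u powr (- \<alpha> - 1)))"
          by (subst ennreal_mult'[OF constant_nonneg]) (simp only: mult_ac)
        also have "ennreal (u / (u + \<tau>)) * ennreal (u powr (- \<alpha> - 1)) = ennreal (u / (u + \<tau>) * u powr (- \<alpha> - 1))"
          using True \<tau> by (intro ennreal_mult'[symmetric]) auto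
        finally have w: "ennreal (u / (u + \<tau>)) * jump_density u =
            ?c * ennreal (u powr (- \<alpha>) / (u + \<tau>))" unfolding * .
        have "G ((s, u), mass_one \<omega>, scaled_jumps (c ((s, u), mass_one \<omega>)) \<omega>) =
            indicator {..1} s * (ennreal (u / (u + \<tau>)) * biased_value F u \<tau> (?pt u))"
          using \<tau> by (simp add: G_def c_def indicator_def)
        then have "G ((s, u), mass_one \<omega>, scaled_jumps (c ((s, u), mass_one \<omega>)) \<omega>) *
            jump_density u =
            indicator {..1} s * (ennreal (u / (u + \<tau>)) * jump_density u * biased_value F u \<tau> (?pt u))"
          by (simp only: mult_ac)
        then show ?thesis unfolding w using True by (simp add: mult.assoc)
      qed simp
      have "?lhs \<omega> =
        (\<integral>\<^sup>+s. (?c * (\<integral>\<^sup>+u. ?k u \<partial>lborel)) * indicator {0<..1::real} s \<partial>lborel)"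
        unfolding Gk
      proof (rule nn_integral_cong)
        fix s :: real
        have "(\<integral>\<^sup>+u. indicator {..1} s * (?c * ?k u) \<partial>lborel) = indicator {..1} s * (\<integral>\<^sup>+u. ?c * ?k u \<partial>lborel)"
          using k by (intro nn_integral_cmult borel_measurable_times) simp_all
        also have "(\<integral>\<^sup>+u. ?c * ?k u \<partial>lborel) = ?c * (\<integral>\<^sup>+u. ?k u \<partial>lborel)"
          using k by (intro nn_integral_cmult) simp
        finally have *: "(\<integral>\<^sup>+u. indicator {..1} s * (?c * ?k u) \<partial>lborel) = indicator {..1} s * (?c * (\<integral>\<^sup>+u. ?k u \<partial>lborel))" .
        show "(\<integral>\<^sup>+u. indicator {..1} s * (?c * ?k u) \<partial>lborel) * indicator {0<..} s =
          ?c * (\<integral>\<^sup>+u. ?k u \<partial>lborel) * indicator {0<..1} s"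
          unfolding * by (cases "0 < s"; cases "s \<le> 1") simp_all
      qed
      also have "\<dots> = ?c * (\<integral>\<^sup>+u. ?k u \<partial>lborel)"
        by (subst nn_integral_cmult_indicator) auto
      finally show "?lhs \<omega> =
        ?rhs \<omega>"
        using \<tau> by simp
    qed
  qed
  finally show ?thesis .
qed

end

section \<open>Sums with total expectation one\<close>

lemma (in prob_space) AE_eq_1_of_nn_integral:
  fixes f :: "'a \<Rightarrow> ennreal"
  assumes [measurable]: "f \<in> borel_measurable M" and le: "AE \<omega> in M. f \<omega> \<le> 1" and int: "(\<integral>\<^sup>+\<omega>. f \<omega> \<partial>M) = 1"
  shows "AE \<omega> in M. f \<omega> = 1"
proof -
  have "AE \<omega> in M. 1 - f \<omega> = 0"
  proof (subst nn_integral_0_iff_AE[symmetric])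
    have "(\<integral>\<^sup>+\<omega>. 1 - f \<omega> \<partial>M) = (\<integral>\<^sup>+\<omega>. 1 \<partial>M) - (\<integral>\<^sup>+\<omega>. f \<omega> \<partial>M)"
      using le int by (intro nn_integral_diff) auto
    then show "(\<integral>\<^sup>+\<omega>. 1 - f \<omega> \<partial>M) = 0" by (simp add: int emeasure_space_1)
  qed measurable
  with le show ?thesis by eventually_elim (auto simp: diff_eq_0_iff_ennreal intro: antisym)
qed

text \<open>If the expected number of indices with property \<open>c\<close> is \<open>1\<close> and almost surely at most one
  index has it, then almost surely exactly one index has it. The number is given as the sum of
  \<open>g \<omega> i\<close>; \<open>h\<close> is the value of \<open>f\<close> at the index in question.\<close>

lemma (in prob_space) nn_integral_unique_index:
  fixes f g :: "'a \<Rightarrow> nat \<Rightarrow> ennreal" and h :: "'a \<Rightarrow> ennreal"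
  assumes [measurable]: "\<And>i. (\<lambda>\<omega>. g \<omega> i) \<in> borel_measurable M"
    and total: "(\<integral>\<^sup>+\<omega>. (\<Sum>i. g \<omega> i) \<partial>M) = 1"
    and c: "AE \<omega> in M. \<forall>i. c \<omega> i \<longrightarrow> g \<omega> i = 1 \<and> f \<omega> i = h \<omega> \<and> (\<forall>k. c \<omega> k \<longrightarrow> k = i)"
    and no: "\<And>\<omega> i. \<not> c \<omega> i \<Longrightarrow> g \<omega> i = 0" "\<And>\<omega> i. \<not> c \<omega> i \<Longrightarrow> f \<omega> i = 0"
  shows "(\<integral>\<^sup>+\<omega>. h \<omega> \<partial>M) = (\<integral>\<^sup>+\<omega>. (\<Sum>i. f \<omega> i) \<partial>M)"
proof -
  have single: "(\<Sum>i. a i) = a k" if "\<And>i. i \<noteq> k \<Longrightarrow> a i = 0" for a :: "nat \<Rightarrow> ennreal" and k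
    using suminf_finite[of "{k}" a] that by simp
  have "AE \<omega> in M. (\<Sum>i. g \<omega> i) \<le> 1"
    using c
  proof eventually_elim
    case (elim \<omega>)
    show ?case
    proof (cases "\<exists>k. c \<omega> k")
      case True
      then obtain k where k: "c \<omega> k" by auto
      then have "(\<Sum>i. g \<omega> i) = g \<omega> k" using elim no by (intro single) blast
      then show ?thesis using k elim by simp
    qed (use no in simp)
  qed
  then have "AE \<omega> in M. (\<Sum>i. g \<omega> i) = 1" by (intro AE_eq_1_of_nn_integral total) auto
  with c have "AE \<omega> in M. h \<omega> = (\<Sum>i. f \<omega> i)"
  proof eventually_elim
    case (elim \<omega>)
    have "\<exists>k. c \<omega> k"
    proof (rule ccontr)
      assume "\<nexists>k. c \<omega> k"
      then have "(\<Sum>i. g \<omega> i) = 0" using no by simp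
      then show False using elim by simp
    qed
    then obtain k where k: "c \<omega> k" by auto
    then have "(\<Sum>i. f \<omega> i) = f \<omega> k" using elim no by (intro single) blast
    then show ?case using k elim by simp
  qed
  then show ?thesis by (rule nn_integral_cong_AE)
qed

section \<open>Size-biased orderings\<close>

text \<open>Conditionally on the history, the choice in step \<open>n\<close> has the prescribed probabilities; in
  integrated form.\<close>

lemma (in prob_space) size_biased_choice:
  assumes V [measurable]: "\<And>i. V i \<in> borel_measurable M"
    and \<sigma> [measurable]: "\<And>n. \<sigma> n \<in> M \<rightarrow>\<^sub>M count_space UNIV"
    and ce: "AE \<omega> in M. real_cond_exp M (choice_history M V \<sigma> n) (indicator {\<omega> \<in> space M. \<sigma> n \<omega> = i}) \<omega> = q \<omega>"
    and q: "q \<in> borel_measurable (choice_history M V \<sigma> n)"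
    and f: "f \<in> borel_measurable (choice_history M V \<sigma> n)"
  shows "(\<integral>\<^sup>+\<omega>. f \<omega> * indicator {\<omega> \<in> space M. \<sigma> n \<omega> = i} \<omega> \<partial>M) = (\<integral>\<^sup>+\<omega>. f \<omega> * ennreal (q \<omega>) \<partial>M)"
    and "AE \<omega> in M. 0 \<le> q \<omega>"
proof -
  let ?H = "choice_history M V \<sigma> n"
  let ?I = "{\<omega> \<in> space M. \<sigma> n \<omega> = i}"
  have I [measurable]: "?I \<in> sets M" by measurable
  have sub: "subalgebra M ?H"
    unfolding subalgebra_def
  proof
    show "space ?H = space M" by (simp add: choice_history_def)
    have "(\<lambda>\<omega>. (\<lambda>i. V i \<omega>, \<lambda>k\<in>{..<n}. \<sigma> k \<omega>)) \<in> M \<rightarrow>\<^sub>M (\<Pi>\<^sub>M i\<in>UNIV. borel) \<Otimes>\<^sub>M (\<Pi>\<^sub>M k\<in>{..<n}. count_space UNIV)"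
      by (intro measurable_Pair measurable_restrict measurable_PiM_single') auto
    note m = this
    then have "(\<lambda>\<omega>. (\<lambda>i. V i \<omega>, \<lambda>k\<in>{..<n}. \<sigma> k \<omega>)) \<in> space M \<rightarrow> space ((\<Pi>\<^sub>M i\<in>UNIV. borel) \<Otimes>\<^sub>M (\<Pi>\<^sub>M k\<in>{..<n}. count_space UNIV))"
      using measurable_space[OF m] by auto
    from sets_vimage_algebra2[OF this] show "sets ?H \<subseteq> sets M"
      unfolding choice_history_def using measurable_sets[OF m] by auto
  qed
  interpret H: finite_measure_subalgebra M ?H
    using sub by unfold_locales
  have fM [measurable]: "f \<in> borel_measurable M" by (rule measurable_from_subalg[OF sub f])
  have qM [measurable]: "q \<in> borel_measurable M" by (rule measurable_from_subalg[OF sub q])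
  have int: "integrable M (indicator ?I :: 'a \<Rightarrow> real)" by (rule integrable_real_indicator) (auto simp: emeasure_eq_measure)
  have "AE \<omega> in M. 0 \<le> real_cond_exp M ?H (indicator ?I) \<omega>"
    by (rule H.real_cond_exp_pos) auto
  with ce show q0: "AE \<omega> in M. 0 \<le> q \<omega>" by eventually_elim simp
  have intq: "integrable M q"
    using H.real_cond_exp_int(1)[OF int] ce by (subst (asm) integrable_cong_AE) auto
  have eq: "restr_to_subalg (density M (indicator ?I)) ?H = restr_to_subalg (density M (\<lambda>\<omega>. ennreal (q \<omega>))) ?H"
  proof (rule measure_eqI)
    have s1: "subalgebra (density M (indicator ?I)) ?H" "subalgebra (density M (\<lambda>\<omega>. ennreal (q \<omega>))) ?H"
      using sub by (auto simp: subalgebra_def)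
    show "sets (restr_to_subalg (density M (indicator ?I)) ?H) = sets (restr_to_subalg (density M (\<lambda>\<omega>. ennreal (q \<omega>))) ?H)"
      using s1 by (simp add: sets_restr_to_subalg)
    fix A assume "A \<in> sets (restr_to_subalg (density M (indicator ?I)) ?H)"
    then have A: "A \<in> sets ?H" using s1 by (simp add: sets_restr_to_subalg)
    then have AM [measurable]: "A \<in> sets M" using sub by (auto simp: subalgebra_def)
    have "(\<integral>\<omega>\<in>A. indicator ?I \<omega> \<partial>M) = (\<integral>\<omega>\<in>A. real_cond_exp M ?H (indicator ?I) \<omega> \<partial>M)"
      by (rule H.real_cond_exp_intA[OF int A])
    also have "\<dots> = (\<integral>\<omega>\<in>A. q \<omega> \<partial>M)"
      unfolding set_lebesgue_integral_def using ce by (intro integral_cong_AE) auto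
    finally have eqA: "(\<integral>\<omega>\<in>A. indicator ?I \<omega> \<partial>M) = (\<integral>\<omega>\<in>A. q \<omega> \<partial>M)" .
    have "emeasure (density M (indicator ?I)) A = (\<integral>\<^sup>+\<omega>. ennreal (indicator A \<omega> * indicator ?I \<omega>) \<partial>M)"
      by (subst emeasure_density) (auto intro!: nn_integral_cong simp: indicator_def)
    also have "\<dots> = ennreal (\<integral>\<omega>\<in>A. indicator ?I \<omega> \<partial>M)"
      unfolding set_lebesgue_integral_def using integrable_mult_indicator[OF AM int]
      by (subst nn_integral_eq_integral) (auto simp: real_scaleR_def)
    also have "\<dots> = (\<integral>\<^sup>+\<omega>. ennreal (indicator A \<omega> * q \<omega>) \<partial>M)"
      unfolding eqA unfolding set_lebesgue_integral_def using integrable_mult_indicator[OF AM intq] q0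
      by (subst nn_integral_eq_integral) (auto simp: real_scaleR_def)
    also have "\<dots> = emeasure (density M (\<lambda>\<omega>. ennreal (q \<omega>))) A"
      by (subst emeasure_density) (auto intro!: nn_integral_cong simp: indicator_def)
    finally show "emeasure (restr_to_subalg (density M (indicator ?I)) ?H) A =
        emeasure (restr_to_subalg (density M (\<lambda>\<omega>. ennreal (q \<omega>))) ?H) A"
      using s1 A by (simp add: emeasure_restr_to_subalg)
  qed
  have s1: "subalgebra (density M (indicator ?I)) ?H" "subalgebra (density M (\<lambda>\<omega>. ennreal (q \<omega>))) ?H"
    using sub by (auto simp: subalgebra_def)
  have "(\<integral>\<^sup>+\<omega>. f \<omega> * indicator ?I \<omega> \<partial>M) = (\<integral>\<^sup>+\<omega>. f \<omega> \<partial>density M (indicator ?I))"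
    by (subst nn_integral_density) (auto simp: mult.commute)
  also have "\<dots> = (\<integral>\<^sup>+\<omega>. f \<omega> \<partial>density M (\<lambda>\<omega>. ennreal (q \<omega>)))"
    using nn_integral_subalgebra2[OF s1(1) f] nn_integral_subalgebra2[OF s1(2) f] by (simp add: eq)
  also have "\<dots> = (\<integral>\<^sup>+\<omega>. f \<omega> * ennreal (q \<omega>) \<partial>M)"
    by (subst nn_integral_density) (auto simp: mult.commute)
  finally show "(\<integral>\<^sup>+\<omega>. f \<omega> * indicator ?I \<omega> \<partial>M) = (\<integral>\<^sup>+\<omega>. f \<omega> * ennreal (q \<omega>) \<partial>M)" .
qed

text \<open>If the masses sum up to at most \<open>1\<close>, then the existence of a size-biased ordering forces
  the sum to be \<open>1\<close>, and the ordering exhausts the positive masses: as long as a mass of at least \<open>\<epsilon>\<close> has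
  not been chosen, the conditional probability that it is chosen next is at least \<open>\<epsilon>\<close>. The last
  property says that the first choice is \<open>i\<close> with conditional probability \<open>V i\<close>.\<close>

theorem (in prob_space) size_biased_ordering_exhausts:
  assumes sbo: "size_biased_ordering M V W"
    and V_nonneg: "\<And>i \<omega>. \<omega> \<in> space M \<Longrightarrow> 0 \<le> V i \<omega>"
    and V_sum: "\<And>\<omega>. \<omega> \<in> space M \<Longrightarrow> (\<Sum>i. ennreal (V i \<omega>)) \<le> 1"
  obtains \<sigma> :: "nat \<Rightarrow> 'a \<Rightarrow> nat" where
    "\<And>n. \<sigma> n \<in> M \<rightarrow>\<^sub>M count_space UNIV"
    "\<And>n \<omega>. \<omega> \<in> space M \<Longrightarrow> W n \<omega> = V (\<sigma> n \<omega>) \<omega>"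
    "AE \<omega> in M. bij_betw (\<lambda>n. \<sigma> n \<omega>) UNIV {i. 0 < V i \<omega>}"
    "AE \<omega> in M. (\<Sum>i. ennreal (V i \<omega>)) = 1"
    "\<And>i f. f \<in> borel_measurable (\<Pi>\<^sub>M i\<in>UNIV. borel) \<Longrightarrow>
      (\<integral>\<^sup>+\<omega>. f (\<lambda>i. V i \<omega>) * indicator {\<omega> \<in> space M. \<sigma> 0 \<omega> = i} \<omega> \<partial>M) = (\<integral>\<^sup>+\<omega>. f (\<lambda>i. V i \<omega>) * ennreal (V i \<omega>) \<partial>M)"
proof -
  from sbo obtain \<sigma> where V [measurable]: "\<And>i. V i \<in> borel_measurable M"
    and \<sigma> [measurable]: "\<And>n. \<sigma> n \<in> M \<rightarrow>\<^sub>M count_space UNIV"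
    and ce: "\<And>n i. AE \<omega> in M.
        real_cond_exp M (choice_history M V \<sigma> n) (indicator {\<omega> \<in> space M. \<sigma> n \<omega> = i}) \<omega> =
          (if \<exists>k<n. \<sigma> k \<omega> = i then 0 else V i \<omega> / (1 - (\<Sum>k<n. V (\<sigma> k \<omega>) \<omega>)))"
    and W: "\<And>n \<omega>. \<omega> \<in> space M \<Longrightarrow> W n \<omega> = V (\<sigma> n \<omega>) \<omega>"
    unfolding size_biased_ordering_def by blast
  define q where "q n i \<omega> = (if \<exists>k<n. \<sigma> k \<omega> = i then 0 else V i \<omega> / (1 - (\<Sum>k<n. V (\<sigma> k \<omega>) \<omega>)))" for n i \<omega>
  let ?H = "choice_history M V \<sigma>"
  have hist: "(\<lambda>\<omega>. (\<lambda>i. V i \<omega>, \<lambda>k\<in>{..<n}. \<sigma> k \<omega>)) \<in> ?H n \<rightarrow>\<^sub>M (\<Pi>\<^sub>M i\<in>UNIV. borel) \<Otimes>\<^sub>M (\<Pi>\<^sub>M k\<in>{..<n}. count_space UNIV)" for n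
    unfolding choice_history_def
    by (rule measurable_vimage_algebra1) (auto simp: space_pair_measure space_PiM)
  have V_seq: "(\<lambda>\<omega> i. V i \<omega>) \<in> ?H n \<rightarrow>\<^sub>M (\<Pi>\<^sub>M i\<in>UNIV. borel)" for n
    using measurable_compose[OF hist measurable_fst] by simp
  have V_hist [measurable]: "V i \<in> borel_measurable (?H n)" for i n
    using measurable_compose[OF V_seq measurable_component_singleton[of i UNIV]] by simp
  have \<sigma>_hist: "\<sigma> k \<in> ?H n \<rightarrow>\<^sub>M count_space UNIV" if "k < n" for k n
    using measurable_compose[OF measurable_compose[OF hist measurable_snd] measurable_component_singleton[of k "{..<n}"]] that
    by simp
  have used: "Measurable.pred (?H n) (\<lambda>\<omega>. \<exists>k<n. \<sigma> k \<omega> = i)" for n i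
  proof -
    have "{\<omega> \<in> space (?H n). \<exists>k\<in>{..<n}. \<sigma> k \<omega> = i} \<in> sets (?H n)"
    proof (rule sets.sets_Collect_finite_Ex)
      fix k assume "k \<in> {..<n}"
      then have [measurable]: "\<sigma> k \<in> ?H n \<rightarrow>\<^sub>M count_space UNIV" using \<sigma>_hist by simp
      show "{\<omega> \<in> space (?H n). \<sigma> k \<omega> = i} \<in> sets (?H n)" by measurable
    qed simp
    moreover have "{\<omega> \<in> space (?H n). \<exists>k\<in>{..<n}. \<sigma> k \<omega> = i} = {\<omega> \<in> space (?H n). \<exists>k<n. \<sigma> k \<omega> = i}"
      by auto
    ultimately show ?thesis unfolding pred_def by (rule back_subst[of "\<lambda>A. A \<in> sets (?H n)"])
  qed
  have V\<sigma>: "(\<lambda>\<omega>. \<Sum>k<n. V (\<sigma> k \<omega>) \<omega>) \<in> borel_measurable (?H n)" for n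
  proof (rule borel_measurable_sum)
    fix k assume "k \<in> {..<n}"
    then have "\<sigma> k \<in> ?H n \<rightarrow>\<^sub>M count_space UNIV" using \<sigma>_hist by simp
    then show "(\<lambda>\<omega>. V (\<sigma> k \<omega>) \<omega>) \<in> borel_measurable (?H n)"
      by (rule measurable_compose_countable[OF V_hist])
  qed
  have q_hist: "q n i \<in> borel_measurable (?H n)" for n i
    unfolding q_def
    by (intro measurable_If used[unfolded pred_def] borel_measurable_divide borel_measurable_diff
        V_hist V\<sigma> borel_measurable_const measurable_const) simp
  have choice: "(\<integral>\<^sup>+\<omega>. f \<omega> * indicator {\<omega> \<in> space M. \<sigma> n \<omega> = i} \<omega> \<partial>M) = (\<integral>\<^sup>+\<omega>. f \<omega> * ennreal (q n i \<omega>) \<partial>M)"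
    if "f \<in> borel_measurable (?H n)" for f n i
    by (rule size_biased_choice(1)[OF V \<sigma> _ q_hist that]) (use ce[of n i] in \<open>simp add: q_def\<close>)
  have no_choice: "AE \<omega> in M. \<sigma> n \<omega> = i \<longrightarrow> \<not> P \<omega>"
    if P: "Measurable.pred (?H n) P" "Measurable.pred M P"
      and z: "\<And>\<omega>. \<omega> \<in> space M \<Longrightarrow> P \<omega> \<Longrightarrow> q n i \<omega> = 0" for n i P
  proof -
    note [measurable] = P
    have "(\<integral>\<^sup>+\<omega>. (if P \<omega> then 1 else 0) * indicator {\<omega> \<in> space M. \<sigma> n \<omega> = i} \<omega> \<partial>M) =
        (\<integral>\<^sup>+\<omega>. (if P \<omega> then 1 else 0) * ennreal (q n i \<omega>) \<partial>M)"
      by (rule choice) measurable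
    also have "\<dots> = (\<integral>\<^sup>+\<omega>. 0 \<partial>M)" using z by (intro nn_integral_cong) auto
    finally have "(\<integral>\<^sup>+\<omega>. (if P \<omega> then 1 else 0) * indicator {\<omega> \<in> space M. \<sigma> n \<omega> = i} \<omega> \<partial>M) = 0" by simp
    then have "AE \<omega> in M. (if P \<omega> then 1 else 0) * indicator {\<omega> \<in> space M. \<sigma> n \<omega> = i} \<omega> = (0::ennreal)"
      by (subst (asm) nn_integral_0_iff_AE) measurable
    then show ?thesis by (rule AE_mp) (auto intro!: AE_I2 split: if_splits)
  qed
  have used_M [measurable]: "Measurable.pred M (\<lambda>\<omega>. \<exists>k<n. \<sigma> k \<omega> = i)" for n i by measurable
  have distinct: "AE \<omega> in M. \<forall>n i. \<sigma> n \<omega> = i \<longrightarrow> \<not> (\<exists>k<n. \<sigma> k \<omega> = i)"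
    unfolding AE_all_countable by (intro allI no_choice used used_M) (simp add: q_def)
  have positive: "AE \<omega> in M. \<forall>n i. \<sigma> n \<omega> = i \<longrightarrow> \<not> V i \<omega> = 0"
    unfolding AE_all_countable by (intro allI no_choice) (measurable, auto simp: q_def)
  have sum_used: "(\<Sum>k<n. ennreal (V (\<sigma> k \<omega>) \<omega>)) + (\<Sum>i. if \<exists>k<n. \<sigma> k \<omega> = i then 0 else ennreal (V i \<omega>)) = (\<Sum>i. ennreal (V i \<omega>))"
    if d: "\<forall>n i. \<sigma> n \<omega> = i \<longrightarrow> \<not> (\<exists>k<n. \<sigma> k \<omega> = i)" for n \<omega>
  proof -
    have inj: "inj_on (\<lambda>k. \<sigma> k \<omega>) {..<n}"
      using d by (intro inj_onI) (metis linorder_neqE_nat)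
    have "(\<Sum>k<n. ennreal (V (\<sigma> k \<omega>) \<omega>)) = (\<Sum>i\<in>(\<lambda>k. \<sigma> k \<omega>) ` {..<n}. ennreal (V i \<omega>))"
      by (simp add: sum.reindex[OF inj])
    also have "\<dots> = (\<Sum>i\<in>(\<lambda>k. \<sigma> k \<omega>) ` {..<n}. if \<exists>k<n. \<sigma> k \<omega> = i then ennreal (V i \<omega>) else 0)"
      by (intro sum.cong) auto
    also have "\<dots> = (\<Sum>i. if \<exists>k<n. \<sigma> k \<omega> = i then ennreal (V i \<omega>) else 0)"
      by (rule suminf_finite[symmetric]) auto
    finally have "(\<Sum>k<n. ennreal (V (\<sigma> k \<omega>) \<omega>)) = (\<Sum>i. if \<exists>k<n. \<sigma> k \<omega> = i then ennreal (V i \<omega>) else 0)" .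
    then have "(\<Sum>k<n. ennreal (V (\<sigma> k \<omega>) \<omega>)) + (\<Sum>i. if \<exists>k<n. \<sigma> k \<omega> = i then 0 else ennreal (V i \<omega>)) =
        (\<Sum>i. (if \<exists>k<n. \<sigma> k \<omega> = i then ennreal (V i \<omega>) else 0) + (if \<exists>k<n. \<sigma> k \<omega> = i then 0 else ennreal (V i \<omega>)))"
      by (simp add: suminf_add summableI)
    also have "\<dots> = (\<Sum>i. ennreal (V i \<omega>))"
      by (intro arg_cong[where f=suminf] ext) auto
    finally show ?thesis .
  qed
  have used_le: "(\<Sum>k<n. V (\<sigma> k \<omega>) \<omega>) \<le> 1"
    if d: "\<forall>n i. \<sigma> n \<omega> = i \<longrightarrow> \<not> (\<exists>k<n. \<sigma> k \<omega> = i)" and \<omega>: "\<omega> \<in> space M" for n \<omega>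
  proof -
    have "ennreal (\<Sum>k<n. V (\<sigma> k \<omega>) \<omega>) = (\<Sum>k<n. ennreal (V (\<sigma> k \<omega>) \<omega>))"
      using V_nonneg[OF \<omega>] by (simp add: sum_ennreal)
    also have "\<dots> \<le> (\<Sum>k<n. ennreal (V (\<sigma> k \<omega>) \<omega>)) + (\<Sum>i. if \<exists>k<n. \<sigma> k \<omega> = i then 0 else ennreal (V i \<omega>))"
      by simp
    also have "\<dots> \<le> 1" unfolding sum_used[OF d] by (rule V_sum[OF \<omega>])
    finally show ?thesis by simp
  qed
  have q_total: "(\<integral>\<^sup>+\<omega>. (\<Sum>i. ennreal (q n i \<omega>)) \<partial>M) = 1" for n
  proof -
    have [measurable]: "(\<lambda>\<omega>. q n i \<omega>) \<in> borel_measurable M" for i unfolding q_def by measurable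
    have "(\<integral>\<^sup>+\<omega>. (\<Sum>i. ennreal (q n i \<omega>)) \<partial>M) = (\<Sum>i. \<integral>\<^sup>+\<omega>. ennreal (q n i \<omega>) \<partial>M)"
      by (rule nn_integral_suminf) measurable
    also have "\<dots> = (\<Sum>i. \<integral>\<^sup>+\<omega>. indicator {\<omega> \<in> space M. \<sigma> n \<omega> = i} \<omega> \<partial>M)"
      using choice[of "\<lambda>_. 1" n] by simp
    also have "\<dots> = (\<integral>\<^sup>+\<omega>. (\<Sum>i. indicator {\<omega> \<in> space M. \<sigma> n \<omega> = i} \<omega>) \<partial>M)"
      by (rule nn_integral_suminf[symmetric]) measurable
    also have "\<dots> = (\<integral>\<^sup>+\<omega>. 1 \<partial>M)"
    proof (rule nn_integral_cong)
      fix \<omega> assume "\<omega> \<in> space M"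
      then have "(\<Sum>i. indicator {\<omega> \<in> space M. \<sigma> n \<omega> = i} \<omega>) = (\<Sum>i\<in>{\<sigma> n \<omega>}. indicator {\<omega> \<in> space M. \<sigma> n \<omega> = i} \<omega> :: ennreal)"
        by (intro suminf_finite) auto
      then show "(\<Sum>i. indicator {\<omega> \<in> space M. \<sigma> n \<omega> = i} \<omega>) = (1::ennreal)"
        using \<open>\<omega> \<in> space M\<close> by simp
    qed
    finally show ?thesis by (simp add: emeasure_space_1)
  qed
  \<comment> \<open>Where the first \<open>n\<close> choices use up the total mass, the next choice would have probabilities \<open>0\<close>,
    because division by zero yields zero. Since they have total expectation \<open>1\<close> and never exceed \<open>1\<close>
    in total, this happens with probability \<open>0\<close>.\<close>
  have left: "AE \<omega> in M. \<forall>n. (\<Sum>k<n. V (\<sigma> k \<omega>) \<omega>) < 1"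
    unfolding AE_all_countable
  proof
    fix n
    have [measurable]: "(\<lambda>\<omega>. q n i \<omega>) \<in> borel_measurable M" for i unfolding q_def by measurable
    define P where "P \<omega> \<longleftrightarrow> (\<Sum>k<n. V (\<sigma> k \<omega>) \<omega>) < 1" for \<omega>
    have [measurable]: "Measurable.pred M P" unfolding P_def by measurable
    have "1 = (\<integral>\<^sup>+\<omega>. (\<Sum>i. ennreal (q n i \<omega>)) \<partial>M)" using q_total[of n] by simp
    also have "\<dots> \<le> (\<integral>\<^sup>+\<omega>. indicator {\<omega> \<in> space M. P \<omega>} \<omega> \<partial>M)"
    proof (rule nn_integral_mono_AE)
      show "AE \<omega> in M. (\<Sum>i. ennreal (q n i \<omega>)) \<le> indicator {\<omega> \<in> space M. P \<omega>} \<omega>"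
        using distinct
      proof (rule AE_mp, intro AE_I2 impI)
        fix \<omega> assume \<omega>: "\<omega> \<in> space M" and d: "\<forall>n i. \<sigma> n \<omega> = i \<longrightarrow> \<not> (\<exists>k<n. \<sigma> k \<omega> = i)"
        let ?s = "\<Sum>k<n. V (\<sigma> k \<omega>) \<omega>"
        show "(\<Sum>i. ennreal (q n i \<omega>)) \<le> indicator {\<omega> \<in> space M. P \<omega>} \<omega>"
        proof (cases "?s < 1")
          case False
          then have "?s = 1" using used_le[OF d \<omega>, of n] by simp
          then have "q n i \<omega> = 0" for i by (simp add: q_def)
          then show ?thesis by simp
        next
          case True
          have "(\<Sum>i. ennreal (q n i \<omega>)) = (\<Sum>i. ennreal (1 / (1 - ?s)) * (if \<exists>k<n. \<sigma> k \<omega> = i then 0 else ennreal (V i \<omega>)))"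
            using True V_nonneg[OF \<omega>] by (intro arg_cong[where f=suminf] ext) (auto simp: q_def ennreal_mult'[symmetric])
          also have "\<dots> = ennreal (1 / (1 - ?s)) * (\<Sum>i. if \<exists>k<n. \<sigma> k \<omega> = i then 0 else ennreal (V i \<omega>))"
            by simp
          also have "\<dots> \<le> ennreal (1 / (1 - ?s)) * ennreal (1 - ?s)"
          proof (rule mult_left_mono)
            have s0: "0 \<le> ?s" using V_nonneg[OF \<omega>] by (simp add: sum_nonneg)
            have "ennreal ?s + (\<Sum>i. if \<exists>k<n. \<sigma> k \<omega> = i then 0 else ennreal (V i \<omega>)) \<le> ennreal 1"
              using sum_used[OF d, of n] V_sum[OF \<omega>] V_nonneg[OF \<omega>] by (simp add: sum_ennreal)
            then have "(\<Sum>i. if \<exists>k<n. \<sigma> k \<omega> = i then 0 else ennreal (V i \<omega>)) \<le> ennreal 1 - ennreal ?s"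
              unfolding ennreal_le_minus_iff by (simp add: add.commute)
            then show "(\<Sum>i. if \<exists>k<n. \<sigma> k \<omega> = i then 0 else ennreal (V i \<omega>)) \<le> ennreal (1 - ?s)"
              unfolding ennreal_minus[OF s0] .
          qed simp
          also have "\<dots> = 1" using True by (simp add: ennreal_mult'[symmetric])
          finally show ?thesis using True \<omega> by (simp add: P_def)
        qed
      qed
    qed
    also have "\<dots> = emeasure M {\<omega> \<in> space M. P \<omega>}" by simp
    finally have "prob {\<omega> \<in> space M. P \<omega>} = 1"
      using prob_le_1[of "{\<omega> \<in> space M. P \<omega>}"] by (simp add: emeasure_eq_measure)
    then have "AE \<omega> in M. \<omega> \<in> {\<omega> \<in> space M. P \<omega>}" by (subst (asm) prob_eq_1) auto
    then show "AE \<omega> in M. (\<Sum>k<n. V (\<sigma> k \<omega>) \<omega>) < 1"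
      by (rule AE_mp) (auto simp: P_def)
  qed
  have exhaust: "AE \<omega> in M. \<forall>i m. 1 / (real m + 1) \<le> V i \<omega> \<longrightarrow> (\<exists>n. \<sigma> n \<omega> = i)"
    unfolding AE_all_countable
  proof (intro allI)
    fix i m :: nat
    define \<epsilon> where "\<epsilon> = 1 / (real m + 1)"
    have \<epsilon>: "0 < \<epsilon>" "\<epsilon> \<le> 1" by (auto simp: \<epsilon>_def)
    \<comment> \<open>The event that \<open>i\<close> has a mass of at least \<open>\<epsilon>\<close> and is not among the first \<open>n\<close> choices\<close>
    define A where "A n = {\<omega> \<in> space M. \<epsilon> \<le> V i \<omega> \<and> \<not> (\<exists>k<n. \<sigma> k \<omega> = i)}" for n
    have A [measurable]: "A n \<in> sets M" for n unfolding A_def by measurable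
    have AH: "A n \<in> sets (?H n)" for n
    proof -
      have "{\<omega> \<in> space (?H n). \<epsilon> \<le> V i \<omega> \<and> \<not> (\<exists>k<n. \<sigma> k \<omega> = i)} \<in> sets (?H n)"
      proof (intro sets.sets_Collect_conj sets.sets_Collect_neg used[unfolded pred_def])
        show "{\<omega> \<in> space (?H n). \<epsilon> \<le> V i \<omega>} \<in> sets (?H n)" using V_hist by measurable
      qed
      then show ?thesis by (simp add: A_def choice_history_def)
    qed
    have step: "prob (A (Suc n)) \<le> (1 - \<epsilon>) * prob (A n)" for n
    proof -
      have "ennreal (\<epsilon> * prob (A n)) = (\<integral>\<^sup>+\<omega>. indicator (A n) \<omega> * ennreal \<epsilon> \<partial>M)"
        using \<epsilon> by (subst nn_integral_multc) (auto simp: emeasure_eq_measure ennreal_mult' mult.commute)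
      also have "\<dots> \<le> (\<integral>\<^sup>+\<omega>. indicator (A n) \<omega> * ennreal (q n i \<omega>) \<partial>M)"
      proof (rule nn_integral_mono_AE)
        show "AE \<omega> in M. indicator (A n) \<omega> * ennreal \<epsilon> \<le> indicator (A n) \<omega> * ennreal (q n i \<omega>)"
          using left
        proof (rule AE_mp, intro AE_I2 impI)
          fix \<omega> assume \<omega>: "\<omega> \<in> space M" and l: "\<forall>n. (\<Sum>k<n. V (\<sigma> k \<omega>) \<omega>) < 1"
          have "\<epsilon> \<le> q n i \<omega>" if "\<omega> \<in> A n"
          proof -
            let ?s = "\<Sum>k<n. V (\<sigma> k \<omega>) \<omega>"
            have s: "0 \<le> ?s" "?s < 1" using V_nonneg[OF \<omega>] l by (auto simp: sum_nonneg)
            have "\<epsilon> \<le> V i \<omega>" "q n i \<omega> = V i \<omega> / (1 - ?s)" using that by (auto simp: A_def q_def)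
            moreover have "V i \<omega> \<le> V i \<omega> / (1 - ?s)"
              using s V_nonneg[OF \<omega>, of i] by (simp add: pos_le_divide_eq mult_left_le)
            ultimately show ?thesis by simp
          qed
          then show "indicator (A n) \<omega> * ennreal \<epsilon> \<le> indicator (A n) \<omega> * ennreal (q n i \<omega>)"
            by (auto simp: indicator_def ennreal_leI)
        qed
      qed
      also have "\<dots> = (\<integral>\<^sup>+\<omega>. indicator (A n) \<omega> * indicator {\<omega> \<in> space M. \<sigma> n \<omega> = i} \<omega> \<partial>M)"
        using AH by (intro choice[symmetric]) simp
      also have "\<dots> = (\<integral>\<^sup>+\<omega>. indicator (A n - A (Suc n)) \<omega> \<partial>M)"
        by (intro nn_integral_cong) (auto simp: A_def indicator_def less_Suc_eq)
      also have "\<dots> = ennreal (prob (A n - A (Suc n)))"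
        by (simp add: emeasure_eq_measure)
      also have "prob (A n - A (Suc n)) = prob (A n) - prob (A (Suc n))"
        by (rule finite_measure_Diff) (auto simp: A_def less_Suc_eq)
      finally have "\<epsilon> * prob (A n) \<le> prob (A n) - prob (A (Suc n))"
      proof (subst (asm) ennreal_le_iff)
        have "prob (A (Suc n)) \<le> prob (A n)"
          by (rule finite_measure_mono) (auto simp: A_def less_Suc_eq)
        then show "0 \<le> prob (A n) - prob (A (Suc n))" by simp
      qed
      then show ?thesis by (simp add: algebra_simps)
    qed
    have bound: "prob (A n) \<le> (1 - \<epsilon>) ^ n" for n
    proof (induction n)
      case (Suc n)
      have "prob (A (Suc n)) \<le> (1 - \<epsilon>) * prob (A n)" by (rule step)
      also have "\<dots> \<le> (1 - \<epsilon>) * (1 - \<epsilon>) ^ n" using Suc \<epsilon> by (intro mult_left_mono) auto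
      finally show ?case by simp
    qed simp
    have "prob (\<Inter>n. A n) \<le> 0"
    proof (rule LIMSEQ_le_const)
      show "(\<lambda>n. (1 - \<epsilon>) ^ n) \<longlonglongrightarrow> 0" using \<epsilon> by (intro LIMSEQ_power_zero) auto
      have "prob (\<Inter>n. A n) \<le> (1 - \<epsilon>) ^ n" for n
        by (rule order_trans[OF finite_measure_mono bound]) auto
      then show "\<exists>N. \<forall>n\<ge>N. prob (\<Inter>n. A n) \<le> (1 - \<epsilon>) ^ n" by auto
    qed
    then have "prob (\<Inter>n. A n) = 0" by (simp add: measure_le_0_iff)
    then have "AE \<omega> in M. \<omega> \<notin> (\<Inter>n. A n)"
      by (intro AE_not_in) (auto simp: null_sets_def emeasure_eq_measure)
    then show "AE \<omega> in M. 1 / (real m + 1) \<le> V i \<omega> \<longrightarrow> (\<exists>n. \<sigma> n \<omega> = i)"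
      by (rule AE_mp) (auto simp: A_def \<epsilon>_def intro!: AE_I2)
  qed
  have bij: "AE \<omega> in M. bij_betw (\<lambda>n. \<sigma> n \<omega>) UNIV {i. 0 < V i \<omega>}"
    using distinct positive exhaust AE_space
  proof eventually_elim
    fix \<omega>
    assume d: "\<forall>n i. \<sigma> n \<omega> = i \<longrightarrow> \<not> (\<exists>k<n. \<sigma> k \<omega> = i)"
      and pos: "\<forall>n i. \<sigma> n \<omega> = i \<longrightarrow> \<not> V i \<omega> = 0"
      and ex: "\<forall>i m. 1 / (real m + 1) \<le> V i \<omega> \<longrightarrow> (\<exists>n. \<sigma> n \<omega> = i)" and \<omega>: "\<omega> \<in> space M"
    have "inj (\<lambda>n. \<sigma> n \<omega>)" using d by (intro injI) (metis linorder_neqE_nat)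
    moreover have "range (\<lambda>n. \<sigma> n \<omega>) \<subseteq> {i. 0 < V i \<omega>}"
      using pos V_nonneg[OF \<omega>] by (auto simp: order_less_le)
    moreover have "i \<in> range (\<lambda>n. \<sigma> n \<omega>)" if V_pos: "0 < V i \<omega>" for i
    proof -
      obtain m where "inverse (real (Suc m)) < V i \<omega>" using reals_Archimedean[OF V_pos] by auto
      then have "1 / (real m + 1) \<le> V i \<omega>" by (simp add: inverse_eq_divide add.commute)
      then show ?thesis using ex by auto
    qed
    ultimately show "bij_betw (\<lambda>n. \<sigma> n \<omega>) UNIV {i. 0 < V i \<omega>}" by (auto simp: bij_betw_def)
  qed
  have q0: "q 0 i = V i" for i by (auto simp: q_def)
  have sum_1: "AE \<omega> in M. (\<Sum>i. ennreal (V i \<omega>)) = 1"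
    using q_total[of 0] V_sum by (intro AE_eq_1_of_nn_integral) (auto simp: q0 intro!: AE_I2)
  show ?thesis
  proof (rule that[OF \<sigma> W bij sum_1])
    fix i and f :: "(nat \<Rightarrow> real) \<Rightarrow> ennreal" assume "f \<in> borel_measurable (\<Pi>\<^sub>M i\<in>UNIV. borel)"
    from measurable_compose[OF V_seq this] have "(\<lambda>\<omega>. f (\<lambda>i. V i \<omega>)) \<in> borel_measurable (?H 0)" .
    from choice[OF this] show "(\<integral>\<^sup>+\<omega>. f (\<lambda>i. V i \<omega>) * indicator {\<omega> \<in> space M. \<sigma> 0 \<omega> = i} \<omega> \<partial>M) = (\<integral>\<^sup>+\<omega>. f (\<lambda>i. V i \<omega>) * ennreal (V i \<omega>) \<partial>M)"
      by (simp add: q0)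
  qed
qed

section \<open>Paths of the subordinator\<close>

lemma subordinator_eq_suminf: "subordinator t p s = (\<Sum>j. if t j \<le> s then ennreal (p j) else 0)"
  unfolding subordinator_def infsum_ennreal_nat by simp

lemma subordinator_left_eq_suminf: "subordinator_left t p s = (\<Sum>j. if t j < s then ennreal (p j) else 0)"
  unfolding subordinator_left_def infsum_ennreal_nat by simp

lemma crossing_jump:
  fixes t p :: "nat \<Rightarrow> real"
  assumes inj: "inj t" and t: "0 \<le> t i" and p: "0 \<le> p i"
    and T: "0 \<le> T" "mass_before t p i < ennreal T" "ennreal T < mass_before t p i + ennreal (p i)"
  shows "inverse_subordinator t p T = t i"
    and "undershoot t p T = T - enn2real (mass_before t p i)"
    and "overshoot t p T = enn2real (mass_before t p i) + p i - T"
proof -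
  have left: "subordinator_left t p (t i) = mass_before t p i"
    by (simp add: subordinator_left_eq_suminf mass_before_def)
  have at: "subordinator t p (t i) = mass_before t p i + ennreal (p i)"
  proof -
    have "subordinator t p (t i) = (if t i \<le> t i then ennreal (p i) else 0) +
        (\<Sum>j. if j = i then 0 else if t j \<le> t i then ennreal (p j) else 0)"
      unfolding subordinator_eq_suminf by (rule suminf_ennreal_split_at)
    also have "(\<Sum>j. if j = i then 0 else if t j \<le> t i then ennreal (p j) else 0) = mass_before t p i"
      unfolding mass_before_def using inj
      by (intro arg_cong[where f=suminf] ext) (auto simp: less_le dest: injD)
    finally show ?thesis by (simp add: add.commute)
  qed
  have before: "\<not> ennreal T < subordinator t p r" if "r < t i" for r
  proof -
    have "subordinator t p r \<le> mass_before t p i"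
      unfolding subordinator_eq_suminf mass_before_def using that
      by (intro suminf_le summableI) auto
    then show ?thesis using T(2) by auto
  qed
  show L: "inverse_subordinator t p T = t i"
    unfolding inverse_subordinator_def
  proof (rule cInf_eq_minimum)
    show "t i \<in> {r. 0 \<le> r \<and> ennreal T < subordinator t p r}" using t T(3) at by simp
    show "t i \<le> r" if "r \<in> {r. 0 \<le> r \<and> ennreal T < subordinator t p r}" for r
      using that before[of r] by force
  qed
  have m: "mass_before t p i < top" using T(2) by (rule less_trans) simp
  show "undershoot t p T = T - enn2real (mass_before t p i)"
    unfolding undershoot_def L left ..
  show "overshoot t p T = enn2real (mass_before t p i) + p i - T"
    unfolding overshoot_def L at using m p by (simp add: enn2real_plus)
qed

lemma measurable_inverse_subordinator:
  assumes [measurable]: "\<And>j. t j \<in> borel_measurable N" "\<And>j. p j \<in> borel_measurable N" "l \<in> borel_measurable N"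
  shows "(\<lambda>\<omega>. inverse_subordinator (\<lambda>j. t j \<omega>) (\<lambda>j. p j \<omega>) (l \<omega>)) \<in> borel_measurable N"
proof -
  define A where "A \<omega> = {r. 0 \<le> r \<and> ennreal (l \<omega>) < subordinator (\<lambda>j. t j \<omega>) (\<lambda>j. p j \<omega>) r}" for \<omega>
  have up: "r' \<in> A \<omega>" if "r \<in> A \<omega>" "r \<le> r'" for r r' \<omega>
  proof -
    have "subordinator (\<lambda>j. t j \<omega>) (\<lambda>j. p j \<omega>) r \<le> subordinator (\<lambda>j. t j \<omega>) (\<lambda>j. p j \<omega>) r'"
      unfolding subordinator_eq_suminf using that(2) by (intro suminf_le summableI) auto
    then show ?thesis using that by (auto simp: A_def intro: less_le_trans)
  qed
  have [measurable]: "Measurable.pred N (\<lambda>\<omega>. r \<in> A \<omega>)" for r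
    unfolding A_def subordinator_eq_suminf by simp
  have bdd: "bdd_below (A \<omega>)" for \<omega> by (rule bdd_belowI[of _ 0]) (auto simp: A_def)
  \<comment> \<open>\<open>A \<omega>\<close> is an up-set, so its rational elements determine its infimum; it is empty iff it contains no
    natural number, and then its infimum is the unspecified value \<open>Inf {}\<close>.\<close>
  have iff: "Inf (A \<omega>) < a \<longleftrightarrow> (\<exists>q\<in>\<rat>. q \<in> A \<omega> \<and> q < a) \<or> (\<forall>n::nat. real n \<notin> A \<omega>) \<and> Inf {} < a" for \<omega> a
  proof (cases "A \<omega> = {}")
    case False
    have "\<exists>n::nat. real n \<in> A \<omega>"
    proof -
      from False obtain r where "r \<in> A \<omega>" by auto
      moreover obtain n :: nat where "r \<le> real n" using real_arch_simple by blast
      ultimately show ?thesis using up by blast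
    qed
    moreover have "(\<exists>x\<in>A \<omega>. x < a) \<longleftrightarrow> (\<exists>q\<in>\<rat>. q \<in> A \<omega> \<and> q < a)"
    proof
      assume "\<exists>x\<in>A \<omega>. x < a"
      then obtain x where x: "x \<in> A \<omega>" "x < a" by auto
      obtain q where "q \<in> \<rat>" "x < q" "q < a" using Rats_dense_in_real[OF x(2)] by auto
      then show "\<exists>q\<in>\<rat>. q \<in> A \<omega> \<and> q < a" using up[OF x(1), of q] by auto
    qed auto
    ultimately show ?thesis using cInf_less_iff[OF False bdd] by blast
  qed auto
  have "{\<omega> \<in> space N. Inf (A \<omega>) < a} \<in> sets N" for a
  proof -
    have "{\<omega> \<in> space N. Inf (A \<omega>) < a} = (\<Union>q\<in>\<rat>. {\<omega> \<in> space N. q \<in> A \<omega> \<and> q < a}) \<union>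
        {\<omega> \<in> space N. (\<forall>n::nat. real n \<notin> A \<omega>) \<and> Inf {} < a}"
      unfolding iff by auto
    also have "\<dots> \<in> sets N"
      by (intro sets.Un sets.countable_UN'' countable_rat) measurable
    finally show ?thesis .
  qed
  then have "(\<lambda>\<omega>. Inf (A \<omega>)) \<in> borel_measurable N"
    unfolding borel_measurable_iff_less by blast
  then show ?thesis unfolding inverse_subordinator_def A_def .
qed

lemma measurable_undershoot:
  assumes [measurable]: "\<And>j. t j \<in> borel_measurable N" "\<And>j. p j \<in> borel_measurable N" "l \<in> borel_measurable N"
  shows "(\<lambda>\<omega>. undershoot (\<lambda>j. t j \<omega>) (\<lambda>j. p j \<omega>) (l \<omega>)) \<in> borel_measurable N"
proof -
  note [measurable] = measurable_inverse_subordinator[OF assms]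
  show ?thesis unfolding undershoot_def subordinator_left_eq_suminf by measurable
qed

lemma measurable_overshoot:
  assumes [measurable]: "\<And>j. t j \<in> borel_measurable N" "\<And>j. p j \<in> borel_measurable N" "l \<in> borel_measurable N"
  shows "(\<lambda>\<omega>. overshoot (\<lambda>j. t j \<omega>) (\<lambda>j. p j \<omega>) (l \<omega>)) \<in> borel_measurable N"
proof -
  note [measurable] = measurable_inverse_subordinator[OF assms]
  show ?thesis unfolding overshoot_def subordinator_eq_suminf by measurable
qed

section \<open>Size-biased picking of the jumps\<close>

lemma (in prob_space) indep_rvs_nn_integral:
  assumes ind: "indep_rvs M S X S' Y" and g: "g \<in> borel_measurable (S \<Otimes>\<^sub>M S')"
  shows "(\<integral>\<^sup>+\<omega>. g (X \<omega>, Y \<omega>) \<partial>M) = (\<integral>\<^sup>+\<omega>. (\<integral>\<^sup>+\<omega>'. g (X \<omega>, Y \<omega>') \<partial>M) \<partial>M)"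
proof -
  have X [measurable]: "X \<in> M \<rightarrow>\<^sub>M S" and Y [measurable]: "Y \<in> M \<rightarrow>\<^sub>M S'"
    and ind_set: "indep_set (sets (vimage_algebra (space M) X S)) (sets (vimage_algebra (space M) Y S'))"
    using ind by (auto simp: indep_rvs_def)
  interpret DX: prob_space "distr M S X" by (rule prob_space_distr) simp
  interpret DY: prob_space "distr M S' Y" by (rule prob_space_distr) simp
  have law: "distr M S X \<Otimes>\<^sub>M distr M S' Y = distr M (S \<Otimes>\<^sub>M S') (\<lambda>\<omega>. (X \<omega>, Y \<omega>))"
  proof (rule pair_measure_eqI)
    fix A B assume "A \<in> sets (distr M S X)" "B \<in> sets (distr M S' Y)"
    then have A [measurable]: "A \<in> sets S" and B [measurable]: "B \<in> sets S'" by auto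
    have "prob ((X -` A \<inter> space M) \<inter> (Y -` B \<inter> space M)) = prob (X -` A \<inter> space M) * prob (Y -` B \<inter> space M)"
      by (rule indep_setD[OF ind_set]) (auto intro: in_vimage_algebra A B)
    moreover have "(X -` A \<inter> space M) \<inter> (Y -` B \<inter> space M) = (\<lambda>\<omega>. (X \<omega>, Y \<omega>)) -` (A \<times> B) \<inter> space M" by auto
    ultimately show "emeasure (distr M S X) A * emeasure (distr M S' Y) B =
        emeasure (distr M (S \<Otimes>\<^sub>M S') (\<lambda>\<omega>. (X \<omega>, Y \<omega>))) (A \<times> B)"
      by (simp add: emeasure_distr emeasure_eq_measure ennreal_mult')
  qed (auto simp: DX.sigma_finite_measure_axioms DY.sigma_finite_measure_axioms)
  have g': "g \<in> borel_measurable (distr M S X \<Otimes>\<^sub>M distr M S' Y)"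
    using g by (simp cong: measurable_cong_sets)
  have "(\<integral>\<^sup>+\<omega>. g (X \<omega>, Y \<omega>) \<partial>M) = (\<integral>\<^sup>+z. g z \<partial>(distr M S X \<Otimes>\<^sub>M distr M S' Y))"
    unfolding law using g by (subst nn_integral_distr) auto
  also have "\<dots> = (\<integral>\<^sup>+x. (\<integral>\<^sup>+y. g (x, y) \<partial>distr M S' Y) \<partial>distr M S X)"
    by (rule DY.nn_integral_fst[OF g', symmetric])
  also have "\<dots> = (\<integral>\<^sup>+\<omega>. (\<integral>\<^sup>+y. g (X \<omega>, y) \<partial>distr M S' Y) \<partial>M)"
    using DY.borel_measurable_nn_integral_fst[OF g'] by (intro nn_integral_distr) auto
  also have "\<dots> = (\<integral>\<^sup>+\<omega>. (\<integral>\<^sup>+\<omega>'. g (X \<omega>, Y \<omega>') \<partial>M) \<partial>M)"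
    using measurable_space[OF X] measurable_Pair2[OF g]
    by (intro nn_integral_cong nn_integral_distr) auto
  finally show ?thesis .
qed

lemma points_reindex:
  assumes \<sigma>: "bij_betw \<sigma> I B" and x: "x \<in> B \<rightarrow> space S"
  shows "points S I (\<lambda>i. x (\<sigma> i)) = points S B x"
proof -
  have "distr (count_space I) (count_space B) \<sigma> = count_space B"
    using \<sigma> by (rule distr_bij_count_space)
  then have "points S B x = distr (distr (count_space I) (count_space B) \<sigma>) S x"
    by (simp add: points_def)
  also have "\<dots> = distr (count_space I) S (x \<circ> \<sigma>)"
    using x \<sigma> by (intro distr_distr) (auto simp: bij_betw_def)
  finally show ?thesis by (simp add: points_def comp_def)
qed

context stable_points
begin

text \<open>The expected total size of the jumps whose time is shared with another jump is, by the Mecke equation,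
  an integral over all times \<open>s\<close> of the expected total size of the jumps at time \<open>s\<close>. It vanishes, as
  each realisation has only countably many jump times.\<close>

lemma distinct_times: "AE \<omega> in M. inj (jump_times \<omega>)"
proof -
  define G :: "(real \<times> real) \<times> ennreal \<times> real measure \<Rightarrow> ennreal" where "G z = fst (snd z)" for z
  have G: "G \<in> borel_measurable (\<nu> \<Otimes>\<^sub>M borel \<Otimes>\<^sub>M measure_algebra borel)"
    unfolding G_def by measurable
  have "(\<integral>\<^sup>+\<omega>. (\<Sum>i. \<Sum>j. if t j \<omega> = t i \<omega> \<and> j \<noteq> i then ennreal (p j \<omega>) else 0) \<partial>M) =
      (\<integral>\<^sup>+\<omega>. (\<Sum>i. let x = (t i \<omega>, p i \<omega>); J = {j. t j \<omega> = t i \<omega>} - {i} in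
        G (x, mass_in J \<omega>, points borel J (\<lambda>j. 0 * p j \<omega>))) \<partial>M)"
    by (simp add: G_def mass_in_def)
  also have "\<dots> = (\<integral>\<^sup>+x. (\<integral>\<^sup>+\<omega>. (let J = {j. t j \<omega> = fst x} in
        G (x, mass_in J \<omega>, points borel J (\<lambda>j. 0 * p j \<omega>))) \<partial>M) \<partial>\<nu>)"
    by (rule mecke_sections[where a="\<lambda>s s'. s' = s" and c="\<lambda>_. 0", OF _ _ G]) simp_all
  also have "\<dots> = (\<integral>\<^sup>+x. (\<integral>\<^sup>+\<omega>. (\<Sum>j. if t j \<omega> = fst x then ennreal (p j \<omega>) else 0) \<partial>M) \<partial>\<nu>)"
    by (simp add: G_def mass_in_def)
  also have "\<dots> = (\<integral>\<^sup>+\<omega>. (\<integral>\<^sup>+s. (\<integral>\<^sup>+u. (\<Sum>j. if t j \<omega> = s then ennreal (p j \<omega>) else 0) *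
      jump_density u * indicator {0<..} u \<partial>lborel) * indicator {0<..} s \<partial>lborel) \<partial>M)"
  proof -
    note [measurable] = X_pair_measurable
    have "(\<lambda>z. \<Sum>j. if t j (snd z) = fst (fst z) then ennreal (p j (snd z)) else 0) \<in> borel_measurable (\<nu> \<Otimes>\<^sub>M M)"
      by measurable
    from nn_integral_nu_M_swap[OF this] show ?thesis by (simp only: fst_conv snd_conv)
  qed
  also have "\<dots> = (\<integral>\<^sup>+\<omega>. 0 \<partial>M)"
  proof (rule nn_integral_cong)
    fix \<omega>
    have "AE s in lborel. s \<notin> range (jump_times \<omega>)"
      by (intro AE_not_in countable_imp_null_set_lborel) auto
    then have "AE s in lborel. (\<integral>\<^sup>+u. (\<Sum>j. if t j \<omega> = s then ennreal (p j \<omega>) else 0) *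
      jump_density u * indicator {0<..} u \<partial>lborel) * indicator {0<..} s = 0"
    proof eventually_elim
      fix s assume "s \<notin> range (jump_times \<omega>)"
      then have "(\<Sum>j. if t j \<omega> = s then ennreal (p j \<omega>) else 0) = (\<Sum>j. 0)"
        by (intro arg_cong[where f=suminf] ext) auto
      then show "(\<integral>\<^sup>+u. (\<Sum>j. if t j \<omega> = s then ennreal (p j \<omega>) else 0) *
        jump_density u * indicator {0<..} u \<partial>lborel) * indicator {0<..} s = 0"
        by simp
    qed
    from nn_integral_cong_AE[OF this]
    show "(\<integral>\<^sup>+s. (\<integral>\<^sup>+u. (\<Sum>j. if t j \<omega> = s then ennreal (p j \<omega>) else 0) *
      jump_density u * indicator {0<..} u \<partial>lborel) * indicator {0<..} s \<partial>lborel) = 0"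
      by simp
  qed
  finally have "AE \<omega> in M. (\<Sum>i. \<Sum>j. if t j \<omega> = t i \<omega> \<and> j \<noteq> i then ennreal (p j \<omega>) else 0) = 0"
    by (subst nn_integral_0_iff_AE[symmetric]) simp_all
  then show ?thesis
    using AE_space
  proof eventually_elim
    fix \<omega> assume z: "(\<Sum>i. \<Sum>j. if t j \<omega> = t i \<omega> \<and> j \<noteq> i then ennreal (p j \<omega>) else 0) = 0" and \<omega>: "\<omega> \<in> space M"
    show "inj (jump_times \<omega>)"
    proof (rule injI, rule ccontr)
      fix i j assume ij: "t i \<omega> = t j \<omega>" "i \<noteq> j"
      have "(if t j \<omega> = t i \<omega> \<and> j \<noteq> i then ennreal (p j \<omega>) else 0) = 0"
        using z by (simp add: suminf_eq_zero_iff summableI)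
      then show False using ij p_pos[OF \<omega>, of j] by (simp add: ennreal_eq_0_iff)
    qed
  qed
qed

lemma jump_partition_eq:
  "jump_partition (jump_times \<omega>) (jump_sizes \<omega>) i = (if t i \<omega> \<le> 1 then p i \<omega> / \<tau>\<^sub>1 \<omega> else 0)"
  by (simp add: jump_partition_def subordinator_eq_suminf mass_one_def)

text \<open>Where the subordinator at time \<open>1\<close> is zero or infinite, the masses of the partition are all \<open>0\<close>, as
  division by zero yields zero.\<close>

lemma jump_partition_sum:
  assumes \<omega>: "\<omega> \<in> space M"
  shows "(\<Sum>i. ennreal (jump_partition (jump_times \<omega>) (jump_sizes \<omega>) i)) = (if 0 < mass_one \<omega> \<and> mass_one \<omega> < \<infinity> then 1 else 0)"
proof (cases "0 < mass_one \<omega> \<and> mass_one \<omega> < \<infinity>")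
  case True
  then obtain \<tau> where \<tau>: "mass_one \<omega> = ennreal \<tau>" "0 < \<tau>" by (cases "mass_one \<omega>") auto
  have "(\<Sum>i. ennreal (jump_partition (jump_times \<omega>) (jump_sizes \<omega>) i)) =
      (\<Sum>i. ennreal (1 / \<tau>) * (if t i \<omega> \<le> 1 then ennreal (p i \<omega>) else 0))"
    using \<tau> p_pos[OF \<omega>] by (intro arg_cong[where f=suminf] ext) (simp add: jump_partition_eq ennreal_mult'[symmetric])
  also have "\<dots> = ennreal (1 / \<tau>) * mass_one \<omega>" by (simp add: mass_one_def)
  also have "\<dots> = 1" using \<tau> by (simp add: ennreal_mult'[symmetric])
  finally show ?thesis using True by simp
next
  case False
  then have "\<tau>\<^sub>1 \<omega> = 0" by (auto simp: enn2real_eq_0_iff top.not_eq_extremum)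
  then have "(\<Sum>i. ennreal (jump_partition (jump_times \<omega>) (jump_sizes \<omega>) i)) = 0"
    by (simp add: jump_partition_eq cong: if_cong)
  then show ?thesis using False by (simp only: if_False)
qed

text \<open>The law of the size-biased triple. That a size-biased ordering exists at all entails that the
  subordinator at time \<open>1\<close> is positive and finite.\<close>

theorem size_biased_law:
  assumes sbo: "size_biased_ordering M (\<lambda>i \<omega>. jump_partition (jump_times \<omega>) (jump_sizes \<omega>) i) W"
    and U: "distr M lborel U = uniform_measure lborel {0<..<1}"
    and UW: "indep_rvs M borel U (\<Pi>\<^sub>M n\<in>UNIV. borel) (\<lambda>\<omega> n. W n \<omega>)"
    and F [measurable]: "F \<in> borel_measurable triple_space"
  shows "AE \<omega> in M. 0 < mass_one \<omega> \<and> mass_one \<omega> < \<infinity>"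
    and "(\<integral>\<^sup>+\<omega>. F (W 0 \<omega>, points borel {1..} (\<lambda>j. W j \<omega>), W 0 \<omega> * (1 / U \<omega> powr (1 / \<alpha>) - 1)) \<partial>M) = common_integral F" (is ?biased)
proof -
  let ?MA = "measure_algebra (borel :: real measure)"
  let ?seq = "\<Pi>\<^sub>M n\<in>(UNIV :: nat set). (borel :: real measure)"
  define V where "V i \<omega> = jump_partition (jump_times \<omega>) (jump_sizes \<omega>) i" for i \<omega>
  have V_nonneg: "0 \<le> V i \<omega>" if "\<omega> \<in> space M" for i \<omega>
    using p_pos[OF that, of i] by (simp add: V_def jump_partition_eq)
  have V_le: "(\<Sum>i. ennreal (V i \<omega>)) \<le> 1" if "\<omega> \<in> space M" for \<omega>
    unfolding V_def jump_partition_sum[OF that] by simp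
  have sbo': "size_biased_ordering M V W" using sbo by (simp add: V_def[abs_def])
  then have V [measurable]: "V i \<in> borel_measurable M" for i by (simp add: size_biased_ordering_def)
  obtain \<sigma> :: "nat \<Rightarrow> 'w \<Rightarrow> nat" where \<sigma> [measurable]: "\<And>n. \<sigma> n \<in> M \<rightarrow>\<^sub>M count_space UNIV"
    and W: "\<And>n \<omega>. \<omega> \<in> space M \<Longrightarrow> W n \<omega> = V (\<sigma> n \<omega>) \<omega>"
    and bij: "AE \<omega> in M. bij_betw (\<lambda>n. \<sigma> n \<omega>) UNIV {i. 0 < V i \<omega>}"
    and V_sum: "AE \<omega> in M. (\<Sum>i. ennreal (V i \<omega>)) = 1"
    and first: "\<And>i f. f \<in> borel_measurable ?seq \<Longrightarrow>
      (\<integral>\<^sup>+\<omega>. f (\<lambda>i. V i \<omega>) * indicator {\<omega> \<in> space M. \<sigma> 0 \<omega> = i} \<omega> \<partial>M) = (\<integral>\<^sup>+\<omega>. f (\<lambda>i. V i \<omega>) * ennreal (V i \<omega>) \<partial>M)"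
    using size_biased_ordering_exhausts[OF sbo' V_nonneg V_le] by blast
  show mass: "AE \<omega> in M. 0 < mass_one \<omega> \<and> mass_one \<omega> < \<infinity>"
    using V_sum AE_space
  proof eventually_elim
    fix \<omega> assume "(\<Sum>i. ennreal (V i \<omega>)) = 1" "\<omega> \<in> space M"
    then show "0 < mass_one \<omega> \<and> mass_one \<omega> < \<infinity>"
      unfolding V_def by (subst (asm) jump_partition_sum) (auto split: if_splits)
  qed
  \<comment> \<open>\<open>F\<close> of the triple after integrating over the independent uniform variable\<close>
  define R where "R a \<xi> = (\<integral>\<^sup>+w. F (a, \<xi>, a * (1 / w powr (1 / \<alpha>) - 1)) * indicator {0<..<1} w \<partial>lborel)" for a \<xi>
  have R: "(\<lambda>z. R (f z) (g z)) \<in> borel_measurable N"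
    if [measurable]: "f \<in> borel_measurable N" "g \<in> N \<rightarrow>\<^sub>M ?MA" for f g and N :: "(nat \<Rightarrow> real) measure"
    unfolding R_def by measurable
  have comp [measurable]: "(\<lambda>v. v i) \<in> borel_measurable ?seq" for i by simp
  have pts [measurable]: "(\<lambda>v. points borel {1..} (\<lambda>j. v j)) \<in> ?seq \<rightarrow>\<^sub>M ?MA"
    by (rule measurable_points) (simp_all)
  have U_meas [measurable]: "U \<in> borel_measurable M" and W_seq: "(\<lambda>\<omega> n. W n \<omega>) \<in> M \<rightarrow>\<^sub>M ?seq"
    using UW by (auto simp: indep_rvs_def)
  have W_meas [measurable]: "W n \<in> borel_measurable M" for n
    using measurable_compose[OF W_seq comp[of n]] by simp
  have W_pts [measurable]: "(\<lambda>\<omega>. points borel {1..} (\<lambda>j. W j \<omega>)) \<in> M \<rightarrow>\<^sub>M ?MA"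
    by (rule measurable_points) simp_all
  interpret MM: pair_sigma_finite M M ..
  \<comment> \<open>\<open>R\<close> of the triple if the jump with index \<open>i\<close> is chosen first: the later choices run through the
    remaining positive masses.\<close>
  let ?pick = "\<lambda>i \<omega>. R (V i \<omega>) (points borel {j. 0 < V j \<omega> \<and> j \<noteq> i} (\<lambda>j. V j \<omega>))"
  have "(\<integral>\<^sup>+\<omega>. F (W 0 \<omega>, points borel {1..} (\<lambda>j. W j \<omega>), W 0 \<omega> * (1 / U \<omega> powr (1 / \<alpha>) - 1)) \<partial>M) =
      (\<integral>\<^sup>+\<omega>. (\<integral>\<^sup>+\<omega>'. F (W 0 \<omega>', points borel {1..} (\<lambda>j. W j \<omega>'), W 0 \<omega>' * (1 / U \<omega> powr (1 / \<alpha>) - 1)) \<partial>M) \<partial>M)"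
  proof -
    have "(\<lambda>z. F (snd z 0, points borel {1..} (snd z), snd z 0 * (1 / fst z powr (1 / \<alpha>) - 1))) \<in> borel_measurable (borel \<Otimes>\<^sub>M ?seq)"
    proof -
      have [measurable]: "(\<lambda>z. snd z 0) \<in> borel_measurable (borel \<Otimes>\<^sub>M ?seq)"
        by (rule measurable_compose[OF measurable_snd comp])
      have [measurable]: "(\<lambda>z. points borel {1..} (snd z)) \<in> borel \<Otimes>\<^sub>M ?seq \<rightarrow>\<^sub>M ?MA"
        using measurable_compose[OF measurable_snd pts] by simp
      show ?thesis by measurable
    qed
    from indep_rvs_nn_integral[OF UW this] show ?thesis by simp
  qed
  also have "\<dots> = (\<integral>\<^sup>+\<omega>'. (\<integral>\<^sup>+\<omega>. F (W 0 \<omega>', points borel {1..} (\<lambda>j. W j \<omega>'), W 0 \<omega>' * (1 / U \<omega> powr (1 / \<alpha>) - 1)) \<partial>M) \<partial>M)"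
  proof (rule MM.Fubini')
    have [measurable]: "(\<lambda>z. points borel {1..} (\<lambda>j. W j (fst z))) \<in> M \<Otimes>\<^sub>M M \<rightarrow>\<^sub>M ?MA"
      by (rule measurable_points) simp_all
    have "(\<lambda>z. F (W 0 (fst z), points borel {1..} (\<lambda>j. W j (fst z)), W 0 (fst z) * (1 / U (snd z) powr (1 / \<alpha>) - 1))) \<in> borel_measurable (M \<Otimes>\<^sub>M M)"
      by measurable
    then show "(\<lambda>(\<omega>', \<omega>). F (W 0 \<omega>', points borel {1..} (\<lambda>j. W j \<omega>'), W 0 \<omega>' * (1 / U \<omega> powr (1 / \<alpha>) - 1))) \<in> borel_measurable (M \<Otimes>\<^sub>M M)"
      by (simp add: split_beta')
  qed
  also have "\<dots> = (\<integral>\<^sup>+\<omega>. R (W 0 \<omega>) (points borel {1..} (\<lambda>j. W j \<omega>)) \<partial>M)"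
  proof (rule nn_integral_cong)
    fix \<omega>' assume \<omega>': "\<omega>' \<in> space M"
    let ?f = "\<lambda>w. F (W 0 \<omega>', points borel {1..} (\<lambda>j. W j \<omega>'), W 0 \<omega>' * (1 / w powr (1 / \<alpha>) - 1))"
    have f [measurable]: "?f \<in> borel_measurable borel"
    proof (rule measurable_compose[OF _ F], intro measurable_Pair)
      show "(\<lambda>w. points borel {1..} (\<lambda>j. W j \<omega>')) \<in> borel \<rightarrow>\<^sub>M ?MA"
        by (rule measurable_const) (simp add: space_measure_algebra)
    qed measurable
    have "(\<integral>\<^sup>+\<omega>. ?f (U \<omega>) \<partial>M) = (\<integral>\<^sup>+w. ?f w \<partial>distr M lborel U)"
      using f by (intro nn_integral_distr[symmetric]) simp_all
    also have "\<dots> = (\<integral>\<^sup>+w. ?f w * indicator {0<..<1} w \<partial>lborel)"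
      unfolding U using f by (subst nn_integral_uniform_measure) (simp_all add: divide_ennreal_def)
    finally show "(\<integral>\<^sup>+\<omega>. ?f (U \<omega>) \<partial>M) = R (W 0 \<omega>') (points borel {1..} (\<lambda>j. W j \<omega>'))"
      unfolding R_def .
  qed
  also have "\<dots> = (\<integral>\<^sup>+\<omega>. (\<Sum>i. ?pick i \<omega> * indicator {\<omega> \<in> space M. \<sigma> 0 \<omega> = i} \<omega>) \<partial>M)"
  proof (rule nn_integral_cong_AE)
    show "AE \<omega> in M. R (W 0 \<omega>) (points borel {1..} (\<lambda>j. W j \<omega>)) =
      (\<Sum>i. ?pick i \<omega> * indicator {\<omega> \<in> space M. \<sigma> 0 \<omega> = i} \<omega>)"
      using bij AE_space
    proof eventually_elim
      fix \<omega> assume b: "bij_betw (\<lambda>n. \<sigma> n \<omega>) UNIV {i. 0 < V i \<omega>}" and \<omega>: "\<omega> \<in> space M"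
      have "bij_betw (\<lambda>n. \<sigma> n \<omega>) {1..} {j. 0 < V j \<omega> \<and> j \<noteq> \<sigma> 0 \<omega>}"
      proof -
        have "bij_betw (\<lambda>n. \<sigma> n \<omega>) (UNIV - {0}) ({i. 0 < V i \<omega>} - {\<sigma> 0 \<omega>})"
          using b by (intro bij_betw_DiffI) (auto simp: bij_betw_def)
        moreover have "UNIV - {0} = {1::nat..}" by auto
        moreover have "{i. 0 < V i \<omega>} - {\<sigma> 0 \<omega>} = {j. 0 < V j \<omega> \<and> j \<noteq> \<sigma> 0 \<omega>}" by auto
        ultimately show ?thesis by simp
      qed
      from points_reindex[OF this, of "\<lambda>j. V j \<omega>" borel]
      have "points borel {1..} (\<lambda>j. W j \<omega>) = points borel {j. 0 < V j \<omega> \<and> j \<noteq> \<sigma> 0 \<omega>} (\<lambda>j. V j \<omega>)"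
        using W[OF \<omega>] by simp
      moreover have "(\<Sum>i. ?pick i \<omega> * indicator {\<omega> \<in> space M. \<sigma> 0 \<omega> = i} \<omega>) =
          (\<Sum>i\<in>{\<sigma> 0 \<omega>}. ?pick i \<omega> * indicator {\<omega> \<in> space M. \<sigma> 0 \<omega> = i} \<omega>)"
        by (rule suminf_finite) auto
      ultimately show "R (W 0 \<omega>) (points borel {1..} (\<lambda>j. W j \<omega>)) =
        (\<Sum>i. ?pick i \<omega> * indicator {\<omega> \<in> space M. \<sigma> 0 \<omega> = i} \<omega>)"
        using W[OF \<omega>] \<omega> by simp
    qed
  qed
  also have "\<dots> = (\<Sum>i. \<integral>\<^sup>+\<omega>. ?pick i \<omega> * ennreal (V i \<omega>) \<partial>M)"
  proof -
    have h: "(\<lambda>v. R (v i) (points borel {j. 0 < v j \<and> j \<noteq> i} (\<lambda>j. v j))) \<in> borel_measurable ?seq" for i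
      by (intro R measurable_points) measurable
    have V_seq: "(\<lambda>\<omega> i. V i \<omega>) \<in> M \<rightarrow>\<^sub>M ?seq" by (rule measurable_PiM_single') auto
    have [measurable]: "(\<lambda>\<omega>. ?pick i \<omega>) \<in> borel_measurable M" for i
      using measurable_compose[OF V_seq h[of i]] by simp
    show ?thesis
      using first[OF h] by (subst nn_integral_suminf) auto
  qed
  also have "\<dots> = (\<integral>\<^sup>+\<omega>. (\<Sum>i. ?pick i \<omega> * ennreal (V i \<omega>)) \<partial>M)"
  proof (rule nn_integral_suminf[symmetric])
    fix i
    have h: "(\<lambda>v. R (v i) (points borel {j. 0 < v j \<and> j \<noteq> i} (\<lambda>j. v j))) \<in> borel_measurable ?seq"
      by (intro R measurable_points) measurable
    have V_seq: "(\<lambda>\<omega> i. V i \<omega>) \<in> M \<rightarrow>\<^sub>M ?seq" by (rule measurable_PiM_single') auto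
    have [measurable]: "(\<lambda>\<omega>. ?pick i \<omega>) \<in> borel_measurable M"
      using measurable_compose[OF V_seq h] by simp
    show "(\<lambda>\<omega>. ?pick i \<omega> * ennreal (V i \<omega>)) \<in> borel_measurable M"
      by measurable
  qed
  also have "\<dots> = common_integral F"
  proof -
    let ?rest = "\<lambda>i \<omega>. \<Sum>j. if t j \<omega> \<le> 1 \<and> j \<noteq> i then ennreal (p j \<omega>) else 0"
    let ?term = "\<lambda>i \<omega>. if t i \<omega> \<le> 1 \<and> ?rest i \<omega> < \<infinity> then
          ennreal (p i \<omega> / (p i \<omega> + enn2real (?rest i \<omega>))) * biased_value F (p i \<omega>) (enn2real (?rest i \<omega>))
            (points borel {j. t j \<omega> \<le> 1 \<and> j \<noteq> i} (\<lambda>j. 1 / (p i \<omega> + enn2real (?rest i \<omega>)) * p j \<omega>)) else 0"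
    have mass_fin: "AE \<omega> in M. mass_one \<omega> < \<infinity>" using mass by eventually_elim simp
    show ?thesis
      unfolding size_biased_integral[OF F mass_fin, symmetric]
    proof (rule nn_integral_cong_AE)
      show "AE \<omega> in M. (\<Sum>i. ?pick i \<omega> * ennreal (V i \<omega>)) =
        (\<Sum>i. ?term i \<omega>)"
        using mass AE_space
      proof eventually_elim
        fix \<omega> assume "0 < mass_one \<omega> \<and> mass_one \<omega> < \<infinity>" and \<omega>: "\<omega> \<in> space M"
        then obtain \<tau> where \<tau>: "mass_one \<omega> = ennreal \<tau>" "0 < \<tau>" by (cases "mass_one \<omega>") auto
        have V_eq: "V i \<omega> = (if t i \<omega> \<le> 1 then p i \<omega> / \<tau> else 0)" for i
          using \<tau> by (simp add: V_def jump_partition_eq)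
        show "(\<Sum>i. ?pick i \<omega> * ennreal (V i \<omega>)) =
          (\<Sum>i. ?term i \<omega>)"
        proof (intro arg_cong[where f=suminf] ext)
          fix i
          show "?pick i \<omega> * ennreal (V i \<omega>) =
            ?term i \<omega>"
          proof (cases "t i \<omega> \<le> 1")
            case True
            have "mass_one \<omega> = (if t i \<omega> \<le> 1 then ennreal (p i \<omega>) else 0) +
                (\<Sum>j. if j = i then 0 else if t j \<omega> \<le> 1 then ennreal (p j \<omega>) else 0)"
              unfolding mass_one_def by (rule suminf_ennreal_split_at)
            also have "(\<Sum>j. if j = i then 0 else if t j \<omega> \<le> 1 then ennreal (p j \<omega>) else 0) = ?rest i \<omega>"
              by (intro arg_cong[where f=suminf] ext) auto
            finally have sum: "ennreal \<tau> = ennreal (p i \<omega>) + ?rest i \<omega>" using True \<tau> by simp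
            then have fin: "?rest i \<omega> < \<infinity>"
              by (metis ennreal_add_eq_top ennreal_neq_top infinity_ennreal_def top.not_eq_extremum)
            obtain \<rho> where \<rho>: "?rest i \<omega> = ennreal \<rho>" "0 \<le> \<rho>" using fin by (cases "?rest i \<omega>") auto
            have \<tau>_ennreal: "ennreal \<tau> = ennreal (p i \<omega> + \<rho>)"
              using sum \<rho> p_pos[OF \<omega>, of i] by simp
            have "0 \<le> \<tau>" "0 \<le> p i \<omega> + \<rho>" using \<tau>(2) \<rho>(2) p_pos[OF \<omega>, of i] by auto
            from ennreal_inj[OF this] \<tau>_ennreal have \<tau>_eq: "p i \<omega> + \<rho> = \<tau>" by blast
            have pts_eq: "points borel {j. 0 < V j \<omega> \<and> j \<noteq> i} (\<lambda>j. V j \<omega>) =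
                points borel {j. t j \<omega> \<le> 1 \<and> j \<noteq> i} (\<lambda>j. 1 / \<tau> * p j \<omega>)"
              using \<tau> p_pos[OF \<omega>] by (intro points_cong) (auto simp: V_eq split: if_splits)
            have w: "1 / w powr (1 / \<alpha>) = w powr (- 1 / \<alpha>)" for w :: real
              by (simp add: powr_minus_divide)
            have "?pick i \<omega> =
                biased_value F (p i \<omega>) \<rho> (points borel {j. t j \<omega> \<le> 1 \<and> j \<noteq> i} (\<lambda>j. 1 / \<tau> * p j \<omega>))"
              unfolding R_def biased_value_def pts_eq w \<tau>_eq using True by (simp add: V_eq)
            then show ?thesis
              using True fin by (simp add: \<rho> \<tau>_eq V_eq mult.commute)
          next
            case False
            then show ?thesis by (simp add: V_eq)
          qed
        qed
      qed
    qed
  qed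
  finally show ?biased .
qed

text \<open>As the common integral of \<open>1\<close> is \<open>1\<close>, a fixed level is crossed by exactly one jump almost surely; hence
  the sum over the crossing jumps is the value at the triple of that level.\<close>

theorem fixed_level_law:
  assumes mass: "AE \<omega> in M. 0 < mass_one \<omega> \<and> mass_one \<omega> < \<infinity>" and one: "common_integral (\<lambda>_. 1) = 1"
    and F: "F \<in> borel_measurable triple_space" and T: "0 < T"
  shows "(\<integral>\<^sup>+\<omega>. F (undershoot (jump_times \<omega>) (jump_sizes \<omega>) T / T,
      points borel {i. t i \<omega> < inverse_subordinator (jump_times \<omega>) (jump_sizes \<omega>) T} (\<lambda>i. p i \<omega> / T),
      overshoot (jump_times \<omega>) (jump_sizes \<omega>) T / T) \<partial>M) = common_integral F"
proof -
  let ?C = "\<lambda>F \<omega> i. crossing F (jump_times \<omega>) (jump_sizes \<omega>) T i"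
  let ?X = "\<lambda>\<omega>. (undershoot (jump_times \<omega>) (jump_sizes \<omega>) T / T,
      points borel {i. t i \<omega> < inverse_subordinator (jump_times \<omega>) (jump_sizes \<omega>) T} (\<lambda>i. p i \<omega> / T),
      overshoot (jump_times \<omega>) (jump_sizes \<omega>) T / T)"
  define crosses where "crosses \<omega> i \<longleftrightarrow> mass_before (jump_times \<omega>) (jump_sizes \<omega>) i < ennreal T \<and>
    ennreal T < mass_before (jump_times \<omega>) (jump_sizes \<omega>) i + ennreal (p i \<omega>)" for \<omega> i
  have X_eq: "?C G \<omega> i = G (?X \<omega>)" and L_eq: "inverse_subordinator (jump_times \<omega>) (jump_sizes \<omega>) T = t i \<omega>"
    if "inj (jump_times \<omega>)" "\<omega> \<in> space M" "crosses \<omega> i" for G \<omega> i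
  proof -
    have "0 \<le> t i \<omega>" "0 \<le> p i \<omega>" "0 \<le> T" using t_pos[OF that(2), of i] p_pos[OF that(2), of i] T by auto
    note cj = crossing_jump[OF that(1) this that(3)[unfolded crosses_def, THEN conjunct1] that(3)[unfolded crosses_def, THEN conjunct2]]
    show "inverse_subordinator (jump_times \<omega>) (jump_sizes \<omega>) T = t i \<omega>" by (rule cj(1))
    show "?C G \<omega> i = G (?X \<omega>)"
      unfolding cj crossing_def using that(3) by (simp add: crosses_def)
  qed
  have no: "?C G \<omega> i = 0" if "\<not> crosses \<omega> i" for G \<omega> i
    using that unfolding crossing_def crosses_def by (simp only: if_False)
  have C1 [measurable]: "(\<lambda>\<omega>. ?C (\<lambda>_. 1) \<omega> i) \<in> borel_measurable M" for i
    by (rule measurable_crossing) simp_all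
  have "(\<integral>\<^sup>+\<omega>. F (?X \<omega>) \<partial>M) = (\<integral>\<^sup>+\<omega>. (\<Sum>i. ?C F \<omega> i) \<partial>M)"
  proof (rule nn_integral_unique_index[where c=crosses and g="?C (\<lambda>_. 1)"])
    show "(\<integral>\<^sup>+\<omega>. (\<Sum>i. ?C (\<lambda>_. 1) \<omega> i) \<partial>M) = 1"
      using crossing_integral[OF _ T mass, of "\<lambda>_. 1"] one by simp
    show "AE \<omega> in M. \<forall>i. crosses \<omega> i \<longrightarrow>
        ?C (\<lambda>_. 1) \<omega> i = 1 \<and> ?C F \<omega> i = F (?X \<omega>) \<and> (\<forall>k. crosses \<omega> k \<longrightarrow> k = i)"
      using distinct_times AE_space
    proof eventually_elim
      case (elim \<omega>)
      then have "k = i" if "crosses \<omega> i" "crosses \<omega> k" for i k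
        using L_eq[OF elim] that by (metis injD)
      then show ?case using X_eq[OF elim] by blast
    qed
  qed (use no C1 in auto)
  also have "\<dots> = common_integral F" by (rule crossing_integral[OF F T mass])
  finally show ?thesis .
qed

end

section \<open>The first cut\<close>

lemma (in prob_space) nn_integral_exponential_tail:
  fixes e :: "'a \<Rightarrow> real"
  assumes e: "distributed M lborel e (exponential_density 1)" and a: "0 \<le> a"
  shows "(\<integral>\<^sup>+\<omega>. indicator {a..} (e \<omega>) \<partial>M) = ennreal (exp (- a))"
proof -
  have [measurable]: "e \<in> borel_measurable M" using distributed_measurable[OF e] by simp
  have "(\<integral>\<^sup>+\<omega>. indicator {a..} (e \<omega>) \<partial>M) = (\<integral>\<^sup>+z. ennreal (exponential_density 1 z) * indicator {a..} z \<partial>lborel)"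
    by (rule distributed_nn_integral[OF e, symmetric]) simp
  also have "\<dots> = (\<integral>\<^sup>+z. ennreal (exponential_density 1 z) * indicator {a<..} z \<partial>lborel)"
    using AE_lborel_singleton[of a]
    by (intro nn_integral_cong_AE) (auto elim!: eventually_mono simp: indicator_def)
  also have "\<dots> = (\<integral>\<^sup>+\<omega>. indicator {a<..} (e \<omega>) \<partial>M)"
    by (rule distributed_nn_integral[OF e]) simp
  also have "\<dots> = (\<integral>\<^sup>+\<omega>. indicator {\<omega> \<in> space M. a < e \<omega>} \<omega> \<partial>M)"
    by (intro nn_integral_cong) (auto simp: indicator_def)
  also have "\<dots> = emeasure M {\<omega> \<in> space M. a < e \<omega>}"
    by (rule nn_integral_indicator) measurable
  also have "\<dots> = ennreal (exp (- a))"
    using exponential_distributedD_gt[OF e a] by (simp add: emeasure_eq_measure)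
  finally show ?thesis .
qed

text \<open>The points with indices in \<open>J\<close> all survive with probability \<open>exp (- \<Sum>j\<in>J. p j)\<close>,
  independently of the mark with index \<open>i \<notin> J\<close>; \<open>J\<close> may be infinite.\<close>

lemma (in prob_space) nn_integral_uncut:
  fixes e :: "nat \<Rightarrow> 'a \<Rightarrow> real" and \<phi> :: "real \<Rightarrow> ennreal"
  assumes ind: "indep_vars (\<lambda>_. borel) e UNIV"
    and e: "\<And>i. distributed M lborel (e i) (exponential_density 1)"
    and i: "i \<notin> J" and p: "\<And>j. 0 \<le> p j"
    and \<phi> [measurable]: "\<phi> \<in> borel_measurable borel" and \<phi>_le: "\<And>z. \<phi> z \<le> 1"
  defines "m \<equiv> \<Sum>j. if j \<in> J then ennreal (p j) else 0"
  shows "(\<integral>\<^sup>+\<omega>. \<phi> (e i \<omega>) * (if \<forall>j\<in>J. p j \<le> e j \<omega> then 1 else 0) \<partial>M) =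
    (if m = \<infinity> then 0 else ennreal (exp (- enn2real m))) * (\<integral>\<^sup>+\<omega>. \<phi> (e i \<omega>) \<partial>M)"
proof -
  have em [measurable]: "e j \<in> borel_measurable M" for j using distributed_measurable[OF e[of j]] by simp
  \<comment> \<open>The claim for finitely many points is immediate from independence; then the number of points tends to
    infinity.\<close>
  define Jn where "Jn n = J \<inter> {..<n}" for n
  define s where "s n = (\<Sum>j<n. if j \<in> J then p j else 0)" for n
  define Y where "Y n \<omega> = \<phi> (e i \<omega>) * (\<Prod>j\<in>Jn n. indicator {p j..} (e j \<omega>))" for n \<omega>
  have Y_int: "(\<integral>\<^sup>+\<omega>. Y n \<omega> \<partial>M) = (\<integral>\<^sup>+\<omega>. \<phi> (e i \<omega>) \<partial>M) * ennreal (exp (- s n))" for n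
  proof -
    define f where "f j = (if j = i then \<phi> else indicator {p j..})" for j
    have f [measurable]: "f j \<in> borel_measurable borel" for j by (simp add: f_def)
    have fin: "finite (Jn n)" "i \<notin> Jn n" using i by (auto simp: Jn_def)
    have iv: "indep_vars (\<lambda>_. borel) (\<lambda>j. f j \<circ> e j) (insert i (Jn n))"
      by (rule indep_vars_compose[OF indep_vars_subset[OF ind]]) auto
    have "(\<integral>\<^sup>+\<omega>. (\<Prod>j\<in>insert i (Jn n). (f j \<circ> e j) \<omega>) \<partial>M) = (\<Prod>j\<in>insert i (Jn n). \<integral>\<^sup>+\<omega>. (f j \<circ> e j) \<omega> \<partial>M)"
      by (rule indep_vars_nn_integral[OF _ iv]) (use fin in auto)
    also have "(\<lambda>\<omega>. \<Prod>j\<in>insert i (Jn n). (f j \<circ> e j) \<omega>) = Y n"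
    proof
      fix \<omega>
      have "(\<Prod>j\<in>Jn n. (f j \<circ> e j) \<omega>) = (\<Prod>j\<in>Jn n. indicator {p j..} (e j \<omega>))"
        using fin by (intro prod.cong) (auto simp: f_def)
      then show "(\<Prod>j\<in>insert i (Jn n). (f j \<circ> e j) \<omega>) = Y n \<omega>"
        using fin by (simp add: Y_def f_def)
    qed
    also have "(\<Prod>j\<in>insert i (Jn n). \<integral>\<^sup>+\<omega>. (f j \<circ> e j) \<omega> \<partial>M) =
        (\<integral>\<^sup>+\<omega>. \<phi> (e i \<omega>) \<partial>M) * (\<Prod>j\<in>Jn n. ennreal (exp (- p j)))"
    proof -
      have "(\<Prod>j\<in>Jn n. \<integral>\<^sup>+\<omega>. (f j \<circ> e j) \<omega> \<partial>M) = (\<Prod>j\<in>Jn n. ennreal (exp (- p j)))"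
      proof (rule prod.cong[OF refl])
        fix j assume "j \<in> Jn n"
        then have "j \<noteq> i" using fin by auto
        then show "(\<integral>\<^sup>+\<omega>. (f j \<circ> e j) \<omega> \<partial>M) = ennreal (exp (- p j))"
          using nn_integral_exponential_tail[OF e p, of j j] by (simp add: f_def)
      qed
      then show ?thesis using fin by (simp add: f_def)
    qed
    also have "(\<Prod>j\<in>Jn n. ennreal (exp (- p j))) = ennreal (exp (- s n))"
    proof -
      have "s n = (\<Sum>j\<in>Jn n. p j)"
        unfolding s_def Jn_def by (subst sum.inter_restrict[symmetric]) (auto simp: Int_commute)
      then show ?thesis using fin by (simp add: prod_ennreal exp_sum flip: sum_negf)
    qed
    finally show ?thesis .
  qed
  have Y_lim: "(\<lambda>n. \<integral>\<^sup>+\<omega>. Y n \<omega> \<partial>M) \<longlonglongrightarrow> (\<integral>\<^sup>+\<omega>. \<phi> (e i \<omega>) * (if \<forall>j\<in>J. p j \<le> e j \<omega> then 1 else 0) \<partial>M)"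
  proof (rule nn_integral_dominated_convergence[where w="\<lambda>_. 1"])
    show "Y n \<in> borel_measurable M" for n unfolding Y_def by measurable
    show "(\<lambda>\<omega>. \<phi> (e i \<omega>) * (if \<forall>j\<in>J. p j \<le> e j \<omega> then 1 else 0)) \<in> borel_measurable M" by measurable
    show "(\<integral>\<^sup>+\<omega>. 1 \<partial>M) < \<infinity>" by (simp add: emeasure_space_1)
    have prod_le: "(\<Prod>j\<in>Jn n. indicator {p j..} (e j \<omega>)) \<le> (1 :: ennreal)" for n \<omega>
      by (rule prod_le_1) (auto simp: indicator_def)
    show "AE \<omega> in M. Y n \<omega> \<le> 1" for n
      unfolding Y_def using mult_mono[OF \<phi>_le prod_le] by (intro AE_I2) simp
    show "AE \<omega> in M. (\<lambda>n. Y n \<omega>) \<longlonglongrightarrow> \<phi> (e i \<omega>) * (if \<forall>j\<in>J. p j \<le> e j \<omega> then 1 else 0)"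
    proof (intro AE_I2)
      fix \<omega>
      show "(\<lambda>n. Y n \<omega>) \<longlonglongrightarrow> \<phi> (e i \<omega>) * (if \<forall>j\<in>J. p j \<le> e j \<omega> then 1 else 0)"
      proof (cases "\<forall>j\<in>J. p j \<le> e j \<omega>")
        case True
        then have "Y n \<omega> = \<phi> (e i \<omega>)" for n by (simp add: Y_def Jn_def)
        then show ?thesis using True by simp
      next
        case False
        then obtain k where k: "k \<in> J" "\<not> p k \<le> e k \<omega>" by auto
        have "Y n \<omega> = 0" if "k < n" for n
        proof -
          have "(\<Prod>j\<in>Jn n. indicator {p j..} (e j \<omega>)) = (0 :: ennreal)"
            by (rule prod_zero) (use k that in \<open>auto simp: Jn_def intro!: bexI[of _ k]\<close>)
          then show ?thesis by (simp add: Y_def)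
        qed
        then have "(\<lambda>n. Y n \<omega>) \<longlonglongrightarrow> 0"
          by (intro tendsto_eventually eventually_sequentiallyI[of "Suc k"]) auto
        then show ?thesis using False by (simp only: if_False mult_zero_right)
      qed
    qed
  qed simp
  have s_nonneg: "0 \<le> s n" for n unfolding s_def using p by (intro sum_nonneg) auto
  have s_lim: "(\<lambda>n. ennreal (s n)) \<longlonglongrightarrow> m"
  proof -
    have "ennreal (s n) = (\<Sum>j<n. if j \<in> J then ennreal (p j) else 0)" for n
    proof -
      have "ennreal (s n) = (\<Sum>j<n. ennreal (if j \<in> J then p j else 0))"
        unfolding s_def using p by (intro sum_ennreal[symmetric]) auto
      also have "\<dots> = (\<Sum>j<n. if j \<in> J then ennreal (p j) else 0)"
        by (intro sum.cong) auto
      finally show ?thesis .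
    qed
    then show ?thesis unfolding m_def by (simp add: summable_LIMSEQ summableI)
  qed
  have "(\<lambda>n. ennreal (exp (- s n))) \<longlonglongrightarrow> (if m = \<infinity> then 0 else ennreal (exp (- enn2real m)))"
  proof (cases "m = \<infinity>")
    case True
    then have "filterlim s at_top sequentially"
      using s_lim by (simp add: ennreal_tendsto_top_eq_at_top)
    then have "(\<lambda>n. exp (- s n)) \<longlonglongrightarrow> 0"
      by (intro filterlim_compose[OF exp_at_bot] filterlim_uminus_at_bot_at_top[THEN filterlim_compose])
    then have "(\<lambda>n. ennreal (exp (- s n))) \<longlonglongrightarrow> ennreal 0" by (rule tendsto_ennrealI)
    then show ?thesis using True by simp
  next
    case False
    then obtain r where r: "m = ennreal r" "0 \<le> r" by (cases m) auto
    have "s \<longlonglongrightarrow> r"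
      using s_lim r s_nonneg by (intro tendsto_ennrealD) auto
    then have "(\<lambda>n. ennreal (exp (- s n))) \<longlonglongrightarrow> ennreal (exp (- r))"
      by (intro tendsto_ennrealI tendsto_intros)
    then show ?thesis using r by simp
  qed
  then have "(\<lambda>n. (\<integral>\<^sup>+\<omega>. \<phi> (e i \<omega>) \<partial>M) * ennreal (exp (- s n))) \<longlonglongrightarrow>
      (\<integral>\<^sup>+\<omega>. \<phi> (e i \<omega>) \<partial>M) * (if m = \<infinity> then 0 else ennreal (exp (- enn2real m)))"
  proof (rule ennreal_tendsto_cmult[rotated])
    have "(\<integral>\<^sup>+\<omega>. \<phi> (e i \<omega>) \<partial>M) \<le> (\<integral>\<^sup>+\<omega>. 1 \<partial>M)" using \<phi>_le by (intro nn_integral_mono) auto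
    then show "(\<integral>\<^sup>+\<omega>. \<phi> (e i \<omega>) \<partial>M) < top" by (auto simp: emeasure_space_1 intro: le_less_trans)
  qed
  then show ?thesis
    using LIMSEQ_unique[OF Y_lim] unfolding Y_int by (simp add: mult.commute)
qed

text \<open>The functional \<open>F\<close> of the triple at the level \<open>\<Gamma>\<close>, if \<open>i\<close> is the index of the first cut
  under the marks \<open>\<epsilon>\<close>, and \<open>0\<close> otherwise. Then \<open>\<Gamma>\<close> is the mass before \<open>i\<close> plus the mark of \<open>i\<close>, and the
  point \<open>i\<close> is cut if it crosses that level. The last factor says that the earlier points are uncut.\<close>

definition first_cut_term ::
  "(real \<times> real measure \<times> real \<Rightarrow> ennreal) \<Rightarrow> (nat \<Rightarrow> real) \<Rightarrow> (nat \<Rightarrow> real) \<Rightarrow> nat \<Rightarrow> (nat \<Rightarrow> real) \<Rightarrow> ennreal" where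
  "first_cut_term F t p i \<epsilon> =
    (if 0 < \<epsilon> i \<and> mass_before t p i < \<infinity> then crossing F t p (enn2real (mass_before t p i) + \<epsilon> i) i else 0) *
    (if \<forall>j\<in>{j. t j < t i}. p j \<le> \<epsilon> j then 1 else 0)"

lemma measurable_first_cut_term:
  assumes [measurable]: "F \<in> borel_measurable triple_space"
    "\<And>j. t j \<in> borel_measurable N" "\<And>j. p j \<in> borel_measurable N" "\<And>j. \<epsilon> j \<in> borel_measurable N"
  shows "(\<lambda>\<omega>. first_cut_term F (\<lambda>j. t j \<omega>) (\<lambda>j. p j \<omega>) i (\<lambda>j. \<epsilon> j \<omega>)) \<in> borel_measurable N"
proof -
  have [measurable]: "(\<lambda>\<omega>. mass_before (\<lambda>j. t j \<omega>) (\<lambda>j. p j \<omega>) i) \<in> borel_measurable N"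
    by (rule measurable_mass_before) measurable
  have [measurable]: "(\<lambda>\<omega>. crossing F (\<lambda>j. t j \<omega>) (\<lambda>j. p j \<omega>)
      (enn2real (mass_before (\<lambda>j. t j \<omega>) (\<lambda>j. p j \<omega>) i) + \<epsilon> i \<omega>) i) \<in> borel_measurable N"
    by (rule measurable_crossing) measurable
  show ?thesis unfolding first_cut_term_def Ball_def mem_Collect_eq by measurable
qed

text \<open>The point \<open>i\<close> is cut and no earlier point is. The mark is required to be positive and the mass before \<open>i\<close>
  to be finite, to the effect that \<open>\<Gamma>\<close> lies strictly between the ends of the jump.\<close>

definition is_first_cut :: "(nat \<Rightarrow> real) \<Rightarrow> (nat \<Rightarrow> real) \<Rightarrow> nat \<Rightarrow> (nat \<Rightarrow> real) \<Rightarrow> bool" where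
  "is_first_cut t p i \<epsilon> \<longleftrightarrow> 0 < \<epsilon> i \<and> \<epsilon> i < p i \<and> mass_before t p i < \<infinity> \<and> (\<forall>j. t j < t i \<longrightarrow> p j \<le> \<epsilon> j)"

lemma first_cut_term_eq_0:
  assumes "\<not> is_first_cut t p i \<epsilon>"
  shows "first_cut_term F t p i \<epsilon> = 0"
proof (cases "0 < \<epsilon> i \<and> mass_before t p i < \<infinity> \<and> (\<forall>j. t j < t i \<longrightarrow> p j \<le> \<epsilon> j)")
  case True
  then obtain m where m: "mass_before t p i = ennreal m" "0 \<le> m" by (cases "mass_before t p i") auto
  have "p i \<le> \<epsilon> i" using True assms by (auto simp: is_first_cut_def)
  then have "mass_before t p i + ennreal (p i) \<le> ennreal (enn2real (mass_before t p i) + \<epsilon> i)"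
    using m True by (simp add: ennreal_leI)
  then have "crossing F t p (enn2real (mass_before t p i) + \<epsilon> i) i = 0"
    unfolding crossing_def by (auto simp: not_less)
  then show ?thesis by (simp add: first_cut_term_def)
next
  case False
  then show ?thesis by (auto simp: first_cut_term_def)
qed

lemma is_first_cut_path:
  assumes inj: "inj t" and t: "0 < t i" and i: "is_first_cut t p i \<epsilon>"
  shows "first_cut t p \<epsilon> = i"
    and "uncut_before_first t p \<epsilon> = {j. t j < t i}"
    and "cut_level t p \<epsilon> = enn2real (mass_before t p i) + \<epsilon> i"
    and "first_cut_term F t p i \<epsilon> =
      F (undershoot t p (cut_level t p \<epsilon>) / cut_level t p \<epsilon>,
         points borel (uncut_before_first t p \<epsilon>) (\<lambda>j. p j / cut_level t p \<epsilon>),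
         overshoot t p (cut_level t p \<epsilon>) / cut_level t p \<epsilon>)"
proof -
  have cut: "is_arg_min t (\<lambda>j. \<epsilon> j < p j) k \<longleftrightarrow> k = i" for k
  proof
    assume k: "is_arg_min t (\<lambda>j. \<epsilon> j < p j) k"
    then have "\<epsilon> k < p k" "\<not> t i < t k" using i by (auto simp: is_arg_min_def is_first_cut_def)
    moreover have "\<not> t k < t i" using i \<open>\<epsilon> k < p k\<close> by (auto simp: is_first_cut_def)
    ultimately have "t k = t i" by simp
    then show "k = i" using inj by (rule injD[rotated])
  next
    assume "k = i"
    then show "is_arg_min t (\<lambda>j. \<epsilon> j < p j) k" using i by (auto simp: is_arg_min_def is_first_cut_def)
  qed
  show fc: "first_cut t p \<epsilon> = i"
    unfolding first_cut_def cut by (rule Least_equality) auto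
  have "t j < t i" if "p j \<le> \<epsilon> j" "t j \<le> t i" for j
  proof -
    have "j \<noteq> i" using that i by (auto simp: is_first_cut_def)
    then show ?thesis using that inj by (auto simp: less_le dest: injD)
  qed
  then show ub: "uncut_before_first t p \<epsilon> = {j. t j < t i}"
    unfolding uncut_before_first_def fc using i by (auto simp: is_first_cut_def)
  show cl: "cut_level t p \<epsilon> = enn2real (mass_before t p i) + \<epsilon> i"
    unfolding cut_level_def fc ub infsum_ennreal_nat by (simp add: mass_before_def)
  obtain m where m: "mass_before t p i = ennreal m" "0 \<le> m"
    using i by (cases "mass_before t p i") (auto simp: is_first_cut_def)
  define T where "T = m + \<epsilon> i"
  have T: "cut_level t p \<epsilon> = T" using cl m by (simp add: T_def)
  have p: "0 < \<epsilon> i" "\<epsilon> i < p i" using i by (auto simp: is_first_cut_def)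
  have c: "mass_before t p i < ennreal T" "ennreal T < mass_before t p i + ennreal (p i)"
    using m p by (auto simp: T_def ennreal_less_iff simp flip: ennreal_plus)
  have T0: "0 \<le> T" using m p by (simp add: T_def)
  have "0 \<le> t i" "0 \<le> p i" using t p by auto
  note cj = crossing_jump[OF inj this T0 c]
  have "first_cut_term F t p i \<epsilon> = crossing F t p T i"
    using i m by (auto simp: first_cut_term_def is_first_cut_def T_def)
  also have "\<dots> = F (undershoot t p T / T, points borel {j. t j < t i} (\<lambda>j. p j / T), overshoot t p T / T)"
    unfolding crossing_def cj using c by simp
  finally show "first_cut_term F t p i \<epsilon> =
      F (undershoot t p (cut_level t p \<epsilon>) / cut_level t p \<epsilon>,
         points borel (uncut_before_first t p \<epsilon>) (\<lambda>j. p j / cut_level t p \<epsilon>),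
         overshoot t p (cut_level t p \<epsilon>) / cut_level t p \<epsilon>)"
    unfolding T ub .
qed

context stable_points
begin

text \<open>Given the process, the triple at \<open>\<Gamma>\<close> is distributed as the triple at an independent
  exponential level.\<close>

lemma first_cut_term_given_path:
  assumes ind: "indep_vars (\<lambda>_. borel) e UNIV"
    and e: "\<And>i. distributed M lborel (e i) (exponential_density 1)"
    and F [measurable]: "F \<in> borel_measurable triple_space" and F_le: "\<And>z. F z \<le> 1"
    and \<omega>: "\<omega> \<in> space M"
  shows "(\<integral>\<^sup>+\<omega>'. first_cut_term F (jump_times \<omega>) (jump_sizes \<omega>) i (\<lambda>j. e j \<omega>') \<partial>M) =
    (\<integral>\<^sup>+T. ennreal (exponential_density 1 T) * (crossing F (jump_times \<omega>) (jump_sizes \<omega>) T i * indicator {0<..} T) \<partial>lborel)"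
proof -
  let ?t = "\<lambda>j. t j \<omega>" and ?p = "\<lambda>j. p j \<omega>"
  let ?mb = "mass_before ?t ?p i"
  define \<phi> where "\<phi> z = (if 0 < z \<and> ?mb < \<infinity> then crossing F ?t ?p (enn2real ?mb + z) i else 0)" for z
  have c [measurable]: "(\<lambda>T. crossing F ?t ?p (l T) i) \<in> borel_measurable borel" if "l \<in> borel_measurable borel" for l
    using that by (intro measurable_crossing[where t="\<lambda>j _. t j \<omega>" and p="\<lambda>j _. p j \<omega>"]) auto
  have \<phi> [measurable]: "\<phi> \<in> borel_measurable borel" unfolding \<phi>_def by measurable
  have c_le: "crossing F ?t ?p T i \<le> 1" for T unfolding crossing_def using F_le by auto
  have \<phi>_le: "\<phi> z \<le> 1" for z unfolding \<phi>_def using c_le by auto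
  have m_eq: "(\<Sum>j. if j \<in> {j. t j \<omega> < t i \<omega>} then ennreal (p j \<omega>) else 0) = ?mb"
    by (simp add: mass_before_def)
  have "(\<integral>\<^sup>+\<omega>'. first_cut_term F ?t ?p i (\<lambda>j. e j \<omega>') \<partial>M) =
      (\<integral>\<^sup>+\<omega>'. \<phi> (e i \<omega>') * (if \<forall>j\<in>{j. t j \<omega> < t i \<omega>}. p j \<omega> \<le> e j \<omega>' then 1 else 0) \<partial>M)"
    by (simp only: first_cut_term_def \<phi>_def)
  also have "\<dots> = (if ?mb = \<infinity> then 0 else ennreal (exp (- enn2real ?mb))) * (\<integral>\<^sup>+\<omega>'. \<phi> (e i \<omega>') \<partial>M)"
    using nn_integral_uncut[OF ind e _ _ \<phi> \<phi>_le, of i "{j. t j \<omega> < t i \<omega>}" ?p] p_pos[OF \<omega>]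
    unfolding m_eq by (simp add: less_imp_le)
  also have "(\<integral>\<^sup>+\<omega>'. \<phi> (e i \<omega>') \<partial>M) = (\<integral>\<^sup>+z. ennreal (exponential_density 1 z) * \<phi> z \<partial>lborel)"
    by (rule distributed_nn_integral[OF e, symmetric]) simp
  also have "(if ?mb = \<infinity> then 0 else ennreal (exp (- enn2real ?mb))) * (\<integral>\<^sup>+z. ennreal (exponential_density 1 z) * \<phi> z \<partial>lborel) =
      (\<integral>\<^sup>+T. ennreal (exponential_density 1 T) * (crossing F ?t ?p T i * indicator {0<..} T) \<partial>lborel)"
  proof (cases "?mb = \<infinity>")
    case True
    then have "crossing F ?t ?p T i = 0" for T by (simp add: crossing_def)
    then show ?thesis using True by simp
  next
    case False
    then obtain m where m: "?mb = ennreal m" "0 \<le> m" by (cases ?mb) auto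
    have "(\<integral>\<^sup>+T. ennreal (exponential_density 1 T) * (crossing F ?t ?p T i * indicator {0<..} T) \<partial>lborel) =
        (\<integral>\<^sup>+z. ennreal (exponential_density 1 (m + z)) * (crossing F ?t ?p (m + z) i * indicator {0<..} (m + z)) \<partial>lborel)"
      by (subst nn_integral_real_affine[where c=1 and t=m]) auto
    also have "\<dots> = (\<integral>\<^sup>+z. ennreal (exp (- m)) * (ennreal (exponential_density 1 z) * \<phi> z) \<partial>lborel)"
    proof (rule nn_integral_cong)
      fix z :: real
      show "ennreal (exponential_density 1 (m + z)) * (crossing F ?t ?p (m + z) i * indicator {0<..} (m + z)) =
        ennreal (exp (- m)) * (ennreal (exponential_density 1 z) * \<phi> z)"
      proof (cases "0 < z")
        case True
        \<comment> \<open>The factor \<open>exp (- m)\<close> is the probability that all points before \<open>i\<close> survive.\<close>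
        have "exponential_density 1 (m + z) = exp (- m) * exponential_density 1 z"
          using True m by (simp add: exponential_density_def flip: exp_add)
        then have d: "ennreal (exponential_density 1 (m + z)) = ennreal (exp (- m)) * ennreal (exponential_density 1 z)"
          by (simp add: ennreal_mult')
        have "\<phi> z = crossing F ?t ?p (m + z) i * indicator {0<..} (m + z)"
          using True m by (simp add: \<phi>_def)
        then show ?thesis unfolding d by (simp only: mult.assoc)
      next
        case False
        then have "ennreal (m + z) \<le> ?mb" using m by (simp add: ennreal_leI)
        then have "crossing F ?t ?p (m + z) i = 0" by (auto simp: crossing_def not_less)
        then show ?thesis using False by (simp add: \<phi>_def)
      qed
    qed
    also have "\<dots> = ennreal (exp (- m)) * (\<integral>\<^sup>+z. ennreal (exponential_density 1 z) * \<phi> z \<partial>lborel)"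
      by (rule nn_integral_cmult) measurable
    finally show ?thesis using m by simp
  qed
  finally show ?thesis .
qed

text \<open>The level is integrated out last: the expectation over the process does not depend on it.\<close>

lemma first_cut_integral:
  assumes ind: "indep_vars (\<lambda>_. borel) e UNIV"
    and e: "\<And>i. distributed M lborel (e i) (exponential_density 1)"
    and indep: "indep_rvs M (\<Pi>\<^sub>M i\<in>UNIV. borel) (\<lambda>\<omega> i. (t i \<omega>, p i \<omega>)) (\<Pi>\<^sub>M i\<in>UNIV. borel) (\<lambda>\<omega> i. e i \<omega>)"
    and mass: "AE \<omega> in M. 0 < mass_one \<omega> \<and> mass_one \<omega> < \<infinity>"
    and F [measurable]: "F \<in> borel_measurable triple_space" and F_le: "\<And>z. F z \<le> 1"
  shows "(\<integral>\<^sup>+\<omega>. (\<Sum>i. first_cut_term F (jump_times \<omega>) (jump_sizes \<omega>) i (\<lambda>j. e j \<omega>)) \<partial>M) = common_integral F"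
proof -
  let ?P = "\<Pi>\<^sub>M i\<in>(UNIV :: nat set). (borel :: (real \<times> real) measure)"
  let ?E = "\<Pi>\<^sub>M i\<in>(UNIV :: nat set). (borel :: real measure)"
  have em [measurable]: "e j \<in> borel_measurable M" for j using distributed_measurable[OF e[of j]] by simp
  let ?C = "\<lambda>\<omega> T i. crossing F (jump_times \<omega>) (jump_sizes \<omega>) T i"
  have "(\<integral>\<^sup>+\<omega>. (\<Sum>i. first_cut_term F (jump_times \<omega>) (jump_sizes \<omega>) i (\<lambda>j. e j \<omega>)) \<partial>M) =
      (\<integral>\<^sup>+\<omega>. (\<integral>\<^sup>+\<omega>'. (\<Sum>i. first_cut_term F (jump_times \<omega>) (jump_sizes \<omega>) i (\<lambda>j. e j \<omega>')) \<partial>M) \<partial>M)"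
  proof -
    have f: "fst \<in> borel_measurable (borel :: (real \<times> real) measure)" and s: "snd \<in> borel_measurable (borel :: (real \<times> real) measure)"
      unfolding borel_prod[symmetric] by simp_all
    have x: "(\<lambda>z. fst z j) \<in> ?P \<Otimes>\<^sub>M ?E \<rightarrow>\<^sub>M borel" for j
      by (rule measurable_compose[OF measurable_fst measurable_component_singleton]) simp
    have [measurable]: "(\<lambda>z. fst (fst z j)) \<in> borel_measurable (?P \<Otimes>\<^sub>M ?E)" "(\<lambda>z. snd (fst z j)) \<in> borel_measurable (?P \<Otimes>\<^sub>M ?E)" for j
      by (rule measurable_compose[OF x f], rule measurable_compose[OF x s])
    have [measurable]: "(\<lambda>z. snd z j) \<in> borel_measurable (?P \<Otimes>\<^sub>M ?E)" for j
      by (rule measurable_compose[OF measurable_snd measurable_component_singleton]) simp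
    have [measurable]: "(\<lambda>z. first_cut_term F (\<lambda>j. fst (fst z j)) (\<lambda>j. snd (fst z j)) i (\<lambda>j. snd z j)) \<in> borel_measurable (?P \<Otimes>\<^sub>M ?E)" for i
      by (rule measurable_first_cut_term) measurable
    have "(\<lambda>z. \<Sum>i. first_cut_term F (\<lambda>j. fst (fst z j)) (\<lambda>j. snd (fst z j)) i (\<lambda>j. snd z j)) \<in> borel_measurable (?P \<Otimes>\<^sub>M ?E)"
      by measurable
    from indep_rvs_nn_integral[OF indep this] show ?thesis by simp
  qed
  also have "\<dots> = (\<integral>\<^sup>+\<omega>. (\<integral>\<^sup>+T. ennreal (exponential_density 1 T) * ((\<Sum>i. ?C \<omega> T i) * indicator {0<..} T) \<partial>lborel) \<partial>M)"
  proof (rule nn_integral_cong)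
    fix \<omega> assume \<omega>: "\<omega> \<in> space M"
    have [measurable]: "(\<lambda>\<omega>'. first_cut_term F (jump_times \<omega>) (jump_sizes \<omega>) i (\<lambda>j. e j \<omega>')) \<in> borel_measurable M" for i
      by (rule measurable_first_cut_term[where t="\<lambda>j _. t j \<omega>" and p="\<lambda>j _. p j \<omega>"]) auto
    have [measurable]: "(\<lambda>T. ?C \<omega> T i) \<in> borel_measurable lborel" for i
      by (rule measurable_crossing[where t="\<lambda>j _. t j \<omega>" and p="\<lambda>j _. p j \<omega>"]) auto
    have "(\<integral>\<^sup>+\<omega>'. (\<Sum>i. first_cut_term F (jump_times \<omega>) (jump_sizes \<omega>) i (\<lambda>j. e j \<omega>')) \<partial>M) =
        (\<Sum>i. \<integral>\<^sup>+\<omega>'. first_cut_term F (jump_times \<omega>) (jump_sizes \<omega>) i (\<lambda>j. e j \<omega>') \<partial>M)"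
      by (rule nn_integral_suminf) measurable
    also have "\<dots> = (\<Sum>i. \<integral>\<^sup>+T. ennreal (exponential_density 1 T) * (?C \<omega> T i * indicator {0<..} T) \<partial>lborel)"
      using first_cut_term_given_path[OF ind e F F_le \<omega>] by simp
    also have "\<dots> = (\<integral>\<^sup>+T. (\<Sum>i. ennreal (exponential_density 1 T) * (?C \<omega> T i * indicator {0<..} T)) \<partial>lborel)"
      by (rule nn_integral_suminf[symmetric]) measurable
    finally show "(\<integral>\<^sup>+\<omega>'. (\<Sum>i. first_cut_term F (jump_times \<omega>) (jump_sizes \<omega>) i (\<lambda>j. e j \<omega>')) \<partial>M) =
      (\<integral>\<^sup>+T. ennreal (exponential_density 1 T) * ((\<Sum>i. ?C \<omega> T i) * indicator {0<..} T) \<partial>lborel)" by simp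
  qed
  also have "\<dots> = (\<integral>\<^sup>+T. (\<integral>\<^sup>+\<omega>. ennreal (exponential_density 1 T) * ((\<Sum>i. ?C \<omega> T i) * indicator {0<..} T) \<partial>M) \<partial>lborel)"
  proof -
    interpret pair_sigma_finite lborel M
      using sigma_finite_lborel sigma_finite_measure_axioms by (simp add: pair_sigma_finite_def)
    have [measurable]: "(\<lambda>z. ?C (snd z) (fst z) i) \<in> borel_measurable (lborel \<Otimes>\<^sub>M M)" for i
      by (rule measurable_crossing) measurable
    have "(\<lambda>z. ennreal (exponential_density 1 (fst z)) * ((\<Sum>i. ?C (snd z) (fst z) i) * indicator {0<..} (fst z))) \<in> borel_measurable (lborel \<Otimes>\<^sub>M M)"
      by measurable
    then show ?thesis by (intro Fubini') (simp add: split_beta')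
  qed
  also have "\<dots> = (\<integral>\<^sup>+T. ennreal (exponential_density 1 T) * common_integral F \<partial>lborel)"
  proof (rule nn_integral_cong_AE)
    show "AE T in lborel. (\<integral>\<^sup>+\<omega>. ennreal (exponential_density 1 T) * ((\<Sum>i. ?C \<omega> T i) * indicator {0<..} T) \<partial>M) =
      ennreal (exponential_density 1 T) * common_integral F"
      using AE_lborel_singleton[of 0]
    proof eventually_elim
      fix T :: real assume "T \<noteq> 0"
      show "(\<integral>\<^sup>+\<omega>. ennreal (exponential_density 1 T) * ((\<Sum>i. ?C \<omega> T i) * indicator {0<..} T) \<partial>M) =
        ennreal (exponential_density 1 T) * common_integral F"
      proof (cases "0 < T")
        case True
        have [measurable]: "(\<lambda>\<omega>. ?C \<omega> T i) \<in> borel_measurable M" for i by (rule measurable_crossing) auto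
        show ?thesis
          using True crossing_integral[OF F True mass] by (simp add: nn_integral_cmult)
      next
        case False
        then show ?thesis using \<open>T \<noteq> 0\<close> by (simp add: exponential_density_def)
      qed
    qed
  qed
  also have "\<dots> = (\<integral>\<^sup>+T. ennreal (exponential_density 1 T) * 1 \<partial>lborel) * common_integral F"
    by (subst nn_integral_multc[symmetric]) auto
  also have "(\<integral>\<^sup>+T. ennreal (exponential_density 1 T) * 1 \<partial>lborel) = (\<integral>\<^sup>+\<omega>. 1 \<partial>M)"
    by (rule distributed_nn_integral[OF e[of 0]]) simp
  finally show ?thesis by (simp add: emeasure_space_1)
qed

text \<open>As the common integral of \<open>1\<close> is \<open>1\<close>, there is exactly one first cut almost surely.\<close>

theorem first_cut_law:
  assumes ind: "indep_vars (\<lambda>_. borel) e UNIV"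
    and e: "\<And>i. distributed M lborel (e i) (exponential_density 1)"
    and indep: "indep_rvs M (\<Pi>\<^sub>M i\<in>UNIV. borel) (\<lambda>\<omega> i. (t i \<omega>, p i \<omega>)) (\<Pi>\<^sub>M i\<in>UNIV. borel) (\<lambda>\<omega> i. e i \<omega>)"
    and mass: "AE \<omega> in M. 0 < mass_one \<omega> \<and> mass_one \<omega> < \<infinity>" and one: "common_integral (\<lambda>_. 1) = 1"
    and F [measurable]: "F \<in> borel_measurable triple_space" and F_le: "\<And>z. F z \<le> 1"
  shows "(\<integral>\<^sup>+\<omega>. (let \<Gamma> = cut_level (jump_times \<omega>) (jump_sizes \<omega>) (\<lambda>i. e i \<omega>) in
      F (undershoot (jump_times \<omega>) (jump_sizes \<omega>) \<Gamma> / \<Gamma>,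
        points borel (uncut_before_first (jump_times \<omega>) (jump_sizes \<omega>) (\<lambda>i. e i \<omega>)) (\<lambda>i. p i \<omega> / \<Gamma>),
        overshoot (jump_times \<omega>) (jump_sizes \<omega>) \<Gamma> / \<Gamma>)) \<partial>M) = common_integral F"
    (is "(\<integral>\<^sup>+\<omega>. ?Y \<omega> \<partial>M) = _")
proof -
  let ?f = "\<lambda>F \<omega> i. first_cut_term F (jump_times \<omega>) (jump_sizes \<omega>) i (\<lambda>j. e j \<omega>)"
  let ?c = "\<lambda>\<omega> i. is_first_cut (jump_times \<omega>) (jump_sizes \<omega>) i (\<lambda>j. e j \<omega>)"
  have [measurable]: "e j \<in> borel_measurable M" for j using distributed_measurable[OF e[of j]] by simp
  have [measurable]: "(\<lambda>\<omega>. ?f (\<lambda>_. 1) \<omega> i) \<in> borel_measurable M" for i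
    by (rule measurable_first_cut_term) simp_all
  have "(\<integral>\<^sup>+\<omega>. ?Y \<omega> \<partial>M) = (\<integral>\<^sup>+\<omega>. (\<Sum>i. ?f F \<omega> i) \<partial>M)"
  proof (rule nn_integral_unique_index[where c="?c" and g="?f (\<lambda>_. 1)"])
    show "(\<integral>\<^sup>+\<omega>. (\<Sum>i. ?f (\<lambda>_. 1) \<omega> i) \<partial>M) = 1"
      using first_cut_integral[OF ind e indep mass, of "\<lambda>_. 1"] one by simp
    show "AE \<omega> in M. \<forall>i. ?c \<omega> i \<longrightarrow> ?f (\<lambda>_. 1) \<omega> i = 1 \<and> ?f F \<omega> i = ?Y \<omega> \<and> (\<forall>k. ?c \<omega> k \<longrightarrow> k = i)"
      using distinct_times AE_space
    proof eventually_elim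
      case (elim \<omega>)
      note path = is_first_cut_path[OF elim(1) t_pos[OF elim(2)]]
      show ?case
      proof (intro allI impI conjI)
        fix i assume i: "?c \<omega> i"
        show "?f (\<lambda>_. 1) \<omega> i = 1" "?f F \<omega> i = ?Y \<omega>" unfolding path(4)[OF i] Let_def by simp_all
        show "k = i" if "?c \<omega> k" for k using path(1)[OF i] path(1)[OF that] by simp
      qed
    qed
  qed (simp_all add: first_cut_term_eq_0)
  also have "\<dots> = common_integral F" by (rule first_cut_integral[OF ind e indep mass F F_le])
  finally show ?thesis .
qed

end

section \<open>Equality of the three laws\<close>

lemma measurable_first_cut:
  assumes [measurable]: "\<And>j. t j \<in> borel_measurable N" "\<And>j. p j \<in> borel_measurable N" "\<And>j. e j \<in> borel_measurable N"
  shows "(\<lambda>\<omega>. first_cut (\<lambda>j. t j \<omega>) (\<lambda>j. p j \<omega>) (\<lambda>j. e j \<omega>)) \<in> N \<rightarrow>\<^sub>M count_space UNIV"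
  unfolding first_cut_def is_arg_min_def by measurable

lemma measurable_uncut_before_first:
  assumes [measurable]: "\<And>j. t j \<in> borel_measurable N" "\<And>j. p j \<in> borel_measurable N" "\<And>j. e j \<in> borel_measurable N"
  shows "Measurable.pred N (\<lambda>\<omega>. i \<in> uncut_before_first (\<lambda>j. t j \<omega>) (\<lambda>j. p j \<omega>) (\<lambda>j. e j \<omega>))"
proof -
  have [measurable]: "(\<lambda>\<omega>. t (first_cut (\<lambda>j. t j \<omega>) (\<lambda>j. p j \<omega>) (\<lambda>j. e j \<omega>)) \<omega>) \<in> borel_measurable N"
    by (rule measurable_compose_countable[OF _ measurable_first_cut]) measurable
  show ?thesis unfolding uncut_before_first_def mem_Collect_eq by measurable
qed

lemma measurable_cut_level:
  assumes [measurable]: "\<And>j. t j \<in> borel_measurable N" "\<And>j. p j \<in> borel_measurable N" "\<And>j. e j \<in> borel_measurable N"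
  shows "(\<lambda>\<omega>. cut_level (\<lambda>j. t j \<omega>) (\<lambda>j. p j \<omega>) (\<lambda>j. e j \<omega>)) \<in> borel_measurable N"
proof -
  have [measurable]: "(\<lambda>\<omega>. e (first_cut (\<lambda>j. t j \<omega>) (\<lambda>j. p j \<omega>) (\<lambda>j. e j \<omega>)) \<omega>) \<in> borel_measurable N"
    by (rule measurable_compose_countable[OF _ measurable_first_cut]) measurable
  have [measurable]: "Measurable.pred N (\<lambda>\<omega>. i \<in> uncut_before_first (\<lambda>j. t j \<omega>) (\<lambda>j. p j \<omega>) (\<lambda>j. e j \<omega>))" for i
    by (rule measurable_uncut_before_first) measurable
  show ?thesis unfolding cut_level_def infsum_ennreal_nat by measurable
qed

lemma eq_in_lawI:
  assumes "X \<in> M \<rightarrow>\<^sub>M S" "Y \<in> M \<rightarrow>\<^sub>M S"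
    and "\<And>A. A \<in> sets S \<Longrightarrow> (\<integral>\<^sup>+\<omega>. indicator A (X \<omega>) \<partial>M) = (\<integral>\<^sup>+\<omega>. indicator A (Y \<omega>) \<partial>M)"
  shows "eq_in_law M S X Y"
  unfolding eq_in_law_def
proof (intro conjI assms(1,2) measure_eqI)
  fix A assume "A \<in> sets (distr M S X)"
  then have A: "A \<in> sets S" by simp
  have "(\<integral>\<^sup>+\<omega>. indicator A (Z \<omega>) \<partial>M) = emeasure (distr M S Z) A" if "Z \<in> M \<rightarrow>\<^sub>M S" for Z
    using that A by (subst nn_integral_distr[symmetric, of Z M S]) auto
  then show "emeasure (distr M S X) A = emeasure (distr M S Y) A"
    using assms(1,2) assms(3)[OF A] by simp
qed simp

theorem theorem3p3:
  fixes M :: "'w measure"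
    and \<alpha> T :: real
    and t p e :: "nat \<Rightarrow> 'w \<Rightarrow> real"
    and W :: "nat \<Rightarrow> 'w \<Rightarrow> real"
    and U :: "'w \<Rightarrow> real"
  assumes "prob_space M"
    and "0 < \<alpha>" "\<alpha> < 1" "0 < T"
    and "poisson_point_process M (stable_intensity \<alpha>) (\<lambda>i \<omega>. (t i \<omega>, p i \<omega>))"
    and "prob_space.indep_vars M (\<lambda>_. borel) e UNIV"
    and "\<And>i. distributed M lborel (e i) (exponential_density 1)"
    and "indep_rvs M (\<Pi>\<^sub>M i\<in>UNIV. borel) (\<lambda>\<omega> i. (t i \<omega>, p i \<omega>))
                     (\<Pi>\<^sub>M i\<in>UNIV. borel) (\<lambda>\<omega> i. e i \<omega>)"
    and "size_biased_ordering M (\<lambda>i \<omega>. jump_partition (\<lambda>i. t i \<omega>) (\<lambda>i. p i \<omega>) i) W"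
    and "distr M lborel U = uniform_measure lborel {0<..<1}"
    and "indep_rvs M borel U (\<Pi>\<^sub>M n\<in>UNIV. borel) (\<lambda>\<omega> n. W n \<omega>)"
  shows
    "let
       S = borel \<Otimes>\<^sub>M measure_algebra borel \<Otimes>\<^sub>M borel;
       L = (\<lambda>\<omega>. inverse_subordinator (\<lambda>i. t i \<omega>) (\<lambda>i. p i \<omega>));
       A = (\<lambda>\<omega>. undershoot (\<lambda>i. t i \<omega>) (\<lambda>i. p i \<omega>));
       B = (\<lambda>\<omega>. overshoot (\<lambda>i. t i \<omega>) (\<lambda>i. p i \<omega>));
       G = (\<lambda>\<omega>. cut_level (\<lambda>i. t i \<omega>) (\<lambda>i. p i \<omega>) (\<lambda>i. e i \<omega>));
       J = (\<lambda>\<omega>. uncut_before_first (\<lambda>i. t i \<omega>) (\<lambda>i. p i \<omega>) (\<lambda>i. e i \<omega>));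
       X = (\<lambda>\<omega>. (A \<omega> T / T, points borel {i. t i \<omega> < L \<omega> T} (\<lambda>i. p i \<omega> / T), B \<omega> T / T));
       Y = (\<lambda>\<omega>. (A \<omega> (G \<omega>) / G \<omega>, points borel (J \<omega>) (\<lambda>i. p i \<omega> / G \<omega>), B \<omega> (G \<omega>) / G \<omega>));
       Z = (\<lambda>\<omega>. (W 0 \<omega>, points borel {1..} (\<lambda>j. W j \<omega>), W 0 \<omega> * (1 / U \<omega> powr (1 / \<alpha>) - 1)))
     in eq_in_law M S X Y \<and> eq_in_law M S Y Z"
proof -
  interpret prob_space M by fact
  interpret stable_points M \<alpha> t p
    by unfold_locales (use assms in auto)
  define A where "A \<omega> = undershoot (\<lambda>i. t i \<omega>) (\<lambda>i. p i \<omega>)" for \<omega>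
  define B where "B \<omega> = overshoot (\<lambda>i. t i \<omega>) (\<lambda>i. p i \<omega>)" for \<omega>
  define L where "L \<omega> = inverse_subordinator (\<lambda>i. t i \<omega>) (\<lambda>i. p i \<omega>)" for \<omega>
  define G where "G \<omega> = cut_level (\<lambda>i. t i \<omega>) (\<lambda>i. p i \<omega>) (\<lambda>i. e i \<omega>)" for \<omega>
  define J where "J \<omega> = uncut_before_first (\<lambda>i. t i \<omega>) (\<lambda>i. p i \<omega>) (\<lambda>i. e i \<omega>)" for \<omega>
  define X where "X \<omega> = (A \<omega> T / T, points borel {i. t i \<omega> < L \<omega> T} (\<lambda>i. p i \<omega> / T), B \<omega> T / T)" for \<omega>
  define Y where "Y \<omega> = (A \<omega> (G \<omega>) / G \<omega>, points borel (J \<omega>) (\<lambda>i. p i \<omega> / G \<omega>), B \<omega> (G \<omega>) / G \<omega>)" for \<omega>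
  define Z where "Z \<omega> = (W 0 \<omega>, points borel {1..} (\<lambda>j. W j \<omega>), W 0 \<omega> * (1 / U \<omega> powr (1 / \<alpha>) - 1))" for \<omega>
  have e_meas [measurable]: "e j \<in> borel_measurable M" for j
    using distributed_measurable[OF assms(7)[of j]] by simp
  have U_meas [measurable]: "U \<in> borel_measurable M"
    and W_seq: "(\<lambda>\<omega> n. W n \<omega>) \<in> M \<rightarrow>\<^sub>M (\<Pi>\<^sub>M n\<in>UNIV. borel)"
    using assms(11) by (auto simp: indep_rvs_def)
  have W_meas [measurable]: "W n \<in> borel_measurable M" for n
    using measurable_compose[OF W_seq measurable_component_singleton[of n UNIV]] by simp
  have G_meas [measurable]: "G \<in> borel_measurable M"
    unfolding G_def by (rule measurable_cut_level) measurable
  have [measurable]: "Measurable.pred M (\<lambda>\<omega>. i \<in> J \<omega>)" for i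
    unfolding J_def by (rule measurable_uncut_before_first) measurable
  have [measurable]: "(\<lambda>\<omega>. L \<omega> T) \<in> borel_measurable M" "(\<lambda>\<omega>. A \<omega> T) \<in> borel_measurable M" "(\<lambda>\<omega>. B \<omega> T) \<in> borel_measurable M"
    unfolding L_def A_def B_def
    by (rule measurable_inverse_subordinator measurable_undershoot measurable_overshoot; simp)+
  have [measurable]: "(\<lambda>\<omega>. A \<omega> (G \<omega>)) \<in> borel_measurable M" "(\<lambda>\<omega>. B \<omega> (G \<omega>)) \<in> borel_measurable M"
    unfolding A_def B_def by (rule measurable_undershoot measurable_overshoot; simp)+
  have [measurable]: "(\<lambda>\<omega>. points borel {i. t i \<omega> < L \<omega> T} (\<lambda>i. p i \<omega> / T)) \<in> M \<rightarrow>\<^sub>M measure_algebra borel"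
    "(\<lambda>\<omega>. points borel (J \<omega>) (\<lambda>i. p i \<omega> / G \<omega>)) \<in> M \<rightarrow>\<^sub>M measure_algebra borel"
    "(\<lambda>\<omega>. points borel {1..} (\<lambda>j. W j \<omega>)) \<in> M \<rightarrow>\<^sub>M measure_algebra borel"
    by (rule measurable_points; simp)+
  have X: "X \<in> M \<rightarrow>\<^sub>M triple_space" unfolding X_def by measurable
  have Y: "Y \<in> M \<rightarrow>\<^sub>M triple_space" unfolding Y_def by measurable
  have Z: "Z \<in> M \<rightarrow>\<^sub>M triple_space" unfolding Z_def by measurable
  have Z_law: "(\<integral>\<^sup>+\<omega>. F (Z \<omega>) \<partial>M) = common_integral F" if "F \<in> borel_measurable triple_space" for F
    unfolding Z_def by (rule size_biased_law(2)[OF assms(9,10,11) that])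
  have mass: "AE \<omega> in M. 0 < mass_one \<omega> \<and> mass_one \<omega> < \<infinity>"
    by (rule size_biased_law(1)[OF assms(9,10,11), of "\<lambda>_. 1"]) simp
  \<comment> \<open>The total mass of the law of the size-biased triple\<close>
  have one: "common_integral (\<lambda>_. 1) = 1"
    using Z_law[of "\<lambda>_. 1"] by (simp add: emeasure_space_1)
  have X_law: "(\<integral>\<^sup>+\<omega>. F (X \<omega>) \<partial>M) = common_integral F" if "F \<in> borel_measurable triple_space" for F
    unfolding X_def A_def B_def L_def by (rule fixed_level_law[OF mass one that \<open>0 < T\<close>])
  have Y_law: "(\<integral>\<^sup>+\<omega>. F (Y \<omega>) \<partial>M) = common_integral F"
    if "F \<in> borel_measurable triple_space" "\<And>z. F z \<le> 1" for F
    using first_cut_law[OF assms(6,7,8) mass one that]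
    unfolding Y_def A_def B_def G_def J_def Let_def .
  have ind: "(\<lambda>z. indicator C z :: ennreal) \<in> borel_measurable triple_space" "indicator C z \<le> (1 :: ennreal)"
    if "C \<in> sets triple_space" for C z
    using that by (auto simp: indicator_def)
  have "eq_in_law M triple_space X Y"
    using X_law[OF ind(1)] Y_law[OF ind] by (intro eq_in_lawI X Y) simp
  moreover have "eq_in_law M triple_space Y Z"
    using Z_law[OF ind(1)] Y_law[OF ind] by (intro eq_in_lawI Y Z) simp
  ultimately show ?thesis
    unfolding Let_def X_def[abs_def] Y_def[abs_def] Z_def[abs_def] A_def B_def G_def J_def L_def ..
qed

end
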